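(* Let $r$ and $s$ be integers with $2\le s\le r$, and let $\ell$ be the smallest positive integer such that $\lceil r\cdot 2^{-\ell}\rceil<s$. Then $$\mathbf{RT}_r(n,K_{r+s},o(n))\ge 2^{-\ell-2}n^2+o(n^2),$$ that is, $\theta_r(K_{r+s})\ge 2^{-\ell-2}$.
   Context: For a graph $G$, the $K_r$-independence number is $\alpha_r(G)=\max\{|S|: S\subseteq V(G),\ G[S]\text{ is }K_r\text{-free}\}$. For a graph $H$ and a function $f$, $\mathbf{RT}_r(n,H,f(n))$ denotes the maximum number of edges in an $H$-free graph $G$ on $n$ vertices with $\alpha_r(G)\le f(n)$. The $r$-Ramsey–Turán number of $H$ is $\theta_r(H)=\lim_{\epsilon\to 0}\lim_{n\to\infty}\frac{1}{n^2}\mathbf{RT}_r(n,H,\epsilon n)$ (this limit exists when $H$ is a complete graph), and one writes $\mathbf{RT}_r(n,H,o(n))=\theta_r(H)n^2+o(n^2)$. $K_t$ denotes the complete graph on $t$ vertices. *)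

theory Defs
  imports Complex_Main
begin

type_synonym 'a sgraph = "'a set \<times> 'a set set"

abbreviation verts :: "'a sgraph \<Rightarrow> 'a set" where
  "verts G \<equiv> fst G"

abbreviation edges :: "'a sgraph \<Rightarrow> 'a set set" where
  "edges G \<equiv> snd G"

definition simple_graph :: "'a sgraph \<Rightarrow> bool" where
  "simple_graph G \<longleftrightarrow> finite (verts G) \<and> (\<forall>e \<in> edges G. e \<subseteq> verts G \<and> card e = 2)"

definition complete_graph :: "nat \<Rightarrow> nat sgraph" where
  "complete_graph t = ({..<t}, {e. e \<subseteq> {..<t} \<and> card e = 2})"

definition induced :: "'a sgraph \<Rightarrow> 'a set \<Rightarrow> 'a sgraph" where
  "induced G S = (S, {e \<in> edges G. e \<subseteq> S})"

text \<open>\<open>G\<close> contains \<open>H\<close> as a subgraph, not necessarily induced.\<close>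

definition contains_copy :: "'a sgraph \<Rightarrow> 'b sgraph \<Rightarrow> bool" where
  "contains_copy G H \<longleftrightarrow>
     (\<exists>f. inj_on f (verts H) \<and> f ` verts H \<subseteq> verts G \<and> (\<forall>e \<in> edges H. f ` e \<in> edges G))"

definition free_of :: "'b sgraph \<Rightarrow> 'a sgraph \<Rightarrow> bool" where
  "free_of H G \<longleftrightarrow> \<not> contains_copy G H"

definition alpha :: "nat \<Rightarrow> 'a sgraph \<Rightarrow> nat" where
  "alpha r G = Max {card S | S. S \<subseteq> verts G \<and> free_of (complete_graph r) (induced G S)}"

text \<open>
  Up to isomorphism every finite graph has its vertices in \<^typ>\<open>nat\<close>. The supremum is over a
  finite set of naturals, hence a maximum; it is \<open>0\<close> if no graph qualifies. The real number \<open>x\<close>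
  is the value \<open>f(n)\<close> bounding the \<open>K\<^sub>r\<close>-independence number.
\<close>

definition RT :: "nat \<Rightarrow> nat \<Rightarrow> 'b sgraph \<Rightarrow> real \<Rightarrow> nat" where
  "RT r n H x = Sup {card (edges G) | G :: nat sgraph.
     simple_graph G \<and> card (verts G) = n \<and> free_of H G \<and> real (alpha r G) \<le> x}"

definition theta :: "nat \<Rightarrow> 'b sgraph \<Rightarrow> real" where
  "theta r H =
     Lim (at_right 0) (\<lambda>\<epsilon>::real. lim (\<lambda>n::nat. real (RT r n H (\<epsilon> * real n)) / (real n)\<^sup>2))"

end

theory Submission
  imports Defs "HOL-Analysis.Analysis"
begin

text \<open>
  The extremal graphs generalise the Bollobas-Erdos graph, with the high-dimensional sphere replaced
  by sign matrices. A \<open>d \<times> d\<close> matrix of signs is described by its vector of row sums; by the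
  Poincare inequality on the cube, any two dense sets of matrices contain matrices whose row-sum
  vectors are opposite up to an error of size \<open>O(d)\<close> in squared norm, whereas by the
  Littlewood-Offord inequality the inner product of two row-sum vectors rarely has modulus \<open>O(d)\<close>.
  So the relation ``large positive inner product'' has density about \<open>1/2\<close>, and no two nearly
  opposite pairs are completely related: the inner product of the two sums is at most \<open>O(d)\<close>.

  Take \<open>l\<close>-tuples of matrices and join two parts when all \<open>l\<close> coordinates are related (density
  \<open>2\<^sup>-\<^sup>l\<close>). Inside a part, every dense set contains \<open>r\<close> tuples arranged along a binary tree
  of depth \<open>l\<close>: where two of them first branch, their coordinates are nearly opposite. A random
  sparse \<open>r\<close>-uniform hypergraph of such \<open>r\<close>-sets, in a blow-up and with its short cycles removed,
  still meets all dense sets, and a clique of its shadow lies in a single hyperedge. A clique of the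
  whole graph then gives two subsets of the tree that branch at disjoint sets of levels, which limits
  its size to \<open>r + \<lceil>r / 2\<^sup>l\<rceil>\<close>.
\<close>

section \<open>Concentration on the discrete cube\<close>

text \<open>The scales make the two relations compatible. A typical row sum has size about
  \<open>sqrt d\<close>, so a row-sum vector has squared norm about \<open>d^2\<close> and two of
  them have inner product about \<open>d^(3/2)\<close>. The threshold \<open>K * d\<close> is
  negligible against that, while \<open>K\<close> depends only on the density demanded of the sets,
  not on \<open>d\<close>. The exponent: the \<open>l\<close> related coordinates cost
  \<open>2^(-l)\<close>, and counting the \<open>X * X\<close> cross pairs against the square of the
  \<open>2 * card X\<close> vertices costs another factor 4. Of the choice of \<open>l\<close> two
  facts survive: \<open>r \<le> (s - 1) * 2 ^ l\<close> turns the clique bound into less than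
  \<open>r + s\<close>, and minimality gives \<open>2 ^ (l - 1) < r\<close>, needed when the tree
  has at least \<open>r\<close> leaves. A separate obstacle is that \<open>theta\<close> is built
  from \<open>lim\<close> and \<open>Lim\<close>, which have some value even without convergence.
  Dense graphs of suitable orders therefore do not suffice; both limits must be shown to exist. They
  do because an optimal graph can be blown up to every large order. Rounding would spoil the bound
  \<open>\<epsilon> * n\<close> on clique-free sets, and a bounded number of extra vertices
  satisfying the bound with \<open>\<epsilon> / 2\<close> repairs this; the constructed graphs
  supply them.\<close>

definition flip :: "'a \<Rightarrow> 'a set \<Rightarrow> 'a set" where
  "flip c x = (if c \<in> x then x - {c} else insert c x)"

lemma flip_flip [simp]: "flip c (flip c x) = x"
  by (auto simp: flip_def)

lemma bij_betw_flip: "c \<in> C \<Longrightarrow> bij_betw (flip c) (Pow C) (Pow C)"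
  by (rule bij_betwI[where g = "flip c"]) (auto simp: flip_def split: if_splits)

lemma flip_insert: "c \<noteq> k \<Longrightarrow> flip c (insert k x) = insert k (flip c x)"
  by (auto simp: flip_def)

lemma sum_Pow_insert:
  fixes f :: "'a set \<Rightarrow> real"
  assumes "finite C" "c \<notin> C"
  shows "sum f (Pow (insert c C)) = (\<Sum>x\<in>Pow C. f x) + (\<Sum>x\<in>Pow C. f (insert c x))"
proof -
  have inj: "inj_on (insert c) (Pow C)"
    using assms by (auto simp: inj_on_def)
  have "sum f (Pow (insert c C)) = sum f (Pow C \<union> insert c ` Pow C)"
    by (simp add: Pow_insert)
  also have "\<dots> = sum f (Pow C) + sum f (insert c ` Pow C)"
    using assms by (intro sum.union_disjoint) auto
  also have "sum f (insert c ` Pow C) = (\<Sum>x\<in>Pow C. f (insert c x))"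
    using inj by (simp add: sum.reindex)
  finally show ?thesis .
qed

text \<open>The Poincare (Efron-Stein) inequality without normalisation: the left side is
  \<open>4 ^ card C\<close> times the variance. The constant 1/4 comes from the variance
  \<open>(a - b)^2 / 4\<close> of a fair choice between two values. The induction splits the cube
  into two halves along a new direction.\<close>

lemma poincare_cube:
  fixes F :: "'a set \<Rightarrow> real"
  assumes "finite C"
  shows "2 ^ card C * (\<Sum>x\<in>Pow C. (F x)\<^sup>2) - (\<Sum>x\<in>Pow C. F x)\<^sup>2
    \<le> 2 ^ card C / 4 * (\<Sum>x\<in>Pow C. \<Sum>c\<in>C. (F (flip c x) - F x)\<^sup>2)"
  using assms
proof (induction C arbitrary: F rule: finite_induct)
  case empty
  then show ?case by simp
next
  case (insert k C)
  let ?N = "2 ^ card C :: real"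
  define F1 where "F1 x = F (insert k x)" for x
  define G where "G f = (\<Sum>x\<in>Pow C. \<Sum>c\<in>C. (f (flip c x) - f x)\<^sup>2)" for f :: "'a set \<Rightarrow> real"
  define S0 where "S0 = (\<Sum>x\<in>Pow C. F x)"
  define S1 where "S1 = (\<Sum>x\<in>Pow C. F1 x)"
  define Q0 where "Q0 = (\<Sum>x\<in>Pow C. (F x)\<^sup>2)"
  define Q1 where "Q1 = (\<Sum>x\<in>Pow C. (F1 x)\<^sup>2)"
  define D where "D = (\<Sum>x\<in>Pow C. (F1 x - F x)\<^sup>2)"
  have i0: "?N * Q0 - S0\<^sup>2 \<le> ?N / 4 * G F"
    unfolding Q0_def S0_def G_def by (rule insert.IH)
  have i1: "?N * Q1 - S1\<^sup>2 \<le> ?N / 4 * G F1"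
    unfolding Q1_def S1_def G_def by (rule insert.IH)
  have "S1 - S0 = (\<Sum>x\<in>Pow C. F1 x - F x)"
    by (simp add: S0_def S1_def sum_subtractf)
  then have d: "(S1 - S0)\<^sup>2 \<le> ?N * D"
    using sum_squared_le_sum_of_squares[of "\<lambda>x. F1 x - F x" "Pow C"] insert.hyps
    by (simp add: D_def card_Pow mult.commute)
  have a0: "(\<Sum>c\<in>insert k C. (F (flip c x) - F x)\<^sup>2)
      = (F1 x - F x)\<^sup>2 + (\<Sum>c\<in>C. (F (flip c x) - F x)\<^sup>2)" if "x \<in> Pow C" for x
    using that insert.hyps by (auto simp: flip_def F1_def)
  have a1: "(\<Sum>c\<in>insert k C. (F (flip c (insert k x)) - F (insert k x))\<^sup>2)
      = (F1 x - F x)\<^sup>2 + (\<Sum>c\<in>C. (F1 (flip c x) - F1 x)\<^sup>2)" if "x \<in> Pow C" for x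
  proof -
    have "k \<notin> x" using that insert.hyps by auto
    then have "flip k (insert k x) = x" by (auto simp: flip_def)
    moreover have "(\<Sum>c\<in>C. (F (flip c (insert k x)) - F (insert k x))\<^sup>2)
      = (\<Sum>c\<in>C. (F1 (flip c x) - F1 x)\<^sup>2)"
      using insert.hyps by (intro sum.cong refl) (metis F1_def flip_insert)
    ultimately show ?thesis
      using insert.hyps by (simp add: F1_def power2_commute)
  qed
  have g: "(\<Sum>x\<in>Pow (insert k C). \<Sum>c\<in>insert k C. (F (flip c x) - F x)\<^sup>2) = 2 * D + G F + G F1"
  proof -
    have "(\<Sum>x\<in>Pow C. \<Sum>c\<in>insert k C. (F (flip c x) - F x)\<^sup>2) = D + G F"
      unfolding D_def G_def sum.distrib[symmetric] by (intro sum.cong refl a0)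
    moreover have "(\<Sum>x\<in>Pow C. \<Sum>c\<in>insert k C. (F (flip c (insert k x)) - F (insert k x))\<^sup>2)
        = D + G F1"
      unfolding D_def G_def sum.distrib[symmetric] by (intro sum.cong refl a1)
    ultimately show ?thesis
      by (simp only: sum_Pow_insert[OF insert.hyps])
  qed
  have s: "(\<Sum>x\<in>Pow (insert k C). F x) = S0 + S1"
    "(\<Sum>x\<in>Pow (insert k C). (F x)\<^sup>2) = Q0 + Q1"
    by (simp_all add: sum_Pow_insert[OF insert.hyps] S0_def S1_def Q0_def Q1_def F1_def)
  \<comment> \<open>Variance within the two halves plus the difference of their means. The latter is
    bounded, via Cauchy-Schwarz in \<open>d\<close>, by the differences along the new direction
    \<open>k\<close>.\<close>
  have "2 * ?N * (Q0 + Q1) - (S0 + S1)\<^sup>2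
      = 2 * (?N * Q0 - S0\<^sup>2) + 2 * (?N * Q1 - S1\<^sup>2) + (S1 - S0)\<^sup>2"
    by (simp add: power2_eq_square algebra_simps)
  also have "\<dots> \<le> 2 * (?N / 4 * G F) + 2 * (?N / 4 * G F1) + ?N * D"
    using i0 i1 d by (intro add_mono mult_left_mono) auto
  also have "\<dots> = 2 * ?N / 4 * (2 * D + G F + G F1)"
    by (simp add: algebra_simps)
  finally show ?case
    unfolding g s using insert.hyps by simp
qed

text \<open>A distance to a set is easily bounded only upwards when a point moves, because the old
  nearest point is merely a candidate for the new position. A decrease along a cube edge is an
  increase seen from its other end, so every edge is charged to one of its ends; using the bounds at
  both ends costs a factor 2.\<close>

lemma poincare_cube_one_sided:
  fixes F :: "'a set \<Rightarrow> real" and b :: "'a set \<Rightarrow> 'a \<Rightarrow> real"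
  assumes C: "finite C"
    and b: "\<And>x c. x \<subseteq> C \<Longrightarrow> c \<in> C \<Longrightarrow> 0 \<le> b x c"
    and up: "\<And>x c. x \<subseteq> C \<Longrightarrow> c \<in> C \<Longrightarrow> F (flip c x) - F x \<le> b x c"
    and V: "\<And>x. x \<subseteq> C \<Longrightarrow> (\<Sum>c\<in>C. (b x c)\<^sup>2) \<le> V"
  shows "2 ^ card C * (\<Sum>x\<in>Pow C. (F x)\<^sup>2) - (\<Sum>x\<in>Pow C. F x)\<^sup>2 \<le> V / 2 * (2 ^ card C)\<^sup>2"
proof -
  have fl: "flip c x \<subseteq> C" if "x \<subseteq> C" "c \<in> C" for x c
    using that by (auto simp: flip_def)
  have "(F (flip c x) - F x)\<^sup>2 \<le> (b x c)\<^sup>2 + (b (flip c x) c)\<^sup>2" if "x \<subseteq> C" "c \<in> C" for x c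
  proof (cases "F x \<le> F (flip c x)")
    case True
    then have "(F (flip c x) - F x)\<^sup>2 \<le> (b x c)\<^sup>2"
      using up[OF that] by (intro power_mono) auto
    then show ?thesis by (smt (verit) zero_le_power2)
  next
    case False
    then have "(F x - F (flip c x))\<^sup>2 \<le> (b (flip c x) c)\<^sup>2"
      using up[OF fl[OF that] that(2)] by (intro power_mono) auto
    then show ?thesis by (smt (verit) zero_le_power2 power2_commute)
  qed
  then have "(\<Sum>x\<in>Pow C. \<Sum>c\<in>C. (F (flip c x) - F x)\<^sup>2)
      \<le> (\<Sum>x\<in>Pow C. \<Sum>c\<in>C. (b x c)\<^sup>2 + (b (flip c x) c)\<^sup>2)"
    by (intro sum_mono) auto
  also have "\<dots> = (\<Sum>x\<in>Pow C. \<Sum>c\<in>C. (b x c)\<^sup>2) + (\<Sum>c\<in>C. \<Sum>x\<in>Pow C. (b (flip c x) c)\<^sup>2)"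
    by (simp add: sum.distrib sum.swap[of _ "Pow C"])
  also have "(\<Sum>c\<in>C. \<Sum>x\<in>Pow C. (b (flip c x) c)\<^sup>2) = (\<Sum>c\<in>C. \<Sum>x\<in>Pow C. (b x c)\<^sup>2)"
    by (intro sum.cong refl sum.reindex_bij_betw[OF bij_betw_flip])
  also have "\<dots> = (\<Sum>x\<in>Pow C. \<Sum>c\<in>C. (b x c)\<^sup>2)"
    by (rule sum.swap)
  also have "\<dots> + \<dots> \<le> 2 * (\<Sum>x\<in>Pow C. V)"
    using sum_mono[of "Pow C" "\<lambda>x. \<Sum>c\<in>C. (b x c)\<^sup>2" "\<lambda>_. V"] V by simp
  also have "\<dots> = 2 * (2 ^ card C * V)"
    using C by (simp add: card_Pow)
  finally have "2 ^ card C / 4 * (\<Sum>x\<in>Pow C. \<Sum>c\<in>C. (F (flip c x) - F x)\<^sup>2)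
      \<le> 2 ^ card C / 4 * (2 * (2 ^ card C * V))"
    by (intro mult_left_mono) auto
  also have "\<dots> = V / 2 * (2 ^ card C)\<^sup>2"
    by (simp add: power2_eq_square)
  finally show ?thesis
    using poincare_cube[OF C, of F] by linarith
qed

section \<open>Sign matrices and the distances of their row-sum vectors\<close>

definition sgn_of :: "'a set \<Rightarrow> 'a \<Rightarrow> real" where
  "sgn_of x c = (if c \<in> x then 1 else - 1)"

definition grid :: "nat \<Rightarrow> (nat \<times> nat) set" where
  "grid d = {..<d} \<times> {..<d}"

definition rowsum :: "nat \<Rightarrow> (nat \<times> nat) set \<Rightarrow> nat \<Rightarrow> real" where
  "rowsum d x i = (\<Sum>j<d. sgn_of x (i, j))"

lemma finite_grid [simp]: "finite (grid d)"
  by (simp add: grid_def)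

lemma rowsum_flip_other: "i' \<noteq> i \<Longrightarrow> rowsum d (flip (i, j) x) i' = rowsum d x i'"
  unfolding rowsum_def by (intro sum.cong) (auto simp: sgn_of_def flip_def)

lemma rowsum_flip:
  assumes "j < d"
  shows "\<bar>rowsum d (flip (i, j) x) i - rowsum d x i\<bar> = 2"
proof -
  have "rowsum d (flip (i, j) x) i - rowsum d x i
      = (\<Sum>j'<d. sgn_of (flip (i, j) x) (i, j') - sgn_of x (i, j'))"
    by (simp add: rowsum_def sum_subtractf)
  also have "\<dots> = (\<Sum>j'<d. if j' = j then (if (i, j) \<in> x then - 2 else 2) else 0)"
    by (intro sum.cong refl; cases "(i, j) \<in> x";
        simp only: sgn_of_def flip_def if_True if_False insert_iff Diff_iff prod.inject; simp)
  also have "\<dots> = (if (i, j) \<in> x then - 2 else 2)"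
    using assms by (simp only: sum.delta finite_lessThan lessThan_iff if_True)
  finally show ?thesis by simp
qed

lemma rowsum_compl: "rowsum d (grid d - x) i = - rowsum d x i" if "i < d"
  using that unfolding rowsum_def sum_negf[symmetric]
  by (intro sum.cong) (auto simp: sgn_of_def grid_def)

definition rdist :: "nat \<Rightarrow> (nat \<times> nat) set \<Rightarrow> (nat \<times> nat) set \<Rightarrow> real" where
  "rdist d x a = (\<Sum>i<d. (rowsum d x i - rowsum d a i)\<^sup>2)"

lemma rdist_nonneg: "0 \<le> rdist d x a"
  by (simp add: rdist_def sum_nonneg)

lemma rdist_flip:
  assumes "i < d" "j < d"
  shows "rdist d (flip (i, j) x) a \<le> rdist d x a + 4 * \<bar>rowsum d x i - rowsum d a i\<bar> + 4"
proof -
  let ?u = "rowsum d x i - rowsum d a i" and ?u' = "rowsum d (flip (i, j) x) i - rowsum d a i"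
  have "\<bar>?u' - ?u\<bar> = 2"
    using rowsum_flip[OF assms(2), of i x] by simp
  then have "?u' = ?u + 2 \<or> ?u' = ?u - 2" by linarith
  moreover have "(t + 2)\<^sup>2 \<le> t\<^sup>2 + 4 * \<bar>t\<bar> + 4" "(t - 2)\<^sup>2 \<le> t\<^sup>2 + 4 * \<bar>t\<bar> + 4" for t :: real
    by (auto simp: power2_eq_square algebra_simps abs_if)
  ultimately have u: "?u'\<^sup>2 \<le> ?u\<^sup>2 + 4 * \<bar>?u\<bar> + 4"
    by metis
  have "rdist d (flip (i, j) x) a = ?u'\<^sup>2 + (\<Sum>i'\<in>{..<d}-{i}. (rowsum d x i' - rowsum d a i')\<^sup>2)"
    unfolding rdist_def using assms
    by (subst sum.remove[of _ i]) (auto simp: rowsum_flip_other intro!: sum.cong)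
  moreover have "rdist d x a = ?u\<^sup>2 + (\<Sum>i'\<in>{..<d}-{i}. (rowsum d x i' - rowsum d a i')\<^sup>2)"
    unfolding rdist_def using assms by (subst sum.remove[of _ i]) auto
  ultimately show ?thesis using u by linarith
qed

text \<open>The square root makes the gradient bounded independently of \<open>d\<close>. With
  \<open>m\<close> the squared distance to \<open>A\<close>, a flip in row \<open>i\<close> raises
  \<open>m\<close> by at most \<open>4 * u x i + 4\<close>, and the squares of
  \<open>(2 * u x i + 2) / (d * F x)\<close> sum over all cells to at most
  \<open>8 * (1 + m / d) / (F x)^2 = 8\<close>. The summand 1 under the root absorbs the constant
  term of the increment and keeps \<open>F\<close> away from 0.\<close>

lemma variance_dist:
  fixes A :: "(nat \<times> nat) set set"
  assumes A: "A \<subseteq> Pow (grid d)" "A \<noteq> {}" and d: "0 < d"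
  defines "F \<equiv> \<lambda>x. sqrt (1 + Min (rdist d x ` A) / d)"
  shows "2 ^ card (grid d) * (\<Sum>x\<in>Pow (grid d). (F x)\<^sup>2) - (\<Sum>x\<in>Pow (grid d). F x)\<^sup>2
     \<le> 4 * (2 ^ card (grid d))\<^sup>2"
proof -
  have finA: "finite A"
    using A(1) by (rule finite_subset) simp
  define m where "m x = Min (rdist d x ` A)" for x
  have m_le: "m x \<le> rdist d x a" if "a \<in> A" for a x
    unfolding m_def using that finA by (intro Min_le) auto
  have "\<exists>a\<in>A. m x = rdist d x a" for x
    using Min_in[of "rdist d x ` A"] finA A(2) unfolding m_def
    by (metis finite_imageI image_iff image_is_empty)
  then obtain near where near: "\<And>x. near x \<in> A" "\<And>x. m x = rdist d x (near x)"
    by metis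
  have m_nonneg: "0 \<le> m x" for x
    using near rdist_nonneg by metis
  have F: "F x = sqrt (1 + m x / d)" for x
    by (simp add: F_def m_def)
  have F1: "1 \<le> F x" for x
    using m_nonneg by (simp add: F)
  have F2: "(F x)\<^sup>2 = 1 + m x / d" for x
    using m_nonneg[of x] by (simp add: F)
  define u where "u x i = \<bar>rowsum d x i - rowsum d (near x) i\<bar>" for x i
  \<comment> \<open>An increase of \<open>F\<close> is the increase of its square, at most
    \<open>(4 * u x i + 4) / d\<close>, divided by the sum of the new and old values, which is at
    least \<open>2 * F x\<close>.\<close>
  define b :: "(nat \<times> nat) set \<Rightarrow> nat \<times> nat \<Rightarrow> real" where "b x c = (2 * u x (fst c) + 2) / (d * F x)" for x c
  have b0: "0 \<le> b x c" for x and c :: "nat \<times> nat"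
    using F1[of x] by (auto simp: b_def u_def intro!: divide_nonneg_nonneg)
  have up: "F (flip c x) - F x \<le> b x c" if "c \<in> grid d" for x c
  proof (cases "F (flip c x) \<le> F x")
    case True
    then show ?thesis using b0[of x c] by linarith
  next
    case False
    obtain i j where c: "c = (i, j)" "i < d" "j < d"
      using \<open>c \<in> grid d\<close> unfolding grid_def by (cases c) auto
    have "m (flip c x) \<le> m x + 4 * u x i + 4"
      using m_le[OF near(1)[of x], of "flip c x"] rdist_flip[OF c(2,3), of x "near x"]
      by (simp add: near(2) u_def c(1))
    then have "m (flip c x) / d \<le> (m x + 4 * u x i + 4) / d"
      by (intro divide_right_mono) auto
    then have "(F (flip c x))\<^sup>2 - (F x)\<^sup>2 \<le> (4 * u x i + 4) / d"
      by (simp add: F2 add_divide_distrib)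
    moreover have "(F (flip c x) - F x) * (2 * F x) \<le> (F (flip c x) - F x) * (F (flip c x) + F x)"
      using False by (intro mult_left_mono) auto
    ultimately have "(F (flip c x) - F x) * (2 * F x) \<le> (4 * u x i + 4) / d"
      by (simp add: power2_eq_square algebra_simps)
    then show ?thesis
      using F1[of x] d by (simp add: b_def c(1) field_simps)
  qed
  have V: "(\<Sum>c\<in>grid d. (b x c)\<^sup>2) \<le> 8" for x
  proof -
    have "(b x c)\<^sup>2 \<le> (8 * (u x (fst c))\<^sup>2 + 8) / (d * F x)\<^sup>2" for c :: "nat \<times> nat"
    proof -
      have "(2 * u x (fst c) + 2)\<^sup>2 \<le> 8 * (u x (fst c))\<^sup>2 + 8"
        using zero_le_power2[of "2 * u x (fst c) - 2"] by (simp add: power2_eq_square algebra_simps)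
      then show ?thesis
        unfolding b_def power_divide by (intro divide_right_mono) auto
    qed
    then have "(\<Sum>c\<in>grid d. (b x c)\<^sup>2) \<le> (\<Sum>c\<in>grid d. (8 * (u x (fst c))\<^sup>2 + 8) / (d * F x)\<^sup>2)"
      by (rule sum_mono)
    also have "\<dots> = (\<Sum>i<d. \<Sum>j<d. (8 * (u x i)\<^sup>2 + 8) / (d * F x)\<^sup>2)"
      unfolding grid_def by (subst sum.cartesian_product) (simp add: case_prod_unfold)
    also have "\<dots> = (\<Sum>i<d. (8 * (u x i)\<^sup>2 + 8)) * (d / (d * F x)\<^sup>2)"
      unfolding sum_distrib_right by (intro sum.cong) auto
    also have "(\<Sum>i<d. (8 * (u x i)\<^sup>2 + 8)) = 8 * m x + 8 * d"
      by (simp add: near(2) rdist_def u_def sum.distrib sum_distrib_left)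
    also have "\<dots> * (d / (d * F x)\<^sup>2) = 8 * (1 + m x / d) / (F x)\<^sup>2"
      using d F1[of x] by (simp add: field_simps power2_eq_square)
    also have "\<dots> = 8"
      using m_nonneg[of x] F1[of x] unfolding F2[symmetric] by simp
    finally show ?thesis .
  qed
  show ?thesis
    using poincare_cube_one_sided[of "grid d" b F 8] b0 up V by simp
qed

text \<open>Chebyshev's inequality read backwards: if all of \<open>A\<close> were far from the
  mean, \<open>A\<close> alone would contribute more than the total variance.\<close>

lemma chebyshev_dense:
  fixes F :: "'a \<Rightarrow> real" and e V :: real
  assumes P: "finite P" and A: "A \<subseteq> P" "A \<noteq> {}" "e * card P \<le> card A" and e: "0 < e"
    and var: "card P * (\<Sum>x\<in>P. (F x)\<^sup>2) - (\<Sum>x\<in>P. F x)\<^sup>2 \<le> V\<^sup>2 * (card P)\<^sup>2" and V: "0 \<le> V"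
  shows "\<exists>a\<in>A. \<bar>F a - (\<Sum>x\<in>P. F x) / card P\<bar> \<le> V / sqrt e"
proof (rule ccontr)
  define mu where "mu = (\<Sum>x\<in>P. F x) / card P"
  have N: "0 < card P"
    using P A by (metis card_gt_0_iff subset_empty)
  have "(\<Sum>x\<in>P. F x) = mu * card P" using N by (simp add: mu_def)
  then have mu: "(\<Sum>x\<in>P. F x) = card P * mu" by simp
  have "card P * (\<Sum>x\<in>P. (F x - mu)\<^sup>2) = card P * (\<Sum>x\<in>P. (F x)\<^sup>2 + mu\<^sup>2 - 2 * mu * F x)"
    by (intro arg_cong2[of _ _ _ _ "(*)"] sum.cong refl) (simp add: power2_diff)
  also have "(\<Sum>x\<in>P. (F x)\<^sup>2 + mu\<^sup>2 - 2 * mu * F x) = (\<Sum>x\<in>P. (F x)\<^sup>2) + card P * mu\<^sup>2 - 2 * mu * (\<Sum>x\<in>P. F x)"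
    by (simp add: sum.distrib sum_subtractf sum_distrib_left)
  also have "card P * \<dots> = card P * (\<Sum>x\<in>P. (F x)\<^sup>2) - (\<Sum>x\<in>P. F x)\<^sup>2"
    unfolding mu by (simp add: power2_eq_square algebra_simps)
  finally have "card P * (\<Sum>x\<in>P. (F x - mu)\<^sup>2) = card P * (\<Sum>x\<in>P. (F x)\<^sup>2) - (\<Sum>x\<in>P. F x)\<^sup>2" .
  with var have "card P * (\<Sum>x\<in>P. (F x - mu)\<^sup>2) \<le> card P * (V\<^sup>2 * card P)"
    by (simp add: power2_eq_square mult_ac)
  then have up: "(\<Sum>x\<in>P. (F x - mu)\<^sup>2) \<le> V\<^sup>2 * card P"
    using N by simp
  assume "\<not> ?thesis"
  then have far: "V / sqrt e < \<bar>F a - mu\<bar>" if "a \<in> A" for a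
    using that by (force simp: mu_def)
  have "V\<^sup>2 / e < (F a - mu)\<^sup>2" if "a \<in> A" for a
  proof -
    have "(V / sqrt e)\<^sup>2 < \<bar>F a - mu\<bar>\<^sup>2"
      using far[OF that] V e by (intro power_strict_mono) auto
    then show ?thesis using e by (simp add: power_divide)
  qed
  then have "(\<Sum>a\<in>A. V\<^sup>2 / e) < (\<Sum>a\<in>A. (F a - mu)\<^sup>2)"
    using A P by (intro sum_strict_mono) (auto dest: finite_subset)
  also have "\<dots> \<le> (\<Sum>x\<in>P. (F x - mu)\<^sup>2)"
    using A P by (intro sum_mono2) auto
  finally have "card A * (V\<^sup>2 / e) < V\<^sup>2 * card P" using up by simp
  moreover have "e * card P * (V\<^sup>2 / e) \<le> card A * (V\<^sup>2 / e)"
    using A e by (intro mult_right_mono) auto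
  ultimately show False using e by (simp add: mult_ac)
qed

text \<open>Chebyshev is used twice for the same function \<open>F\<close>, whose standard deviation
  is at most 2. On \<open>A\<close> the function is 1, which forces the mean below
  \<open>1 + 2 / sqrt e\<close>; then some point of \<open>B\<close> has value at most
  \<open>1 + 4 / sqrt e\<close>, so it is close to \<open>A\<close>.\<close>

lemma concentration:
  fixes e :: real
  assumes A: "A \<subseteq> Pow (grid d)" "e * 2 ^ card (grid d) \<le> card A"
    and B: "B \<subseteq> Pow (grid d)" "e * 2 ^ card (grid d) \<le> card B"
    and e: "0 < e" and d: "0 < d"
  shows "\<exists>a\<in>A. \<exists>b\<in>B. rdist d b a \<le> (1 + 4 / sqrt e)\<^sup>2 * d"
proof -
  define F where "F x = sqrt (1 + Min (rdist d x ` A) / d)" for x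
  have card: "real (card (Pow (grid d))) = 2 ^ card (grid d)"
    by (simp add: card_Pow)
  have pos: "0 < e * 2 ^ card (grid d)" using e by simp
  have ne: "A \<noteq> {}" "B \<noteq> {}" using A(2) B(2) pos by auto
  have finA: "finite A"
    using A(1) by (rule finite_subset) simp
  note var = variance_dist[OF A(1) ne(1) d]
  have cheb: "\<exists>a\<in>D. \<bar>F a - (\<Sum>x\<in>Pow (grid d). F x) / card (Pow (grid d))\<bar> \<le> 2 / sqrt e"
    if "D \<subseteq> Pow (grid d)" "D \<noteq> {}" "e * 2 ^ card (grid d) \<le> card D" for D
    using that e var unfolding F_def
    by (intro chebyshev_dense) (auto simp: card_Pow)
  obtain a where a: "a \<in> A" "\<bar>F a - (\<Sum>x\<in>Pow (grid d). F x) / card (Pow (grid d))\<bar> \<le> 2 / sqrt e"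
    using cheb[OF A(1) ne(1) A(2)] by blast
  obtain b where b: "b \<in> B" "\<bar>F b - (\<Sum>x\<in>Pow (grid d). F x) / card (Pow (grid d))\<bar> \<le> 2 / sqrt e"
    using cheb[OF B(1) ne(2) B(2)] by blast
  obtain a' where a': "a' \<in> A" "Min (rdist d b ` A) = rdist d b a'"
    using Min_in[of "rdist d b ` A"] finA ne(1) by (metis finite_imageI image_iff image_is_empty)
  have "Min (rdist d a ` A) \<le> rdist d a a"
    using finA a(1) by (intro Min_le) auto
  moreover have "rdist d a a = 0" by (simp add: rdist_def)
  moreover have "0 \<le> Min (rdist d a ` A)"
    using finA ne by (simp add: rdist_nonneg)
  ultimately have "F a = 1" by (simp add: F_def)
  then have "F b \<le> 1 + 4 / sqrt e"
    using a(2) b(2) by (simp add: abs_le_iff)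
  moreover have "0 \<le> F b" using rdist_nonneg[of d b a'] by (simp add: F_def a'(2))
  ultimately have "(F b)\<^sup>2 \<le> (1 + 4 / sqrt e)\<^sup>2"
    by (intro power_mono) auto
  then have "rdist d b a' / d \<le> (1 + 4 / sqrt e)\<^sup>2"
    using rdist_nonneg[of d b a'] by (simp add: F_def a'(2))
  then have "rdist d b a' \<le> (1 + 4 / sqrt e)\<^sup>2 * d"
    using d by (simp add: divide_le_eq)
  then show ?thesis using a'(1) b(1) by blast
qed

section \<open>Antichains and the Littlewood-Offord inequality\<close>

text \<open>The weight of \<open>A\<close> counts the orderings of \<open>C\<close> that have
  \<open>A\<close> as an initial segment; for an antichain these families of orderings are disjoint.
  The induction classifies orderings by their last element, which lies outside \<open>A\<close>
  unless \<open>A = C\<close>.\<close>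

lemma lym_weight:
  assumes "finite C" "F \<subseteq> Pow C" "\<And>A B. A \<in> F \<Longrightarrow> B \<in> F \<Longrightarrow> A \<subseteq> B \<Longrightarrow> A = B"
  shows "(\<Sum>A\<in>F. fact (card A) * fact (card C - card A)) \<le> (fact (card C) :: nat)"
  using assms
proof (induction "card C" arbitrary: C F)
  case 0
  then have "C = {}" by simp
  then have "F = {} \<or> F = {{}}" using 0 by auto
  then show ?case using \<open>C = {}\<close> by auto
next
  case (Suc n)
  show ?case
  proof (cases "C \<in> F")
    case True
    then have "F = {C}" using Suc.prems by blast
    then show ?thesis by simp
  next
    case False
    define w where "w A = fact (card A) * (fact (n - card A) :: nat)" for A :: "'a set"
    have finF: "finite F" using Suc.prems by (meson finite_Pow_iff finite_subset)
    have 1: "fact (card A) * fact (card C - card A) = (\<Sum>x\<in>C - A. w A)" if "A \<in> F" for A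
    proof -
      have "A \<subset> C" using that False Suc.prems by auto
      then have lt: "card A < card C" using Suc.prems by (simp add: psubset_card_mono)
      have "card (C - A) = card C - card A"
        using \<open>A \<subset> C\<close> Suc.prems by (intro card_Diff_subset) (auto dest: finite_subset)
      moreover have "card C - card A = Suc (n - card A)"
        using lt Suc.hyps(2) by simp
      ultimately show ?thesis by (simp add: w_def algebra_simps)
    qed
    have "(\<Sum>A\<in>F. fact (card A) * fact (card C - card A)) = (\<Sum>A\<in>F. \<Sum>x\<in>C - A. w A)"
      using 1 by simp
    also have "\<dots> = (\<Sum>A\<in>F. \<Sum>x\<in>C. if x \<notin> A then w A else 0)"
      using Suc.prems(1) by (intro sum.cong refl sum.mono_neutral_cong_left) auto
    also have "\<dots> = (\<Sum>x\<in>C. \<Sum>A\<in>F. if x \<notin> A then w A else 0)"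
      by (rule sum.swap)
    also have "\<dots> = (\<Sum>x\<in>C. \<Sum>A\<in>{A\<in>F. x \<notin> A}. w A)"
      using finF by (intro sum.cong refl sum.mono_neutral_cong_right) auto
    also have "\<dots> \<le> (\<Sum>x\<in>C. fact n)"
    proof (rule sum_mono)
      fix x assume x: "x \<in> C"
      have c: "n = card (C - {x})" using Suc x by simp
      have "(\<Sum>A\<in>{A\<in>F. x \<notin> A}. fact (card A) * fact (card (C - {x}) - card A)) \<le> (fact (card (C - {x})) :: nat)"
        using Suc.prems by (intro Suc.hyps(1)[OF c]) auto
      then show "(\<Sum>A\<in>{A\<in>F. x \<notin> A}. w A) \<le> fact n"
        unfolding w_def c by simp
    qed
    also have "\<dots> = fact (card C)"
      unfolding Suc.hyps(2)[symmetric] by (simp add: Suc.hyps(2)[symmetric])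
    finally show ?thesis .
  qed
qed

lemma sperner:
  assumes "finite C" "F \<subseteq> Pow C" "\<And>A B. A \<in> F \<Longrightarrow> B \<in> F \<Longrightarrow> A \<subseteq> B \<Longrightarrow> A = B"
  shows "card F \<le> card C choose (card C div 2)"
proof -
  let ?n = "card C" and ?b = "card C choose (card C div 2)"
  have "card F * fact ?n \<le> (\<Sum>A\<in>F. ?b * (fact (card A) * fact (?n - card A)))"
  proof -
    have "(\<Sum>A\<in>F. fact ?n) \<le> (\<Sum>A\<in>F. ?b * (fact (card A) * fact (?n - card A)))"
    proof (rule sum_mono)
      fix A assume "A \<in> F"
      then have "card A \<le> ?n" using assms by (intro card_mono) auto
      then have "fact ?n = (fact (card A) * fact (?n - card A)) * (?n choose card A)"
        by (rule binomial_fact_lemma[symmetric])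
      also have "\<dots> \<le> (fact (card A) * fact (?n - card A)) * ?b"
        by (intro mult_left_mono binomial_maximum) auto
      finally show "fact ?n \<le> ?b * (fact (card A) * fact (?n - card A))"
        by (simp add: mult.commute)
    qed
    then show "card F * fact ?n \<le> (\<Sum>A\<in>F. ?b * (fact (card A) * fact (?n - card A)))" by simp
  qed
  also have "\<dots> = ?b * (\<Sum>A\<in>F. fact (card A) * fact (?n - card A))"
    by (simp only: sum_distrib_left)
  also have "\<dots> \<le> ?b * fact ?n"
    by (intro mult_left_mono lym_weight[OF assms]) auto
  finally show ?thesis by simp
qed

section \<open>Size of the middle binomial coefficient\<close>

lemma central_binomial_sq: "(real (2 * m choose m))\<^sup>2 * (2 * m + 1) \<le> (4 ^ m)\<^sup>2"
proof (induction m)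
  case (Suc m)
  let ?b = "real (2 * m choose m)"
  define c where "c = real (2 * Suc m choose Suc m)"
  have "Suc m * (2 * Suc m choose Suc m) = 2 * (Suc m * (Suc (2 * m) choose m))"
    using Suc_times_binomial[of m "Suc (2 * m)"] by simp
  also have "Suc m * (Suc (2 * m) choose m) = (2 * m + 1) * (2 * m choose m)"
    using binomial_absorb_comp[of "Suc (2 * m)" m] by simp
  finally have "Suc m * (2 * Suc m choose Suc m) = 2 * (2 * m + 1) * (2 * m choose m)"
    by (simp only: mult.assoc)
  then have "real (Suc m * (2 * Suc m choose Suc m)) = real (2 * (2 * m + 1) * (2 * m choose m))"
    by (rule arg_cong)
  then have eq: "(real m + 1) * c = 2 * (2 * m + 1) * ?b"
    by (simp only: of_nat_mult c_def) (simp add: algebra_simps)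
  have "c\<^sup>2 * (2 * Suc m + 1) * (real m + 1)\<^sup>2
      = ((real m + 1) * c)\<^sup>2 * (2 * m + 3)"
    unfolding power_mult_distrib by (simp add: algebra_simps)
  also have "\<dots> = ?b\<^sup>2 * (2 * m + 1) * (4 * (2 * m + 1) * (2 * m + 3))"
    unfolding eq by (simp add: power2_eq_square algebra_simps)
  \<comment> \<open>The factor \<open>2 * m + 1\<close> in the statement is what makes this step
    close: it needs exactly \<open>(2m+1)(2m+3) \<le> 4(m+1)^2\<close>.\<close>
  also have "\<dots> \<le> ?b\<^sup>2 * (2 * m + 1) * (16 * (real m + 1)\<^sup>2)"
    by (intro mult_left_mono) (auto simp: power2_eq_square algebra_simps)
  also have "\<dots> \<le> (4 ^ m :: real)\<^sup>2 * (16 * (real m + 1)\<^sup>2)"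
    using Suc.IH by (intro mult_right_mono) auto
  also have "\<dots> = (4 ^ Suc m)\<^sup>2 * (real m + 1)\<^sup>2"
    by (simp add: power_mult_distrib)
  finally show ?case
    unfolding c_def[symmetric] by (simp add: mult_le_cancel_right)
qed auto

lemma middle_binomial_sq: "(real (k choose (k div 2)))\<^sup>2 * k \<le> (2 ^ k)\<^sup>2"
proof (cases "even k")
  case True
  then obtain m where m: "k = 2 * m" by blast
  have "(real (k choose (k div 2)))\<^sup>2 * k \<le> (real (2 * m choose m))\<^sup>2 * (2 * m + 1)"
    unfolding m by (intro mult_mono) auto
  also have "\<dots> \<le> (4 ^ m)\<^sup>2" by (rule central_binomial_sq)
  also have "\<dots> = (2 ^ k)\<^sup>2" by (simp add: m power_mult)
  finally show ?thesis .
next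
  case False
  then obtain m where m: "k = 2 * m + 1" using oddE by blast
  \<comment> \<open>The middle coefficient for odd \<open>k\<close> is half of the central one for
    \<open>k + 1\<close>.\<close>
  have "(2 * Suc m choose Suc m) = (2 * m + 1 choose Suc m) + (2 * m + 1 choose m)"
    by simp
  also have "(2 * m + 1 choose Suc m) = (2 * m + 1 choose m)"
    using binomial_symmetric[of m "2 * m + 1"] by simp
  finally have "2 * (k choose (k div 2)) = (2 * Suc m choose Suc m)"
    by (simp add: m)
  then have "2 * real (k choose (k div 2)) = real (2 * Suc m choose Suc m)"
    by (metis of_nat_mult of_nat_numeral)
  then have "4 * ((real (k choose (k div 2)))\<^sup>2 * k) = (real (2 * Suc m choose Suc m))\<^sup>2 * k"
    by (metis power_mult_distrib mult.assoc four_x_squared)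
  also have "\<dots> \<le> (real (2 * Suc m choose Suc m))\<^sup>2 * (2 * Suc m + 1)"
    unfolding m by (intro mult_left_mono) auto
  also have "\<dots> \<le> (4 ^ Suc m)\<^sup>2" by (rule central_binomial_sq)
  also have "\<dots> = 4 * (2 ^ k)\<^sup>2" by (simp add: m power_mult power_mult_distrib)
  finally show ?thesis by simp
qed

lemma middle_binomial_le: "0 < k \<Longrightarrow> real (k choose (k div 2)) \<le> 2 ^ k / sqrt k"
proof -
  assume k: "0 < k"
  have "(real (k choose (k div 2)) * sqrt k)\<^sup>2 \<le> (2 ^ k)\<^sup>2"
    using middle_binomial_sq[of k] by (simp add: power_mult_distrib)
  then have "real (k choose (k div 2)) * sqrt k \<le> 2 ^ k"
    by (rule power2_le_imp_le) simp
  then show ?thesis using k by (simp add: field_simps)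
qed

section \<open>Signed sums in short intervals\<close>

definition ssum :: "'a set \<Rightarrow> ('a \<Rightarrow> real) \<Rightarrow> 'a set \<Rightarrow> real" where
  "ssum C w x = (\<Sum>c\<in>C. sgn_of x c * w c)"

text \<open>After flipping the coordinates of negative weight, sets whose signed sums lie in a
  window of width \<open>2a\<close> form an antichain.\<close>

lemma littlewood_offord_full:
  assumes T: "finite T" and a: "\<And>c. c \<in> T \<Longrightarrow> a \<le> \<bar>w c\<bar>" "0 < a"
  shows "card {x \<in> Pow T. u \<le> ssum T w x \<and> ssum T w x < u + 2 * a} \<le> card T choose (card T div 2)"
proof -
  define S where "S = {x \<in> Pow T. u \<le> ssum T w x \<and> ssum T w x < u + 2 * a}"
  define M where "M = {c \<in> T. w c < 0}"
  define h where "h x = (x - M) \<union> (M - x)" for x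
  have hh: "h (h x) = x" for x by (auto simp: h_def)
  have "inj_on h S" by (metis hh inj_on_inverseI)
  have s: "ssum T w x = (\<Sum>c\<in>T. sgn_of (h x) c * \<bar>w c\<bar>)" for x
    unfolding ssum_def by (intro sum.cong) (auto simp: h_def M_def sgn_of_def)
  have "card (h ` S) \<le> card T choose (card T div 2)"
  proof (rule sperner[OF T])
    show "h ` S \<subseteq> Pow T" by (auto simp: S_def h_def M_def)
    fix A B assume AB: "A \<in> h ` S" "B \<in> h ` S" "A \<subseteq> B"
    show "A = B"
    proof (rule ccontr)
      assume "A \<noteq> B"
      then obtain c where c: "c \<in> B" "c \<notin> A" using AB by blast
      obtain x y where xy: "x \<in> S" "y \<in> S" "A = h x" "B = h y" using AB by auto
      have cT: "c \<in> T" using c xy by (auto simp: S_def h_def M_def)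
      have d: "ssum T w y - ssum T w x = (\<Sum>c\<in>T. (sgn_of B c - sgn_of A c) * \<bar>w c\<bar>)"
        by (simp add: s xy sum_subtractf algebra_simps)
      have "2 * a \<le> (sgn_of B c - sgn_of A c) * \<bar>w c\<bar>"
        using c a(1)[OF cT] by (simp add: sgn_of_def)
      also have "\<dots> \<le> (\<Sum>c\<in>T. (sgn_of B c - sgn_of A c) * \<bar>w c\<bar>)"
        using AB(3) cT T by (intro member_le_sum) (auto simp: sgn_of_def)
      finally have "2 * a \<le> ssum T w y - ssum T w x" using d by simp
      then show False using xy by (auto simp: S_def)
    qed
  qed
  then show ?thesis
    using \<open>inj_on h S\<close> by (simp add: card_image S_def)
qed

text \<open>Condition on the signs outside \<open>T\<close>: they only translate the window for the
  sum over \<open>T\<close>.\<close>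

lemma littlewood_offord_window:
  assumes C: "finite C" "T \<subseteq> C" and a: "\<And>c. c \<in> T \<Longrightarrow> a \<le> \<bar>w c\<bar>" "0 < a"
  shows "card {x \<in> Pow C. u \<le> ssum C w x \<and> ssum C w x < u + 2 * a}
    \<le> 2 ^ (card C - card T) * (card T choose (card T div 2))"
proof -
  define S where "S = {x \<in> Pow C. u \<le> ssum C w x \<and> ssum C w x < u + 2 * a}"
  define R where "R z = {x \<in> Pow T. u - ssum (C - T) w z \<le> ssum T w x \<and>
    ssum T w x < (u - ssum (C - T) w z) + 2 * a}" for z
  have finT: "finite T" using C by (rule finite_subset[rotated])
  have split: "ssum C w x = ssum T w (x \<inter> T) + ssum (C - T) w (x - T)" for x
  proof -
    have "ssum C w x = (\<Sum>c\<in>T. sgn_of x c * w c) + (\<Sum>c\<in>C - T. sgn_of x c * w c)"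
      unfolding ssum_def using C by (simp add: sum.subset_diff)
    also have "(\<Sum>c\<in>T. sgn_of x c * w c) = ssum T w (x \<inter> T)"
      unfolding ssum_def by (intro sum.cong) (auto simp: sgn_of_def)
    also have "(\<Sum>c\<in>C - T. sgn_of x c * w c) = ssum (C - T) w (x - T)"
      unfolding ssum_def by (intro sum.cong) (auto simp: sgn_of_def)
    finally show ?thesis .
  qed
  have "card S = card ((\<lambda>x. (x - T, x \<inter> T)) ` S)"
    by (rule card_image[symmetric]) (auto simp: inj_on_def)
  also have "\<dots> \<le> card (SIGMA z:Pow (C - T). R z)"
  proof (rule card_mono)
    show "finite (SIGMA z:Pow (C - T). R z)"
      using C finT by (auto simp: R_def)
    show "(\<lambda>x. (x - T, x \<inter> T)) ` S \<subseteq> (SIGMA z:Pow (C - T). R z)"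
      by (auto simp: S_def R_def split)
  qed
  also have "\<dots> = (\<Sum>z\<in>Pow (C - T). card (R z))"
    using C finT by (intro card_SigmaI) (auto simp: R_def)
  also have "\<dots> \<le> (\<Sum>z\<in>Pow (C - T). card T choose (card T div 2))"
    unfolding R_def by (intro sum_mono littlewood_offord_full finT a)
  also have "\<dots> = 2 ^ (card C - card T) * (card T choose (card T div 2))"
    using C finT by (simp add: card_Pow card_Diff_subset)
  finally show ?thesis by (simp add: S_def)
qed

text \<open>The interval from \<open>- L\<close> to \<open>L\<close> is covered by \<open>m\<close>
  windows of width \<open>2 * a\<close>, and each of them contains a proportion of at most
  \<open>1 / sqrt (card T)\<close> of all sign patterns.\<close>

lemma littlewood_offord:
  assumes C: "finite C" "T \<subseteq> C" "T \<noteq> {}" and a: "\<And>c. c \<in> T \<Longrightarrow> a \<le> \<bar>w c\<bar>" "0 < a" and L: "0 \<le> L"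
  shows "card {x \<in> Pow C. \<bar>ssum C w x\<bar> \<le> L} \<le> (L / a + 2) / sqrt (card T) * 2 ^ card C"
proof -
  \<comment> \<open>The extra 1 matters: windows are half-open, so the endpoint \<open>L\<close> can
    require the window with index \<open>L / a\<close>.\<close>
  define m where "m = nat \<lfloor>L / a\<rfloor> + 1"
  define W where "W k = {x \<in> Pow C. - L + 2 * a * real k \<le> ssum C w x \<and>
    ssum C w x < (- L + 2 * a * real k) + 2 * a}" for k :: nat
  have finT: "finite T" using C by (metis finite_subset)
  have T0: "0 < card T" using finT C by (simp add: card_gt_0_iff)
  have TC: "card T \<le> card C" using C by (intro card_mono)
  have m: "real m \<le> L / a + 1" "L / a < m"
  proof -
    have "0 \<le> L / a" using L a(2) by simp
    then have "real m = of_int \<lfloor>L / a\<rfloor> + 1" by (simp add: m_def)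
    then show "real m \<le> L / a + 1" "L / a < m" by linarith+
  qed
  have "{x \<in> Pow C. \<bar>ssum C w x\<bar> \<le> L} \<subseteq> (\<Union>k<m. W k)"
  proof
    fix x assume x: "x \<in> {x \<in> Pow C. \<bar>ssum C w x\<bar> \<le> L}"
    define k where "k = nat \<lfloor>(ssum C w x + L) / (2 * a)\<rfloor>"
    have nn: "0 \<le> (ssum C w x + L) / (2 * a)" using x a(2) by auto
    have k: "real k \<le> (ssum C w x + L) / (2 * a)" "(ssum C w x + L) / (2 * a) < real k + 1"
      using nn by (auto simp: k_def of_nat_nat)
    have "(ssum C w x + L) / (2 * a) \<le> (2 * L) / (2 * a)"
      using x a(2) by (intro divide_right_mono) auto
    then have "real k < real m" using k(1) m(2) by simp
    moreover have "x \<in> W k" using k x a(2) by (auto simp: W_def field_simps)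
    ultimately show "x \<in> (\<Union>k<m. W k)" by auto
  qed
  then have "card {x \<in> Pow C. \<bar>ssum C w x\<bar> \<le> L} \<le> card (\<Union>k<m. W k)"
    using C by (intro card_mono) (auto simp: W_def)
  also have "\<dots> \<le> (\<Sum>k<m. card (W k))"
    by (rule card_UN_le) simp
  also have "\<dots> \<le> (\<Sum>k<m. 2 ^ (card C - card T) * (card T choose (card T div 2)))"
    unfolding W_def by (intro sum_mono littlewood_offord_window[OF C(1,2) a])
  finally have "card {x \<in> Pow C. \<bar>ssum C w x\<bar> \<le> L}
      \<le> m * (2 ^ (card C - card T) * (card T choose (card T div 2)))" by simp
  then have "real (card {x \<in> Pow C. \<bar>ssum C w x\<bar> \<le> L})
      \<le> real m * (2 ^ (card C - card T) * real (card T choose (card T div 2)))"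
    by (metis (mono_tags) of_nat_le_iff of_nat_mult of_nat_power of_nat_numeral)
  also have "\<dots> \<le> (L / a + 2) * (2 ^ (card C - card T) * (2 ^ card T / sqrt (card T)))"
    using m L a(2) by (intro mult_mono middle_binomial_le T0) auto
  also have "\<dots> = (L / a + 2) / sqrt (card T) * (2 ^ (card C - card T) * 2 ^ card T)"
    by simp
  also have "2 ^ (card C - card T) * 2 ^ card T = (2 ^ card C :: real)"
    using TC by (simp add: power_add[symmetric])
  finally show ?thesis .
qed

section \<open>The Bollobas-Erdos relations\<close>

definition bform :: "nat \<Rightarrow> (nat \<times> nat) set \<Rightarrow> (nat \<times> nat) set \<Rightarrow> real" where
  "bform d x y = (\<Sum>i<d. rowsum d x i * rowsum d y i)"

lemma bform_ssum: "bform d x y = ssum (grid d) (\<lambda>c. rowsum d y (fst c)) x"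
  unfolding bform_def ssum_def grid_def rowsum_def[of d x] sum_distrib_right
  by (subst sum.cartesian_product) (simp add: case_prod_unfold)

lemma rowsum_ssum:
  assumes "i < d"
  shows "rowsum d x i = ssum (grid d) (\<lambda>c. if fst c = i then 1 else 0) x"
proof -
  have "ssum (grid d) (\<lambda>c. if fst c = i then 1 else 0) x
      = (\<Sum>i'<d. \<Sum>j<d. if i' = i then sgn_of x (i', j) else 0)"
    unfolding ssum_def grid_def
    by (subst sum.cartesian_product) (auto simp: case_prod_unfold intro!: sum.cong)
  also have "\<dots> = (\<Sum>i'<d. if i' = i then (\<Sum>j<d. sgn_of x (i', j)) else 0)"
    by (intro sum.cong) auto
  also have "\<dots> = rowsum d x i"
    using assms by (simp add: rowsum_def)
  finally show ?thesis by simp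
qed

section \<open>Anti-concentration of the inner product\<close>

lemma small_rowsum:
  assumes "i < d" "0 \<le> L"
  shows "card {x \<in> Pow (grid d). \<bar>rowsum d x i\<bar> \<le> L} \<le> (L + 2) / sqrt d * 2 ^ card (grid d)"
proof -
  have sub: "{i} \<times> {..<d} \<subseteq> grid d" "{i} \<times> {..<d} \<noteq> {}"
    using assms by (auto simp: grid_def)
  have "real (card {x \<in> Pow (grid d). \<bar>ssum (grid d) (\<lambda>c. if fst c = i then 1 else 0) x\<bar> \<le> L})
      \<le> (L / 1 + 2) / sqrt (card ({i} \<times> {..<d})) * 2 ^ card (grid d)"
    using assms(2) by (intro littlewood_offord sub) auto
  then show ?thesis
    by (simp add: rowsum_ssum[OF assms(1)])
qed

text \<open>Markov's inequality by double counting the pairs of a matrix and a small row; the factor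
  2 comes from asking for half of the rows.\<close>

lemma many_small_rows:
  assumes d: "0 < d" and L: "0 \<le> L"
  shows "card {y \<in> Pow (grid d). real d / 2 \<le> card {i. i < d \<and> \<bar>rowsum d y i\<bar> \<le> L}}
    \<le> 2 * (L + 2) / sqrt d * 2 ^ card (grid d)"
proof -
  define P where "P = Pow (grid d)"
  have finP: "finite P" by (simp add: P_def)
  define k where "k y = card {i. i < d \<and> \<bar>rowsum d y i\<bar> \<le> L}" for y
  define Y where "Y = {y \<in> P. real d / 2 \<le> k y}"
  have kk: "real (k y) = (\<Sum>i<d. if \<bar>rowsum d y i\<bar> \<le> L then 1 else 0)" for y
  proof -
    have "{i. i < d \<and> \<bar>rowsum d y i\<bar> \<le> L} = {i \<in> {..<d}. \<bar>rowsum d y i\<bar> \<le> L}" by auto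
    then show ?thesis by (simp add: k_def sum.If_cases Int_def)
  qed
  have "card Y * (real d / 2) \<le> (\<Sum>y\<in>Y. real (k y))"
    using sum_bounded_below[of Y "real d / 2" "\<lambda>y. real (k y)"] by (simp add: Y_def)
  also have "\<dots> \<le> (\<Sum>y\<in>P. real (k y))"
    using finP by (intro sum_mono2) (auto simp: Y_def)
  also have "\<dots> = (\<Sum>i<d. \<Sum>y\<in>P. if \<bar>rowsum d y i\<bar> \<le> L then 1 else 0)"
    unfolding kk by (rule sum.swap)
  also have "\<dots> = (\<Sum>i<d. real (card {y \<in> P. \<bar>rowsum d y i\<bar> \<le> L}))"
    using finP by (intro sum.cong) (auto simp: sum.If_cases Int_def)
  also have "\<dots> \<le> (\<Sum>i<d. (L + 2) / sqrt d * 2 ^ card (grid d))"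
    unfolding P_def using L by (intro sum_mono small_rowsum) auto
  also have "\<dots> = (2 * (L + 2) / sqrt d * 2 ^ card (grid d)) * (real d / 2)"
    by (simp add: algebra_simps add_divide_distrib)
  finally have "card Y \<le> 2 * (L + 2) / sqrt d * 2 ^ card (grid d)"
    using d by (subst (asm) mult_le_cancel_right) auto
  then show ?thesis by (simp add: Y_def k_def P_def)
qed

text \<open>For fixed \<open>y\<close> the form is a signed sum over all cells of \<open>x\<close>,
  and each cell carries the row sum of \<open>y\<close> in its row as weight. More than half of the
  rows have weight above \<open>a\<close>, so of the order of \<open>d^2\<close> cells take part.
  This yields the denominator \<open>d\<close> instead of \<open>sqrt d\<close>, which is needed
  because \<open>L\<close> will be a multiple of \<open>d\<close>.\<close>

lemma small_bform_fixed:
  assumes d: "0 < d" and a: "0 < a" and L: "0 \<le> L"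
    and y: "card {i. i < d \<and> \<bar>rowsum d y i\<bar> \<le> a} < real d / 2"
  shows "card {x \<in> Pow (grid d). \<bar>bform d x y\<bar> \<le> L} \<le> 2 * (L / a + 2) / d * 2 ^ card (grid d)"
proof -
  define I where "I = {i. i < d \<and> a < \<bar>rowsum d y i\<bar>}"
  define T where "T = I \<times> {..<d}"
  have "{..<d} = I \<union> {i. i < d \<and> \<bar>rowsum d y i\<bar> \<le> a}"
    by (auto simp: I_def)
  then have "d = card (I \<union> {i. i < d \<and> \<bar>rowsum d y i\<bar> \<le> a})"
    by (metis card_lessThan)
  also have "\<dots> \<le> card I + card {i. i < d \<and> \<bar>rowsum d y i\<bar> \<le> a}"
    by (rule card_Un_le)
  finally have I: "real d / 2 < card I" using y by linarith
  then have "I \<noteq> {}" using d by auto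
  have cT: "real d * real d / 4 \<le> card T"
  proof -
    have "real d * real d / 4 \<le> (real d / 2) * real d" by simp
    also have "\<dots> \<le> card I * real d" using I by (intro mult_right_mono) auto
    finally show ?thesis by (simp add: T_def card_cartesian_product)
  qed
  have "real d / 2 \<le> sqrt (card T)"
    using cT by (intro real_le_rsqrt) (simp add: power2_eq_square)
  have "card {x \<in> Pow (grid d). \<bar>ssum (grid d) (\<lambda>c. rowsum d y (fst c)) x\<bar> \<le> L}
      \<le> (L / a + 2) / sqrt (card T) * 2 ^ card (grid d)"
  proof (rule littlewood_offord)
    show "T \<subseteq> grid d" "T \<noteq> {}" using \<open>I \<noteq> {}\<close> d by (auto simp: T_def I_def grid_def)
  qed (use a L in \<open>auto simp: T_def I_def\<close>)
  also have "\<dots> \<le> (L / a + 2) / (real d / 2) * 2 ^ card (grid d)"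
    using \<open>real d / 2 \<le> sqrt (card T)\<close> a L d order_less_le_trans[of 0 "real d / 2" "sqrt (card T)"]
    by (intro mult_right_mono divide_left_mono) auto
  finally show ?thesis by (simp add: bform_ssum mult.commute)
qed

text \<open>The first term pays for the matrices \<open>y\<close> with too many small rows, for
  which every \<open>x\<close> is counted; the second is the bound for all other
  \<open>y\<close>.\<close>

lemma small_bform:
  assumes d: "0 < d" and a: "0 < a" and L: "0 \<le> L"
  shows "card {(x, y) \<in> Pow (grid d) \<times> Pow (grid d). \<bar>bform d x y\<bar> \<le> L}
    \<le> (2 * (a + 2) / sqrt d + 2 * (L / a + 2) / d) * (2 ^ card (grid d))\<^sup>2"
proof -
  let ?N = "2 ^ card (grid d) :: real"
  define P where "P = Pow (grid d)"
  have finP: "finite P" and cP: "real (card P) = ?N" by (simp_all add: P_def card_Pow)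
  define Y where "Y = {y \<in> P. real d / 2 \<le> card {i. i < d \<and> \<bar>rowsum d y i\<bar> \<le> a}}"
  have Y: "real (card Y) \<le> 2 * (a + 2) / sqrt d * ?N"
    unfolding Y_def P_def using a by (intro many_small_rows d) auto
  define R where "R y = {x \<in> P. \<bar>bform d x y\<bar> \<le> L}" for y
  have finR: "finite (R y)" for y using finP by (simp add: R_def)
  have R1: "real (card (R y)) \<le> ?N" for y
    unfolding cP[symmetric] using finP by (auto simp: R_def intro!: card_mono)
  have R2: "real (card (R y)) \<le> 2 * (L / a + 2) / d * ?N" if "y \<in> P - Y" for y
    unfolding R_def P_def using that by (intro small_bform_fixed d a L) (auto simp: Y_def)
  have "{(x, y) \<in> P \<times> P. \<bar>bform d x y\<bar> \<le> L} = prod.swap ` (SIGMA y:P. R y)"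
    by (auto simp: R_def image_iff)
  then have "card {(x, y) \<in> P \<times> P. \<bar>bform d x y\<bar> \<le> L} = card (SIGMA y:P. R y)"
    by (simp add: card_image)
  also have "\<dots> = (\<Sum>y\<in>P. card (R y))"
    using finP finR by simp
  finally have "real (card {(x, y) \<in> P \<times> P. \<bar>bform d x y\<bar> \<le> L}) = (\<Sum>y\<in>P. real (card (R y)))"
    by simp
  also have "\<dots> = (\<Sum>y\<in>Y. real (card (R y))) + (\<Sum>y\<in>P - Y. real (card (R y)))"
    using finP by (subst sum.subset_diff[of Y P]) (auto simp: Y_def)
  also have "\<dots> \<le> card Y * ?N + (\<Sum>y\<in>P - Y. 2 * (L / a + 2) / d * ?N)"
    using R1 sum_bounded_above[of Y "\<lambda>y. real (card (R y))" ?N] R2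
    by (intro add_mono sum_mono) auto
  also have "\<dots> \<le> (2 * (a + 2) / sqrt d * ?N) * ?N + (\<Sum>y\<in>P. 2 * (L / a + 2) / d * ?N)"
    using Y a L finP by (intro add_mono mult_right_mono sum_mono2) auto
  also have "\<dots> = (2 * (a + 2) / sqrt d + 2 * (L / a + 2) / d) * ?N\<^sup>2"
    unfolding sum_constant cP by (simp add: power2_eq_square algebra_simps)
  finally show ?thesis by (simp add: P_def)
qed

text \<open>Complementing \<open>x\<close> negates the form, so values above \<open>L\<close> and
  below \<open>- L\<close> are equally frequent and share everything outside the small
  range.\<close>

lemma large_bform:
  assumes d: "0 < d" and a: "0 < a" and L: "0 \<le> L"
  shows "(1 - (2 * (a + 2) / sqrt d + 2 * (L / a + 2) / d)) / 2 * (2 ^ card (grid d))\<^sup>2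
    \<le> card {(x, y) \<in> Pow (grid d) \<times> Pow (grid d). L < bform d x y}"
proof -
  let ?N = "2 ^ card (grid d) :: real"
  define PP where "PP = Pow (grid d) \<times> Pow (grid d)"
  have fin: "finite PP" by (simp add: PP_def)
  define U where "U = {p \<in> PP. L < bform d (fst p) (snd p)}"
  define W where "W = {p \<in> PP. bform d (fst p) (snd p) < - L}"
  define Z where "Z = {p \<in> PP. \<bar>bform d (fst p) (snd p)\<bar> \<le> L}"
  have neg: "bform d (grid d - x) y = - bform d x y" for x y
    unfolding bform_def sum_negf[symmetric] by (intro sum.cong) (auto simp: rowsum_compl)
  have "bij_betw (\<lambda>p. (grid d - fst p, snd p)) W U"
    by (rule bij_betwI[where g = "\<lambda>p. (grid d - fst p, snd p)"])
      (auto simp: W_def U_def PP_def neg double_diff)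
  then have "card W = card U" by (rule bij_betw_same_card)
  moreover have "PP = U \<union> W \<union> Z" by (auto simp: U_def W_def Z_def)
  then have "card PP \<le> card U + card W + card Z"
    using card_Un_le[of "U \<union> W" Z] card_Un_le[of U W] by simp
  moreover have "real (card PP) = ?N\<^sup>2"
    by (simp add: PP_def card_Pow power2_eq_square card_cartesian_product)
  moreover have "{(x, y) \<in> Pow (grid d) \<times> Pow (grid d). \<bar>bform d x y\<bar> \<le> L} = Z"
    by (auto simp: Z_def PP_def)
  then have "real (card Z) \<le> (2 * (a + 2) / sqrt d + 2 * (L / a + 2) / d) * ?N\<^sup>2"
    using small_bform[OF assms] by simp
  moreover have "{(x, y) \<in> Pow (grid d) \<times> Pow (grid d). L < bform d x y} = U"
    by (auto simp: U_def PP_def)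
  moreover define c where "c = 2 * (a + 2) / sqrt d + 2 * (L / a + 2) / d"
  ultimately have "?N\<^sup>2 \<le> 2 * real (card U) + c * ?N\<^sup>2" and
    U: "{(x, y) \<in> Pow (grid d) \<times> Pow (grid d). L < bform d x y} = U"
    unfolding c_def[symmetric] by linarith+
  then have "(1 - c) / 2 * ?N\<^sup>2 \<le> real (card U)"
    by (simp add: algebra_simps)
  then show ?thesis unfolding U c_def .
qed

text \<open>The order of choice matters: for threshold \<open>K * d\<close> the term
  \<open>2 * K / a\<close> does not decay in \<open>d\<close>, so \<open>a\<close> is first fixed
  large against \<open>K / e\<close>; the remaining terms vanish as \<open>d\<close> grows.\<close>

lemma large_dimension:
  fixes K :: real
  assumes K: "0 < K" and e: "0 < e"
  shows "\<exists>d>0. \<exists>a>0. 2 * (a + 2) / sqrt (real d) + 2 * (K * d / a + 2) / d \<le> e"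
proof -
  define c where "c = 4 * K / e + 1"
  have c: "0 < c" "2 * K / c \<le> e / 2"
  proof -
    show "0 < c" using K e by (simp add: c_def add_pos_pos)
    have "4 * K \<le> c * e" using K e by (simp add: c_def field_simps)
    then show "2 * K / c \<le> e / 2" using \<open>0 < c\<close> by (simp add: field_simps)
  qed
  have "((\<lambda>d::nat. 2 * (c + 2) / sqrt (real d) + 4 / d) \<longlongrightarrow> 0) at_top"
    by (intro tendsto_add_zero tendsto_divide_0[OF tendsto_const] filterlim_at_top_imp_at_infinity
        filterlim_compose[OF sqrt_at_top] filterlim_real_sequentially)
  then have "eventually (\<lambda>d::nat. 2 * (c + 2) / sqrt (real d) + 4 / d < e / 2 \<and> 0 < d) at_top"
    using e by (intro eventually_conj eventually_gt_at_top) (auto dest: order_tendstoD(2)[where a = "e / 2"])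
  then obtain d :: nat where d: "2 * (c + 2) / sqrt (real d) + 4 / d < e / 2" "0 < d"
    by (auto dest: eventually_happens)
  have "2 * (c + 2) / sqrt (real d) + 2 * (K * d / c + 2) / d
      = 2 * (c + 2) / sqrt (real d) + 4 / d + 2 * K / c"
    using d(2) by (simp add: add_divide_distrib)
  also have "\<dots> \<le> e" using d(1) c(2) by linarith
  finally show ?thesis using d(2) c(1) by blast
qed

text \<open>The same number \<open>K * d\<close>, with \<open>K\<close> from the concentration
  bound, is the radius of \<open>N\<close> and the threshold of \<open>Q\<close>. Four related pairs
  add up to more than \<open>4 * K * d\<close>, whereas the inner product of the two sums is at most
  the mean of their squared norms, hence at most \<open>K * d\<close>.\<close>

lemma bollobas_erdos_relations:
  fixes e \<delta> :: real
  assumes e: "0 < e" and \<delta>: "0 < \<delta>"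
  obtains \<Omega> :: "(nat \<times> nat) set set" and N Q where
    "finite \<Omega>" "\<Omega> \<noteq> {}"
    "\<And>A B. A \<subseteq> \<Omega> \<Longrightarrow> B \<subseteq> \<Omega> \<Longrightarrow> e * card \<Omega> \<le> card A \<Longrightarrow> e * card \<Omega> \<le> card B \<Longrightarrow>
      \<exists>a\<in>A. \<exists>b\<in>B. N a b"
    "\<And>x y. N x y \<Longrightarrow> N y x"
    "(1 / 2 - \<delta>) * (card \<Omega>)\<^sup>2 \<le> card {(x, y) \<in> \<Omega> \<times> \<Omega>. Q x y}"
    "\<And>x x' y y'. N x x' \<Longrightarrow> N y y' \<Longrightarrow> Q x y \<Longrightarrow> Q x y' \<Longrightarrow> Q x' y \<Longrightarrow> Q x' y' \<Longrightarrow> False"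
proof -
  define K where "K = (1 + 4 / sqrt e)\<^sup>2"
  have "0 < 1 + 4 / sqrt e" using e by (simp add: add_pos_nonneg)
  then have K: "0 < K" by (simp add: K_def)
  obtain d :: nat and a where d: "0 < d" and a: "0 < a"
    \<comment> \<open>The error \<open>2 * \<delta>\<close> is halved later, since only the positive
      half of the large values counts.\<close>
    and small: "2 * (a + 2) / sqrt (real d) + 2 * (K * d / a + 2) / d \<le> 2 * \<delta>"
    using large_dimension[OF K, of "2 * \<delta>"] \<delta> by auto
  let ?\<Omega> = "Pow (grid d)"
  define N where "N x y \<longleftrightarrow> (\<Sum>i<d. (rowsum d x i + rowsum d y i)\<^sup>2) \<le> K * d" for x y
  define Q where "Q x y \<longleftrightarrow> K * d < bform d x y" for x y
  have card: "real (card ?\<Omega>) = 2 ^ card (grid d)" by (simp add: card_Pow)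
  show ?thesis
  proof (rule that[of ?\<Omega> N Q])
    show "finite ?\<Omega>" "?\<Omega> \<noteq> {}" by auto
    show "N y x" if "N x y" for x y
      using that by (simp add: N_def add.commute)
  next
    fix A B assume AB: "A \<subseteq> ?\<Omega>" "B \<subseteq> ?\<Omega>" "e * card ?\<Omega> \<le> card A" "e * card ?\<Omega> \<le> card B"
    \<comment> \<open>Complements turn concentration, which finds nearly equal vectors, into a
      source of nearly opposite ones.\<close>
    let ?B = "(\<lambda>x. grid d - x) ` B"
    have "inj_on (\<lambda>x. grid d - x) B"
      using AB(2) by (intro inj_on_inverseI[where g = "\<lambda>x. grid d - x"]) (auto simp: double_diff)
    then have cB: "card ?B = card B" by (rule card_image)
    have "\<exists>b\<in>?B. \<exists>a\<in>A. rdist d a b \<le> (1 + 4 / sqrt e)\<^sup>2 * d"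
      using AB e d cB card by (intro concentration) auto
    then obtain a b where ab: "a \<in> A" "b \<in> B" "rdist d a (grid d - b) \<le> K * d"
      unfolding K_def by auto
    have "rdist d a (grid d - b) = (\<Sum>i<d. (rowsum d a i + rowsum d b i)\<^sup>2)"
      unfolding rdist_def by (intro sum.cong) (auto simp: rowsum_compl)
    then have "N a b" using ab(3) by (simp add: N_def)
    then show "\<exists>a\<in>A. \<exists>b\<in>B. N a b" using ab by blast
  next
    have "(1 / 2 - \<delta>) * (2 ^ card (grid d))\<^sup>2
        \<le> (1 - (2 * (a + 2) / sqrt d + 2 * (K * d / a + 2) / d)) / 2 * (2 ^ card (grid d))\<^sup>2"
      using small by (intro mult_right_mono) auto
    also have "\<dots> \<le> card {(x, y) \<in> ?\<Omega> \<times> ?\<Omega>. K * d < bform d x y}"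
      using K by (intro large_bform d a) auto
    finally show "(1 / 2 - \<delta>) * (card ?\<Omega>)\<^sup>2 \<le> card {(x, y) \<in> ?\<Omega> \<times> ?\<Omega>. Q x y}"
      by (simp add: Q_def card_Pow)
  next
    fix x x' y y' assume N: "N x x'" "N y y'" and Q: "Q x y" "Q x y'" "Q x' y" "Q x' y'"
    let ?u = "\<lambda>i. rowsum d x i + rowsum d x' i" and ?v = "\<lambda>i. rowsum d y i + rowsum d y' i"
    have "4 * (K * d) < bform d x y + bform d x y' + bform d x' y + bform d x' y'"
      using Q by (simp add: Q_def)
    also have "\<dots> = (\<Sum>i<d. ?u i * ?v i)"
      by (simp add: bform_def sum.distrib[symmetric] algebra_simps)
    also have "\<dots> \<le> (\<Sum>i<d. ((?u i)\<^sup>2 + (?v i)\<^sup>2) / 2)"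
    proof (rule sum_mono)
      have "p * q \<le> (p\<^sup>2 + q\<^sup>2) / 2" for p q :: real
        using sum_squares_bound[of p q] by simp
      then show "?u i * ?v i \<le> ((?u i)\<^sup>2 + (?v i)\<^sup>2) / 2" for i .
    qed
    also have "\<dots> = ((\<Sum>i<d. (?u i)\<^sup>2) + (\<Sum>i<d. (?v i)\<^sup>2)) / 2"
      by (simp only: sum_divide_distrib[symmetric] sum.distrib)
    also have "\<dots> \<le> K * d" using N by (simp add: N_def)
    finally show False using K by simp
  qed
qed

section \<open>Binary trees\<close>

text \<open>Indices are leaves of the binary tree, read from the lowest binary digit upwards: a path
  of length \<open>i\<close> is a residue modulo \<open>2 ^ i\<close>. Indices that are congruent
  modulo \<open>2 ^ l\<close> share a leaf of the tree of depth \<open>l\<close> and branch at none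
  of its levels, so \<open>r\<close> may exceed the number of leaves.\<close>

definition branch :: "nat \<Rightarrow> nat \<Rightarrow> nat \<Rightarrow> bool" where
  "branch i a b \<longleftrightarrow> a mod 2 ^ i = b mod 2 ^ i \<and> a mod 2 ^ Suc i \<noteq> b mod 2 ^ Suc i"

lemma branch_0: "branch 0 a b \<longleftrightarrow> even a \<noteq> even b"
  by (simp add: branch_def) presburger

lemma branch_Suc: "branch (Suc i) a b \<longleftrightarrow> even a = even b \<and> branch i (a div 2) (b div 2)"
proof -
  have m: "a mod 2 ^ Suc j = b mod 2 ^ Suc j
      \<longleftrightarrow> even a = even b \<and> a div 2 mod 2 ^ j = b div 2 mod 2 ^ j" for j
  proof -
    have "a mod 2 ^ Suc j = 2 * (a div 2 mod 2 ^ j) + a mod 2"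
      "b mod 2 ^ Suc j = 2 * (b div 2 mod 2 ^ j) + b mod 2"
      by (simp_all add: mod_mult2_eq)
    moreover have "2 * x + a mod 2 = 2 * y + b mod 2 \<longleftrightarrow> even a = even b \<and> x = y" for x y
      by presburger
    ultimately show ?thesis by (simp only:)
  qed
  show ?thesis unfolding branch_def m[of i] m[of "Suc i"] by argo
qed

text \<open>The branching level is the 2-adic valuation of the difference. In this form differences
  of two pairs can be added.\<close>

lemma branch_dvd:
  "branch i a b \<longleftrightarrow> 2 ^ i dvd int a - int b \<and> \<not> 2 ^ Suc i dvd int a - int b"
proof -
  have "a mod 2 ^ j = b mod 2 ^ j \<longleftrightarrow> 2 ^ j dvd int a - int b" for j
  proof -
    have "a mod 2 ^ j = b mod 2 ^ j \<longleftrightarrow> int (a mod 2 ^ j) = int (b mod 2 ^ j)" by simp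
    also have "\<dots> \<longleftrightarrow> int a mod 2 ^ j = int b mod 2 ^ j" by (simp add: of_nat_mod)
    also have "\<dots> \<longleftrightarrow> 2 ^ j dvd int a - int b" by (rule mod_eq_dvd_iff)
    finally show ?thesis .
  qed
  then show ?thesis by (simp only: branch_def)
qed

lemma ex_branch: "a mod 2 ^ l \<noteq> b mod 2 ^ l \<Longrightarrow> \<exists>i<l. branch i a b"
proof (induction l)
  case (Suc l)
  then show ?case
    by (cases "a mod 2 ^ l = b mod 2 ^ l") (auto simp: branch_def less_Suc_eq)
qed simp

text \<open>Induction on the depth, with half the density lost at every level: if \<open>W\<close>
  has density \<open>e * 2 ^ Suc l\<close>, then a proportion of at least \<open>e * 2 ^ l\<close>
  of the first coordinates have fibres of density \<open>e * 2 ^ l\<close>. Two nearly opposite such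
  coordinates become the root's branches, and trees for the two fibres hang below them.\<close>

lemma dense_tree:
  fixes \<Omega> :: "'a set" and e :: real
  assumes \<Omega>: "finite \<Omega>" "\<Omega> \<noteq> {}" and e: "0 < e"
    and dens: "\<And>A B. A \<subseteq> \<Omega> \<Longrightarrow> B \<subseteq> \<Omega> \<Longrightarrow> e * card \<Omega> \<le> card A \<Longrightarrow> e * card \<Omega> \<le> card B \<Longrightarrow>
      \<exists>a\<in>A. \<exists>b\<in>B. N a b"
    and sym: "\<And>x y. N x y \<Longrightarrow> N y x"
    and W: "W \<subseteq> {xs. set xs \<subseteq> \<Omega> \<and> length xs = l}" "e * 2 ^ l * card \<Omega> ^ l \<le> card W"
  shows "\<exists>v. range v \<subseteq> W \<and> (\<forall>i<l. \<forall>a b. branch i a b \<longrightarrow> N (v a ! i) (v b ! i))"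
  using W
proof (induction l arbitrary: W)
  case 0
  then have "0 < card W" using e by simp
  then have "W \<noteq> {}" by auto
  then have "W = {[]}" using 0 by auto
  then show ?case by auto
next
  case (Suc l)
  let ?n = "real (card \<Omega>)"
  define F where "F p = {xs. p # xs \<in> W}" for p
  have F: "F p \<subseteq> {xs. set xs \<subseteq> \<Omega> \<and> length xs = l}" for p
  proof
    fix xs assume "xs \<in> F p"
    then have "p # xs \<in> {xs. set xs \<subseteq> \<Omega> \<and> length xs = Suc l}"
      using Suc.prems(1) unfolding F_def by blast
    then show "xs \<in> {xs. set xs \<subseteq> \<Omega> \<and> length xs = l}" by simp
  qed
  have fin: "finite {xs. set xs \<subseteq> \<Omega> \<and> length xs = l}"
    using \<Omega>(1) by (rule finite_lists_length_eq)
  have finF: "finite (F p)" for p using F fin by (rule finite_subset)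
  have cF: "real (card (F p)) \<le> ?n ^ l" for p
    using card_mono[OF fin F[of p]] card_lists_length_eq[OF \<Omega>(1), of l]
    by (metis of_nat_le_iff of_nat_power)
  have n: "0 < ?n" using \<Omega> by (simp add: card_gt_0_iff)
  define A where "A = {p \<in> \<Omega>. e * 2 ^ l * ?n ^ l \<le> card (F p)}"
  have "card W \<le> card (SIGMA p:\<Omega>. F p)"
  proof (rule card_inj_on_le)
    show "inj_on (\<lambda>xs. (hd xs, tl xs)) W"
    proof (rule inj_onI)
      fix xs ys assume h: "xs \<in> W" "ys \<in> W" "(hd xs, tl xs) = (hd ys, tl ys)"
      then have "length xs = Suc l" "length ys = Suc l" using Suc.prems(1) by auto
      then show "xs = ys" using h(3) by (cases xs; cases ys) auto
    qed
    show "(\<lambda>xs. (hd xs, tl xs)) ` W \<subseteq> (SIGMA p:\<Omega>. F p)"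
    proof
      fix z assume "z \<in> (\<lambda>xs. (hd xs, tl xs)) ` W"
      then obtain xs where xs: "xs \<in> W" "z = (hd xs, tl xs)" by auto
      then have "xs \<noteq> []" "set xs \<subseteq> \<Omega>" using Suc.prems(1) by auto
      then show "z \<in> (SIGMA p:\<Omega>. F p)" using xs by (cases xs) (auto simp: F_def)
    qed
    show "finite (SIGMA p:\<Omega>. F p)" using \<Omega>(1) finF by auto
  qed
  then have "real (card W) \<le> (\<Sum>p\<in>\<Omega>. real (card (F p)))"
    using \<Omega>(1) finF by (simp flip: of_nat_sum)
  also have "\<dots> = (\<Sum>p\<in>A. real (card (F p))) + (\<Sum>p\<in>\<Omega> - A. real (card (F p)))"
    using \<Omega>(1) by (subst sum.subset_diff[of A \<Omega>]) (auto simp: A_def)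
  also have "\<dots> \<le> (\<Sum>p\<in>A. ?n ^ l) + (\<Sum>p\<in>\<Omega> - A. e * 2 ^ l * ?n ^ l)"
    by (intro add_mono sum_mono cF) (auto simp: A_def)
  also have "\<dots> \<le> (\<Sum>p\<in>A. ?n ^ l) + (\<Sum>p\<in>\<Omega>. e * 2 ^ l * ?n ^ l)"
    using \<Omega>(1) e by (intro add_left_mono sum_mono2) auto
  also have "\<dots> = card A * ?n ^ l + e * 2 ^ l * ?n * ?n ^ l" by simp
  finally have "e * 2 ^ Suc l * ?n ^ Suc l \<le> (card A + e * 2 ^ l * ?n) * ?n ^ l"
    using Suc.prems(2) by (simp add: algebra_simps)
  then have "(e * 2 ^ l * ?n) * ?n ^ l \<le> card A * ?n ^ l"
    by (simp add: algebra_simps)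
  then have A: "e * 2 ^ l * ?n \<le> card A"
    using n by (simp add: mult_le_cancel_right)
  have "e * 1 * ?n \<le> e * 2 ^ l * ?n"
    using e n by (intro mult_right_mono mult_left_mono) auto
  with A have "e * ?n \<le> card A" by simp
  then obtain p p' where p: "p \<in> A" "p' \<in> A" "N p p'"
    using dens[of A A] by (auto simp: A_def)
  obtain v where v: "range v \<subseteq> F p" "\<forall>i<l. \<forall>a b. branch i a b \<longrightarrow> N (v a ! i) (v b ! i)"
    using Suc.IH[OF F[of p]] p(1) by (auto simp: A_def)
  obtain v' where v': "range v' \<subseteq> F p'" "\<forall>i<l. \<forall>a b. branch i a b \<longrightarrow> N (v' a ! i) (v' b ! i)"
    using Suc.IH[OF F[of p']] p(2) by (auto simp: A_def)
  \<comment> \<open>The parity of the index selects the branch at the root; the remaining digits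
    locate the leaf in the subtree.\<close>
  define w where "w a = (if even a then p # v (a div 2) else p' # v' (a div 2))" for a
  have "w a \<in> W" for a
    using v(1) v'(1) by (auto simp: w_def F_def)
  moreover have "N (w a ! i) (w b ! i)" if "i < Suc l" "branch i a b" for i a b
  proof (cases i)
    case 0
    then show ?thesis using that p(3) sym by (auto simp: w_def branch_0)
  next
    case (Suc j)
    then show ?thesis using that v(2) v'(2) by (auto simp: w_def branch_Suc)
  qed
  ultimately show ?case by (intro exI[of _ w]) auto
qed

text \<open>Below \<open>r\<close>, the residue classes \<open>c < q\<close> have
  \<open>k + 1\<close> elements and the other ones \<open>k\<close>. Dividing \<open>r - 1\<close>
  and not \<open>r\<close> makes \<open>k + 1\<close> the ceiling of \<open>r / m\<close> and keeps
  \<open>q\<close> between 1 and \<open>m\<close>.\<close>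

lemma card_le_residues:
  fixes m r :: nat
  assumes A: "A \<subseteq> {..<r}" and m: "0 < m" and r: "0 < r"
  defines "k \<equiv> (r - 1) div m"
  defines "q \<equiv> r - k * m"
  shows "card A \<le> k * card ((\<lambda>x. x mod m) ` A) + min q (card ((\<lambda>x. x mod m) ` A))"
proof -
  let ?R = "(\<lambda>x. x mod m) ` A"
  have finA: "finite A" using A by (rule finite_subset) simp
  have q: "r = k * m + q"
  proof -
    have "k * m \<le> r - 1" by (simp add: k_def)
    then show ?thesis by (simp add: q_def)
  qed
  have "(r - 1) div m * m + (r - 1) mod m = r - 1" by simp
  then have "q \<le> m"
    using q mod_less_divisor[OF m, of "r - 1"] r unfolding k_def by linarith
  have cls: "card {x \<in> A. x mod m = c} \<le> k + (if c < q then 1 else 0)" for c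
  proof -
    have "x div m < k + (if c < q then 1 else 0)" if "x \<in> A" "x mod m = c" for x
    proof -
      have x: "x = x div m * m + c" using that(2) div_mult_mod_eq[of x m] by simp
      have lt: "x < r" using that A by auto
      show ?thesis
      proof (rule ccontr)
        assume h: "\<not> ?thesis"
        show False
        proof (cases "c < q")
          case True
          then have "k + 1 \<le> x div m" using h by (simp only: if_True not_less)
          then have "(k + 1) * m \<le> x div m * m" by (rule mult_le_mono1)
          then have "k * m + m \<le> x" using x unfolding add_mult_distrib by linarith
          then show False using lt q \<open>q \<le> m\<close> by linarith
        next
          case False
          then have "k \<le> x div m" using h by (simp only: if_False add_0_right not_less)
          then have "k * m \<le> x div m * m" by (rule mult_le_mono1)
          then show False using x lt q False by linarith
        qed
      qed
    qed
    then have "(\<lambda>x. x div m) ` {x \<in> A. x mod m = c} \<subseteq> {..<k + (if c < q then 1 else 0)}"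
      unfolding lessThan_def by blast
    moreover have "inj_on (\<lambda>x. x div m) {x \<in> A. x mod m = c}"
    proof (rule inj_onI)
      fix x y assume "x \<in> {x \<in> A. x mod m = c}" "y \<in> {x \<in> A. x mod m = c}" "x div m = y div m"
      then show "x = y" using div_mult_mod_eq[of x m] div_mult_mod_eq[of y m] by simp
    qed
    ultimately have "card {x \<in> A. x mod m = c} \<le> card {..<k + (if c < q then 1 else 0)}"
      by (intro card_inj_on_le) auto
    then show ?thesis by simp
  qed
  have "card A = (\<Sum>c\<in>?R. card {x \<in> A. x mod m = c})"
    using sum.image_gen[OF finA, of "\<lambda>_. 1 :: nat" "\<lambda>x. x mod m"] by simp
  also have "\<dots> \<le> (\<Sum>c\<in>?R. k + (if c < q then 1 else 0))"
    by (intro sum_mono cls)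
  also have "\<dots> = k * card ?R + card {c \<in> ?R. c < q}"
    using finA by (simp add: sum.distrib sum.If_cases Int_def)
  also have "\<dots> \<le> k * card ?R + min q (card ?R)"
  proof -
    have "card {c \<in> ?R. c < q} \<le> card {..<q}" by (intro card_mono) auto
    moreover have "card {c \<in> ?R. c < q} \<le> card ?R" using finA by (intro card_mono) auto
    ultimately show ?thesis by simp
  qed
  finally show ?thesis .
qed

text \<open>Since no level is common to both sets, \<open>a + b\<close> modulo \<open>2\<^sup>l\<close> determines the residues of
  \<open>a\<close> and of \<open>b\<close>; hence the numbers of residues multiply to at most \<open>2\<^sup>l\<close>.\<close>

lemma card_add_le_if_no_common_branch:
  assumes A: "A \<subseteq> {..<r}" and B: "B \<subseteq> {..<r}" and l: "0 < l" "2 ^ (l - 1) < r"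
    and no: "\<And>i a a' b b'. i < l \<Longrightarrow> a \<in> A \<Longrightarrow> a' \<in> A \<Longrightarrow> b \<in> B \<Longrightarrow> b' \<in> B \<Longrightarrow>
      branch i a a' \<Longrightarrow> branch i b b' \<Longrightarrow> False"
  shows "card A + card B \<le> r + (r - 1) div 2 ^ l + 1"
proof -
  let ?m = "2 ^ l :: nat"
  let ?RA = "(\<lambda>x. x mod ?m) ` A" and ?RB = "(\<lambda>x. x mod ?m) ` B"
  have fin: "finite A" "finite B" using A B by (meson finite_lessThan finite_subset)+
  have r: "0 < r" using l by (metis gr0I less_nat_zero_code)
  have le_r: "card A \<le> r" "card B \<le> r"
    using card_mono[OF _ A] card_mono[OF _ B] by simp_all
  have "inj_on (\<lambda>(x, y). (x + y) mod ?m) (?RA \<times> ?RB)"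
  proof (rule inj_onI, clarsimp)
    fix a b a' b' assume ab: "a \<in> A" "b \<in> B" "a' \<in> A" "b' \<in> B"
      and eq: "(a mod ?m + b mod ?m) mod ?m = (a' mod ?m + b' mod ?m) mod ?m"
    have "(a + b) mod ?m = (a' + b') mod ?m" using eq by (simp add: mod_simps)
    then have "int (a + b) mod int ?m = int (a' + b') mod int ?m"
      by (simp only: zmod_int[symmetric])
    then have "int ?m dvd int (a + b) - int (a' + b')"
      by (simp only: mod_eq_dvd_iff)
    then have d: "2 ^ l dvd (int a - int a') + (int b - int b')"
      by (simp add: algebra_simps)
    \<comment> \<open>The sum of the two differences is divisible by \<open>2 ^ l\<close>, so up to
      level \<open>l\<close> they have the same valuation. Distinct residues would thus branch at a
      common level, which \<open>no\<close> forbids.\<close>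
    have dl: "2 ^ j dvd int a - int a' \<longleftrightarrow> 2 ^ j dvd int b - int b'" if "j \<le> l" for j
    proof -
      have "2 ^ j dvd (int a - int a') + (int b - int b')"
        using d that by (meson dvd_trans le_imp_power_dvd)
      then show ?thesis
        using dvd_add_right_iff[of "2 ^ j" "int a - int a'"] dvd_add_left_iff[of "2 ^ j" "int b - int b'"]
        by blast
    qed
    have "branch i b b'" if "branch i a a'" "i < l" for i
      using that dl[of i] dl[of "Suc i"] by (auto simp: branch_dvd)
    then have "a mod ?m = a' mod ?m"
      using no[OF _ ab(1,3,2,4)] ex_branch by blast
    moreover have "branch i a a'" if "branch i b b'" "i < l" for i
      using that dl[of i] dl[of "Suc i"] by (auto simp: branch_dvd)
    then have "b mod ?m = b' mod ?m"
      using no[OF _ ab(1,3,2,4)] ex_branch by blast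
    ultimately show "a mod ?m = a' mod ?m \<and> b mod ?m = b' mod ?m" by simp
  qed
  moreover have "(\<lambda>(x, y). (x + y) mod ?m) ` (?RA \<times> ?RB) \<subseteq> {..<?m}" by auto
  ultimately have "card (?RA \<times> ?RB) \<le> card {..<?m}"
    by (intro card_inj_on_le) auto
  then have prod: "card ?RA * card ?RB \<le> ?m" by (simp add: card_cartesian_product)
  define k where "k = (r - 1) div ?m"
  define q where "q = r - k * ?m"
  have rq: "r = k * ?m + q"
  proof -
    have "k * ?m \<le> r - 1" by (simp add: k_def)
    then show ?thesis by (simp add: q_def)
  qed
  have cA: "card A \<le> k * card ?RA + min q (card ?RA)"
    unfolding q_def k_def by (rule card_le_residues[OF A _ r]) simp
  have cB: "card B \<le> k * card ?RB + min q (card ?RB)"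
    unfolding q_def k_def by (rule card_le_residues[OF B _ r]) simp
  show ?thesis
  proof (cases "A = {} \<or> B = {}")
    case True
    then show ?thesis using le_r by auto
  next
    case False
    then obtain x y where xy: "card ?RA = Suc x" "card ?RB = Suc y"
      using fin by (metis card_gt_0_iff finite_imageI gr0_implies_Suc image_is_empty)
    have prod': "x * y + x + y + 1 \<le> ?m" using prod unfolding xy by simp
    show ?thesis
    proof (cases "k = 0")
      case k0: True
      show ?thesis
      proof (cases "x = 0 \<or> y = 0")
        case True
        then show ?thesis using cA cB le_r k0 xy by auto
      next
        case False
        then obtain x' y' where xy': "x = Suc x'" "y = Suc y'" by (metis not0_implies_Suc)
        \<comment> \<open>In this case \<open>r \<le> 2 ^ l\<close>, and each set has at least two
          residues. The product bound then gives \<open>x + y \<le> 2 ^ (l - 1)\<close>, and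
          \<open>2 ^ (l - 1) < r\<close> finishes; this is where the minimality of \<open>l\<close>
          enters.\<close>
        have "?m = 2 * 2 ^ (l - 1)" using l(1) by (cases l) auto
        then have "x + y \<le> 2 ^ (l - 1)" using prod' unfolding xy' by simp
        then show ?thesis using cA cB l(2) k0 xy by simp
      qed
    next
      case False
      \<comment> \<open>Together the two remainder terms exceed a single \<open>q\<close> by at most
        \<open>min x y + 1\<close>. The mixed term \<open>k * (x * y)\<close>, still available in
        the bound \<open>k * 2 ^ l\<close>, pays for \<open>min x y\<close>.\<close>
      have "min x y \<le> k * (x * y)"
      proof (cases "x = 0 \<or> y = 0")
        case True
        then show ?thesis by auto
      next
        case nz: False
        have "min x y \<le> 1 * (x * 1)" by simp
        also have "\<dots> \<le> k * (x * y)" using False nz by (intro mult_le_mono) auto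
        finally show ?thesis .
      qed
      have "card A + card B \<le> k * (x + y + 2) + min q (Suc x) + min q (Suc y)"
        using cA cB unfolding xy by (simp add: algebra_simps)
      also have "\<dots> \<le> k * (x + y + 2) + q + min x y + 1" by (simp add: min_def)
      also have "\<dots> \<le> k * (x + y + 2) + q + k * (x * y) + 1"
        using \<open>min x y \<le> k * (x * y)\<close> by simp
      also have "\<dots> = k * (x * y + x + y + 1) + k + q + 1"
        by (simp add: algebra_simps)
      also have "\<dots> \<le> k * ?m + k + q + 1"
        using prod' by (intro add_right_mono mult_left_mono) auto
      also have "\<dots> = r + k + 1" using rq by simp
      finally show ?thesis by (simp add: k_def)
    qed
  qed
qed

section \<open>Sparse hypergraphs\<close>

text \<open>The probability space of the random hypergraph: \<open>N\<close> independent uniform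
  \<open>r\<close>-tuples, with repetitions allowed. Probabilities are expressed as cardinalities
  throughout.\<close>

definition seqs :: "nat \<Rightarrow> nat \<Rightarrow> 'a set \<Rightarrow> (nat \<Rightarrow> nat \<Rightarrow> 'a) set" where
  "seqs N r X = ({..<N} \<rightarrow>\<^sub>E ({..<r} \<rightarrow>\<^sub>E X))"

lemma finite_seqs [simp]: "finite X \<Longrightarrow> finite (seqs N r X)"
  by (simp add: seqs_def finite_PiE)

lemma card_seqs: "finite X \<Longrightarrow> card (seqs N r X) = (card X ^ r) ^ N"
  by (simp add: seqs_def card_PiE finite_PiE)

type_synonym coincidences = "((nat \<times> nat) \<times> (nat \<times> nat)) list"

definition satisfies :: "(nat \<Rightarrow> nat \<Rightarrow> 'a) \<Rightarrow> coincidences \<Rightarrow> bool" where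
  "satisfies g L \<longleftrightarrow> (\<forall>((i, p), (j, q)) \<in> set L. g i p = g j q)"

text \<open>The coincidences are independent: their second cells are distinct and none of them is a
  first cell, so the entries there are determined by the other entries. Each coincidence thus costs
  a factor \<open>card X\<close>.\<close>

lemma card_satisfies:
  fixes X :: "'a set"
  assumes X: "finite X"
    and L: "set L \<subseteq> ({..<N} \<times> {..<r}) \<times> ({..<N} \<times> {..<r})" "distinct (map snd L)"
    and disj: "set (map fst L) \<inter> set (map snd L) = {}"
  shows "card {g \<in> seqs N r X. satisfies g L} * card X ^ length L \<le> card (seqs N r X)"
proof -
  let ?C = "{..<N} \<times> {..<r}"
  define W where "W = set (map snd L)"
  define S where "S = {g \<in> seqs N r X. satisfies g L}"
  \<comment> \<open>The entries at the free cells, which determine the whole sequence.\<close>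
  define \<Phi> where "\<Phi> g = (\<lambda>c\<in>?C - W. g (fst c) (snd c))" for g :: "nat \<Rightarrow> nat \<Rightarrow> 'a"
  have W: "W \<subseteq> ?C" using L(1) by (auto simp: W_def)
  have cW: "card W = length L" using L(2) by (metis W_def distinct_card length_map)
  have range: "\<Phi> ` S \<subseteq> (?C - W) \<rightarrow>\<^sub>E X"
  proof -
    have "g i p \<in> X" if "g \<in> S" "i < N" "p < r" for g i p
    proof -
      have "g i \<in> {..<r} \<rightarrow>\<^sub>E X" using that unfolding S_def seqs_def by (blast intro: PiE_mem)
      then show ?thesis using that(3) by (blast intro: PiE_mem)
    qed
    then show ?thesis unfolding \<Phi>_def image_subset_iff restrict_PiE_iff by auto
  qed
  have "inj_on \<Phi> S"
  proof (rule inj_onI)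
    fix g h assume g: "g \<in> S" and h: "h \<in> S" and eq: "\<Phi> g = \<Phi> h"
    have free: "g i p = h i p" if "(i, p) \<in> ?C - W" for i p
      using fun_cong[OF eq, of "(i, p)"] that by (simp add: \<Phi>_def)
    have "g i p = h i p" if ip: "i < N" "p < r" for i p
    proof (cases "(i, p) \<in> W")
      case True
      then obtain j q where u: "((j, q), (i, p)) \<in> set L" by (auto simp: W_def)
      then have "(j, q) \<in> ?C - W" using L(1) disj by (force simp: W_def)
      then have "g j q = h j q" by (rule free)
      moreover have "g j q = g i p" "h j q = h i p"
        using g h u by (auto simp: S_def satisfies_def)
      ultimately show ?thesis by simp
    next
      case False
      then show ?thesis using ip by (intro free) auto
    qed
    moreover have "g i p = h i p" if "i < N" "\<not> p < r" for i p
    proof -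
      have "f i p = undefined" if f: "f \<in> S" for f
      proof -
        have "f i \<in> {..<r} \<rightarrow>\<^sub>E X"
          using f \<open>i < N\<close> unfolding S_def seqs_def by (blast intro: PiE_mem)
        then show ?thesis using \<open>\<not> p < r\<close> PiE_arb by fastforce
      qed
      from this[OF g] this[OF h] show ?thesis by simp
    qed
    moreover have "g i p = h i p" if "\<not> i < N" for i p
    proof -
      have "f i = undefined" if "f \<in> S" for f
        using that \<open>\<not> i < N\<close> PiE_arb[of f "{..<N}" _ i] unfolding S_def seqs_def by blast
      from this[OF g] this[OF h] show ?thesis by simp
    qed
    ultimately have "g i p = h i p" for i p by blast
    then show "g = h" by blast
  qed
  then have "card S \<le> card ((?C - W) \<rightarrow>\<^sub>E X)"
    using X range by (intro card_inj_on_le[of \<Phi>]) (auto intro!: finite_PiE)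
  also have "\<dots> = card X ^ (N * r - length L)"
    using W by (simp add: card_PiE card_Diff_subset finite_subset[OF W] cW)
  finally have "card S * card X ^ length L \<le> card X ^ (N * r - length L) * card X ^ length L"
    by (rule mult_le_mono1)
  also have "\<dots> = card X ^ (N * r)"
  proof -
    have "length L \<le> N * r"
      using card_mono[OF _ W] cW by (simp add: card_cartesian_product)
    then show ?thesis by (simp flip: power_add)
  qed
  also have "\<dots> = card (seqs N r X)"
    using X by (simp add: card_seqs power_mult[symmetric] mult.commute)
  finally show ?thesis by (simp add: S_def)
qed

text \<open>A coincidence list of length \<open>k\<close> describes a cycle of \<open>k\<close> distinct hyperedges: hyperedge
  \<open>i\<close> meets the next one in a vertex, entering and leaving each hyperedge at different positions.
  For \<open>k = 1\<close> this is a repeated vertex.\<close>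

definition loops :: "nat \<Rightarrow> nat \<Rightarrow> coincidences set" where
  "loops N r = {[((i, p), (i, q))] | i p q. i < N \<and> p < r \<and> q < r \<and> p \<noteq> q}"

definition two_cycles :: "nat \<Rightarrow> nat \<Rightarrow> coincidences set" where
  "two_cycles N r = {[((i, q), (j, p')), ((j, q'), (i, p))] | i j p q p' q'.
     i < N \<and> j < N \<and> i \<noteq> j \<and> p < r \<and> q < r \<and> p' < r \<and> q' < r \<and> p \<noteq> q \<and> p' \<noteq> q'}"

definition three_cycles :: "nat \<Rightarrow> nat \<Rightarrow> coincidences set" where
  "three_cycles N r = {[((i, q), (j, p')), ((j, q'), (k, p'')), ((k, q''), (i, p))] | i j k p q p' q' p'' q''.
     i < N \<and> j < N \<and> k < N \<and> i \<noteq> j \<and> j \<noteq> k \<and> i \<noteq> k \<and> p < r \<and> q < r \<and> p' < r \<and> q' < r \<and>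
     p'' < r \<and> q'' < r \<and> p \<noteq> q \<and> p' \<noteq> q' \<and> p'' \<noteq> q''}"

text \<open>A cycle of length \<open>k\<close> consists of \<open>k\<close> hyperedges, each with a
  position of entry and one of exit; this and the two bounds below are instances of
  \<open>(N * r ^ 2) ^ k\<close>.\<close>

lemma loops_bound: "finite (loops N r) \<and> card (loops N r) \<le> N * r ^ 2"
proof -
  let ?T = "{..<N} \<times> {..<r} \<times> {..<r}"
  have sub: "loops N r \<subseteq> (\<lambda>(i, p, q). [((i, p), (i, q))]) ` ?T"
    by (auto simp: loops_def image_iff)
  have "card (loops N r) \<le> card ?T"
    using sub by (intro surj_card_le) auto
  then show ?thesis
    using finite_subset[OF sub] by (simp add: card_cartesian_product power2_eq_square)
qed

lemma two_cycles_bound: "finite (two_cycles N r) \<and> card (two_cycles N r) \<le> (N * r ^ 2) ^ 2"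
proof -
  let ?T = "{..<N} \<times> {..<N} \<times> {..<r} \<times> {..<r} \<times> {..<r} \<times> {..<r}"
  let ?f = "\<lambda>(i, j, p, q, p', q'). [((i, q), (j, p')), ((j, q'), (i, p))]"
  have sub: "two_cycles N r \<subseteq> ?f ` ?T"
  proof
    fix L assume "L \<in> two_cycles N r"
    then obtain i j p q p' q' where "L = ?f (i, j, p, q, p', q')" "(i, j, p, q, p', q') \<in> ?T"
      by (auto simp: two_cycles_def)
    then show "L \<in> ?f ` ?T" by (rule image_eqI)
  qed
  have "card (two_cycles N r) \<le> card ?T"
    using sub by (intro surj_card_le) auto
  then show ?thesis
    using finite_subset[OF sub] by (simp add: card_cartesian_product power2_eq_square mult_ac)
qed

lemma three_cycles_bound: "finite (three_cycles N r) \<and> card (three_cycles N r) \<le> (N * r ^ 2) ^ 3"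
proof -
  let ?T = "{..<N} \<times> {..<N} \<times> {..<N} \<times> {..<r} \<times> {..<r} \<times> {..<r} \<times> {..<r} \<times> {..<r} \<times> {..<r}"
  let ?f = "\<lambda>(i, j, k, p, q, p', q', p'', q'').
    [((i, q), (j, p')), ((j, q'), (k, p'')), ((k, q''), (i, p))]"
  have sub: "three_cycles N r \<subseteq> ?f ` ?T"
  proof
    fix L assume "L \<in> three_cycles N r"
    then obtain i j k p q p' q' p'' q'' where
      "L = ?f (i, j, k, p, q, p', q', p'', q'')" "(i, j, k, p, q, p', q', p'', q'') \<in> ?T"
      by (auto simp: three_cycles_def)
    then show "L \<in> ?f ` ?T" by (rule image_eqI)
  qed
  have "card (three_cycles N r) \<le> card ?T"
    using sub by (intro surj_card_le) auto
  then show ?thesis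
    using finite_subset[OF sub] by (simp add: card_cartesian_product power2_eq_square power3_eq_cube mult_ac)
qed

definition cycles :: "nat \<Rightarrow> nat \<Rightarrow> coincidences set" where
  "cycles N r = loops N r \<union> two_cycles N r \<union> three_cycles N r"

lemma finite_cycles: "finite (cycles N r)"
  using loops_bound two_cycles_bound three_cycles_bound by (simp add: cycles_def)

text \<open>First moment: with \<open>N\<close> linear in \<open>card X\<close>, the number of
  cycles of length \<open>k\<close> grows like \<open>card X ^ k\<close> and cancels the probability
  of each. So the expected number of cycles present is bounded independently of
  \<open>X\<close>.\<close>

lemma sum_satisfied:
  fixes X :: "'a set" and \<C> :: "coincidences set" and b :: real
  assumes X: "finite X" "X \<noteq> {}" and \<C>: "finite \<C>" "real (card \<C>) \<le> (b * card X) ^ k"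
    and good: "\<And>L. L \<in> \<C> \<Longrightarrow> length L = k \<and> set L \<subseteq> ({..<N} \<times> {..<r}) \<times> ({..<N} \<times> {..<r}) \<and>
      distinct (map snd L) \<and> set (map fst L) \<inter> set (map snd L) = {}"
  shows "(\<Sum>g\<in>seqs N r X. real (card {L \<in> \<C>. satisfies g L})) \<le> b ^ k * card (seqs N r X)"
proof -
  let ?G = "seqs N r X" and ?n = "real (card X)"
  have n: "0 < ?n" using X by (simp add: card_gt_0_iff)
  have "(\<Sum>g\<in>?G. real (card {L \<in> \<C>. satisfies g L})) = (\<Sum>g\<in>?G. \<Sum>L\<in>\<C>. if satisfies g L then 1 else 0)"
    using \<C>(1) by (simp add: sum.If_cases Int_def)
  also have "\<dots> = (\<Sum>L\<in>\<C>. \<Sum>g\<in>?G. if satisfies g L then 1 else 0)"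
    by (rule sum.swap)
  also have "\<dots> = (\<Sum>L\<in>\<C>. real (card {g \<in> ?G. satisfies g L}))"
    using X(1) by (simp add: sum.If_cases Int_def)
  also have "\<dots> \<le> (\<Sum>L\<in>\<C>. card ?G / ?n ^ k)"
  proof (rule sum_mono)
    fix L assume "L \<in> \<C>"
    then have "card {g \<in> ?G. satisfies g L} * card X ^ length L \<le> card ?G"
      using card_satisfies[OF X(1), of L N r] good[OF \<open>L \<in> \<C>\<close>] by blast
    then have "real (card {g \<in> ?G. satisfies g L}) * ?n ^ k \<le> card ?G"
      using good[OF \<open>L \<in> \<C>\<close>] unfolding of_nat_power[symmetric] of_nat_mult[symmetric] of_nat_le_iff
      by simp
    then show "real (card {g \<in> ?G. satisfies g L}) \<le> card ?G / ?n ^ k"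
      using n by (simp add: pos_le_divide_eq)
  qed
  also have "\<dots> = card \<C> * (card ?G / ?n ^ k)" by simp
  also have "\<dots> \<le> (b * ?n) ^ k * (card ?G / ?n ^ k)"
    using \<C>(2) by (intro mult_right_mono) auto
  also have "\<dots> = b ^ k * card ?G" using n by (simp add: power_mult_distrib)
  finally show ?thesis .
qed

lemma sum_satisfied_cycles:
  fixes X :: "'a set" and c r :: nat
  assumes X: "finite X" "X \<noteq> {}"
  defines "b \<equiv> real (c * r ^ 2)" and "N \<equiv> c * card X"
  shows "(\<Sum>g\<in>seqs N r X. real (card {L \<in> cycles N r. satisfies g L}))
    \<le> (b + b ^ 2 + b ^ 3) * card (seqs N r X)"
proof -
  let ?G = "seqs N r X"
  let ?s = "\<lambda>\<C>. \<Sum>g\<in>?G. real (card {L \<in> \<C>. satisfies g L})"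
  have N: "real (N * r ^ 2) = b * card X" by (simp add: b_def N_def)
  have "?s (loops N r) \<le> b ^ 1 * card ?G"
  proof (rule sum_satisfied[OF X])
    show "real (card (loops N r)) \<le> (b * card X) ^ 1"
      using loops_bound[of N r] N by (metis of_nat_mono power_one_right)
  qed (use loops_bound[of N r] in \<open>auto simp: loops_def\<close>)
  moreover have "?s (two_cycles N r) \<le> b ^ 2 * card ?G"
  proof (rule sum_satisfied[OF X])
    show "real (card (two_cycles N r)) \<le> (b * card X) ^ 2"
      using two_cycles_bound[of N r] N by (metis of_nat_mono of_nat_power)
  qed (use two_cycles_bound[of N r] in \<open>auto simp: two_cycles_def\<close>)
  moreover have "?s (three_cycles N r) \<le> b ^ 3 * card ?G"
  proof (rule sum_satisfied[OF X])
    show "real (card (three_cycles N r)) \<le> (b * card X) ^ 3"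
      using three_cycles_bound[of N r] N by (metis of_nat_mono of_nat_power)
  qed (use three_cycles_bound[of N r] in \<open>auto simp: three_cycles_def\<close>)
  moreover have "?s (cycles N r) \<le> ?s (loops N r) + ?s (two_cycles N r) + ?s (three_cycles N r)"
    unfolding sum.distrib[symmetric]
  proof (rule sum_mono)
    fix g
    have "{L \<in> cycles N r. satisfies g L} = {L \<in> loops N r. satisfies g L} \<union>
      {L \<in> two_cycles N r. satisfies g L} \<union> {L \<in> three_cycles N r. satisfies g L}"
      by (auto simp: cycles_def)
    then have "card {L \<in> cycles N r. satisfies g L} \<le> card {L \<in> loops N r. satisfies g L} +
      card {L \<in> two_cycles N r. satisfies g L} + card {L \<in> three_cycles N r. satisfies g L}"
      by (metis (no_types, lifting) card_Un_le add_right_mono le_trans)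
    then show "real (card {L \<in> cycles N r. satisfies g L}) \<le> card {L \<in> loops N r. satisfies g L} +
      real (card {L \<in> two_cycles N r. satisfies g L}) + card {L \<in> three_cycles N r. satisfies g L}"
      by linarith
  qed
  ultimately show ?thesis by (simp add: algebra_simps)
qed

text \<open>Deleting the first hyperedge of every cycle present destroys the cycle. Let hyperedge
  \<open>i\<close> contain \<open>a\<close> and \<open>b\<close>. A further vertex \<open>c\<close>
  outside it would be joined to them by hyperedges \<open>j\<close> and \<open>k\<close>: if these
  coincide, two hyperedges share \<open>a\<close> and \<open>b\<close>; otherwise the three of them
  form a triangle.\<close>

lemma clique_in_hyperedge:
  fixes g :: "nat \<Rightarrow> nat \<Rightarrow> 'a"
  assumes I: "I \<subseteq> {..<N}"
    and clean: "\<And>L. L \<in> cycles N r \<Longrightarrow> satisfies g L \<Longrightarrow> fst (fst (hd L)) \<notin> I"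
  shows "i \<in> I \<Longrightarrow> inj_on (g i) {..<r}"
    and "a \<in> K \<Longrightarrow> b \<in> K \<Longrightarrow> a \<noteq> b \<Longrightarrow>
      (\<And>x y. x \<in> K \<Longrightarrow> y \<in> K \<Longrightarrow> x \<noteq> y \<Longrightarrow> \<exists>i\<in>I. x \<in> g i ` {..<r} \<and> y \<in> g i ` {..<r}) \<Longrightarrow>
      \<exists>i\<in>I. K \<subseteq> g i ` {..<r}"
proof -
  show "inj_on (g i) {..<r}" if i: "i \<in> I" for i
  proof (rule inj_onI, rule ccontr)
    fix p q assume pq: "p \<in> {..<r}" "q \<in> {..<r}" "g i p = g i q" "p \<noteq> q"
    have "[((i, p), (i, q))] \<in> cycles N r"
      using pq i I by (auto simp: cycles_def loops_def)
    from clean[OF this] show False using pq i by (simp add: satisfies_def)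
  qed
  have ltN: "i < N" if "i \<in> I" for i using I that by auto
  have two: "i = j" if h: "i \<in> I" "j \<in> I" "x \<noteq> y" "x \<in> g i ` {..<r}" "y \<in> g i ` {..<r}"
    "x \<in> g j ` {..<r}" "y \<in> g j ` {..<r}" for i j x y
  proof (rule ccontr)
    assume ij: "i \<noteq> j"
    obtain q p p' q' where e: "g i q = x" "g i p = y" "g j p' = x" "g j q' = y"
      "q < r" "p < r" "p' < r" "q' < r" using h(4-7) by (auto simp: image_iff)
    have "[((i, q), (j, p')), ((j, q'), (i, p))] \<in> two_cycles N r"
      using e ij h(1-3) ltN by (auto simp: two_cycles_def)
    then have "[((i, q), (j, p')), ((j, q'), (i, p))] \<in> cycles N r"
      by (simp add: cycles_def)
    from clean[OF this] show False using e h by (simp add: satisfies_def)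
  qed
  have three: False if h: "i \<in> I" "j \<in> I" "k \<in> I" "i \<noteq> j" "j \<noteq> k" "i \<noteq> k" "x \<noteq> y" "y \<noteq> z" "x \<noteq> z"
    "x \<in> g i ` {..<r}" "x \<in> g j ` {..<r}" "y \<in> g j ` {..<r}" "y \<in> g k ` {..<r}"
    "z \<in> g k ` {..<r}" "z \<in> g i ` {..<r}" for i j k x y z
  proof -
    obtain q p' q' p'' q'' p where e: "g i q = x" "g j p' = x" "g j q' = y" "g k p'' = y"
      "g k q'' = z" "g i p = z" "q < r" "p < r" "p' < r" "q' < r" "p'' < r" "q'' < r"
      using h(10-15) by (auto simp: image_iff)
    let ?L = "[((i, q), (j, p')), ((j, q'), (k, p'')), ((k, q''), (i, p))]"
    have "p \<noteq> q" "p' \<noteq> q'" "p'' \<noteq> q''" using e h(7-9) by auto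
    then have "?L \<in> three_cycles N r"
      using e h(1-6) ltN by (auto simp: three_cycles_def)
    then have "?L \<in> cycles N r" by (simp add: cycles_def)
    from clean[OF this] show False using e h(1) by (simp add: satisfies_def)
  qed
  show "\<exists>i\<in>I. K \<subseteq> g i ` {..<r}" if ab: "a \<in> K" "b \<in> K" "a \<noteq> b"
    and adj: "\<And>x y. x \<in> K \<Longrightarrow> y \<in> K \<Longrightarrow> x \<noteq> y \<Longrightarrow> \<exists>i\<in>I. x \<in> g i ` {..<r} \<and> y \<in> g i ` {..<r}"
    for a b K
  proof -
    obtain i where i: "i \<in> I" "a \<in> g i ` {..<r}" "b \<in> g i ` {..<r}" using adj[OF ab] by blast
    have "c \<in> g i ` {..<r}" if c: "c \<in> K" for c
    proof (cases "c = a \<or> c = b")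
      case True
      then show ?thesis using i by auto
    next
      case False
      obtain j where j: "j \<in> I" "a \<in> g j ` {..<r}" "c \<in> g j ` {..<r}"
        using adj[OF ab(1) c] False by blast
      obtain k where k: "k \<in> I" "c \<in> g k ` {..<r}" "b \<in> g k ` {..<r}"
        using adj[OF c ab(2)] False by blast
      show ?thesis
      proof (cases "i = j \<or> i = k")
        case True
        then show ?thesis using j k by auto
      next
        case ne: False
        then have "j \<noteq> k" using two[OF i(1) j(1) ab(3) i(2,3) j(2)] k by blast
        then show ?thesis
          using three[OF i(1) j(1) k(1) _ _ _ _ _ ab(3) i(2) j(2,3) k(2,3) i(3)] ne False by blast
      qed
    qed
    then show ?thesis using i(1) by blast
  qed
qed

text \<open>Independence: avoiding a set of tuples in all \<open>N\<close> places is again a product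
  condition.\<close>

lemma card_missing:
  fixes X :: "'a set" and q :: real
  assumes X: "finite X" and q: "0 \<le> q" and S: "S \<subseteq> X"
    and hit: "(1 - q) * card X ^ r \<le> card (U \<inter> ({..<r} \<rightarrow>\<^sub>E S))"
  shows "card {g \<in> seqs N r X. \<forall>i<N. g i \<notin> U \<inter> ({..<r} \<rightarrow>\<^sub>E S)} \<le> q ^ N * card (seqs N r X)"
proof -
  let ?T = "{..<r} \<rightarrow>\<^sub>E X" and ?B = "U \<inter> ({..<r} \<rightarrow>\<^sub>E S)"
  have finT: "finite ?T" using X by (intro finite_PiE) auto
  have sub: "?B \<subseteq> ?T" using S by (auto simp: PiE_iff)
  have cT: "card ?T = card X ^ r" using X by (simp add: card_PiE)
  have "real (card (?T - ?B)) = real (card ?T) - card ?B"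
    using sub finT by (simp add: card_Diff_subset finite_subset[OF sub] card_mono of_nat_diff)
  then have d: "real (card (?T - ?B)) \<le> q * card X ^ r"
    using hit by (simp add: cT algebra_simps)
  have "{g \<in> seqs N r X. \<forall>i<N. g i \<notin> ?B} = ({..<N} \<rightarrow>\<^sub>E (?T - ?B))"
  proof -
    have "{g \<in> {..<N} \<rightarrow>\<^sub>E T. \<forall>i<N. g i \<notin> B} = ({..<N} \<rightarrow>\<^sub>E (T - B))"
      for T B :: "(nat \<Rightarrow> 'a) set"
      by (simp only: set_eq_iff mem_Collect_eq PiE_iff Diff_iff lessThan_iff Ball_def) blast
    then show ?thesis unfolding seqs_def .
  qed
  then have "real (card {g \<in> seqs N r X. \<forall>i<N. g i \<notin> ?B}) = real (card (?T - ?B)) ^ N"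
    by (simp add: card_PiE)
  also have "\<dots> \<le> (q * card X ^ r) ^ N" using d by (intro power_mono) auto
  also have "\<dots> = q ^ N * card (seqs N r X)"
    using X by (simp add: card_seqs power_mult_distrib)
  finally show ?thesis .
qed

text \<open>The clause on cliques asks for two distinct vertices, since a single vertex may lie in
  no hyperedge.\<close>

definition sparse_hitting :: "nat \<Rightarrow> real \<Rightarrow> 'a set \<Rightarrow> (nat \<Rightarrow> 'a) set \<Rightarrow> bool" where
  "sparse_hitting r z X H \<longleftrightarrow> (\<forall>u\<in>H. inj_on u {..<r}) \<and>
      (\<forall>K a b. a \<in> K \<and> b \<in> K \<and> a \<noteq> b \<and>
        (\<forall>x\<in>K. \<forall>y\<in>K. x \<noteq> y \<longrightarrow> (\<exists>u\<in>H. x \<in> u ` {..<r} \<and> y \<in> u ` {..<r})) \<longrightarrow>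
        (\<exists>u\<in>H. K \<subseteq> u ` {..<r})) \<and>
      (\<forall>S. S \<subseteq> X \<and> z \<le> card S \<longrightarrow> (\<exists>u\<in>H. u ` {..<r} \<subseteq> S))"

text \<open>The deletion method. With linearly many random tuples the probability of missing a given
  dense set is exponentially small, which beats the number of sets, while only boundedly many tuples
  lie on short cycles. To survive their deletion, a set is first stripped of the boundedly many
  vertices of the deleted tuples; this turns the density \<open>2 * \<epsilon>\<close> into at least
  \<open>\<epsilon>\<close>.\<close>

lemma sparse_hypergraph:
  fixes r :: nat and \<epsilon> \<beta> :: real
  assumes r: "0 < r" and \<epsilon>: "0 < \<epsilon>" and \<beta>: "0 < \<beta>"
  obtains n0 :: nat where "\<And>(X :: 'a set) U. finite X \<Longrightarrow> n0 \<le> card X \<Longrightarrow>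
    (\<And>S. S \<subseteq> X \<Longrightarrow> \<epsilon> * card X \<le> card S \<Longrightarrow> \<beta> * card X ^ r \<le> card (U \<inter> ({..<r} \<rightarrow>\<^sub>E S))) \<Longrightarrow>
    \<exists>H. H \<subseteq> U \<inter> ({..<r} \<rightarrow>\<^sub>E X) \<and> sparse_hitting r (2 * \<epsilon> * card X) X H"
proof -
  define q where "q = max 0 (1 - \<beta>)"
  have q: "0 \<le> q" "q < 1" using \<beta> by (auto simp: q_def)
  \<comment> \<open>The value 1/8 beats the \<open>2 ^ card X\<close> sets and leaves total failure
    probability at most \<open>(1 / 4) ^ card X\<close>.\<close>
  obtain c :: nat where c: "q ^ c < 1 / 8"
    using real_arch_pow_inv[of "1 / 8" q] q(2) by auto
  define b where "b = real (c * r ^ 2)"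
  \<comment> \<open>More than twice the expected number of cycles, so by Markov at most half of the
    sequences have more than \<open>D\<close>; the summand 1 keeps \<open>D\<close>
    positive.\<close>
  define D where "D = 2 * (b + b ^ 2 + b ^ 3) + 1"
  have b: "0 \<le> b" by (simp add: b_def)
  have D: "0 < D" using b by (simp add: D_def add_nonneg_pos)
  obtain n1 :: nat where n1: "D * r / \<epsilon> \<le> n1" using real_arch_simple by blast
  show ?thesis
  proof (rule that[of "max 1 n1"])
    fix X :: "'a set" and U
    assume X: "finite X" and n0: "max 1 n1 \<le> card X"
      and dense: "\<And>S. S \<subseteq> X \<Longrightarrow> \<epsilon> * card X \<le> card S \<Longrightarrow>
        \<beta> * card X ^ r \<le> card (U \<inter> ({..<r} \<rightarrow>\<^sub>E S))"
    have ne: "X \<noteq> {}" using n0 by auto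
    have Dr: "D * r \<le> \<epsilon> * card X"
    proof -
      have "D * r / \<epsilon> \<le> card X" using n1 n0 by linarith
      then show ?thesis using \<epsilon> by (simp add: pos_divide_le_eq mult.commute)
    qed
    define N where "N = c * card X"
    define G where "G = seqs N r X"
    have finG: "finite G" using X by (simp add: G_def)
    have cG: "0 < card G" using X ne by (simp add: G_def card_seqs card_gt_0_iff)
    define conf where "conf g = {L \<in> cycles N r. satisfies g L}" for g :: "nat \<Rightarrow> nat \<Rightarrow> 'a"
    define G1 where "G1 = {g \<in> G. D < card (conf g)}"
    define \<S> where "\<S> = {S. S \<subseteq> X \<and> \<epsilon> * card X \<le> card S}"
    define miss where "miss S = {g \<in> G. \<forall>i<N. g i \<notin> U \<inter> ({..<r} \<rightarrow>\<^sub>E S)}" for S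
    define G2 where "G2 = (\<Union>S\<in>\<S>. miss S)"
    have "D * card G1 \<le> (\<Sum>g\<in>G1. real (card (conf g)))"
      using sum_bounded_below[of G1 D "\<lambda>g. real (card (conf g))"] by (simp add: G1_def mult.commute)
    also have "\<dots> \<le> (\<Sum>g\<in>G. real (card (conf g)))"
      using finG by (intro sum_mono2) (auto simp: G1_def)
    also have "\<dots> \<le> (b + b ^ 2 + b ^ 3) * card G"
      unfolding conf_def G_def N_def b_def by (rule sum_satisfied_cycles[OF X ne])
    also have "\<dots> \<le> (D / 2) * card G"
      by (intro mult_right_mono) (auto simp: D_def)
    finally have G1: "2 * real (card G1) \<le> card G" using D by simp
    have "real (card G2) \<le> (\<Sum>S\<in>\<S>. real (card (miss S)))"
      unfolding G2_def of_nat_sum[symmetric] of_nat_le_iff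
      using X by (intro card_UN_le) (auto simp: \<S>_def)
    also have "\<dots> \<le> (\<Sum>S\<in>\<S>. q ^ N * card G)"
    proof (rule sum_mono)
      fix S assume S: "S \<in> \<S>"
      have "(1 - q) * card X ^ r \<le> \<beta> * card X ^ r"
        by (intro mult_right_mono) (auto simp: q_def)
      also have "\<dots> \<le> card (U \<inter> ({..<r} \<rightarrow>\<^sub>E S))"
        using S by (intro dense) (auto simp: \<S>_def)
      finally show "real (card (miss S)) \<le> q ^ N * card G"
        unfolding miss_def G_def using S X q by (intro card_missing) (auto simp: \<S>_def)
    qed
    also have "\<dots> = card \<S> * (q ^ N * card G)" by simp
    also have "\<dots> \<le> 2 ^ card X * ((1 / 8) ^ card X * card G)"
    proof (rule mult_mono)
      have "card \<S> \<le> card (Pow X)" using X by (intro card_mono) (auto simp: \<S>_def)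
      then show "real (card \<S>) \<le> 2 ^ card X"
        using X by (simp add: card_Pow)
      have "(q ^ c) ^ card X \<le> (1 / 8) ^ card X" using c q by (intro power_mono) auto
      then show "q ^ N * card G \<le> (1 / 8) ^ card X * card G"
        by (intro mult_right_mono) (auto simp: N_def power_mult)
    qed (use q in auto)
    also have "\<dots> = (1 / 4) ^ card X * card G"
      by (simp add: power_mult_distrib[symmetric] mult.assoc[symmetric])
    also have "\<dots> \<le> (1 / 4) ^ 1 * card G"
      using n0 by (intro mult_right_mono power_decreasing) auto
    finally have G2: "4 * real (card G2) \<le> card G" by simp
    have "card (G1 \<union> G2) \<le> card G1 + card G2" by (rule card_Un_le)
    also have "\<dots> < card G"
    proof -
      have "real (card G1 + card G2) < card G" using G1 G2 cG by simp
      then show ?thesis by linarith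
    qed
    finally have "card (G1 \<union> G2) < card G" .
    then have "\<not> G \<subseteq> G1 \<union> G2"
    proof -
      have "finite (G1 \<union> G2)"
        using finG by (rule finite_subset[rotated]) (auto simp: G1_def G2_def miss_def)
      then show ?thesis using card_mono[of "G1 \<union> G2" G] \<open>card (G1 \<union> G2) < card G\<close> by linarith
    qed
    then obtain g where g: "g \<in> G" "g \<notin> G1" "g \<notin> G2" by blast
    define Z where "Z = (\<lambda>L. fst (fst (hd L))) ` conf g"
    have finC: "finite (conf g)" by (simp add: conf_def finite_cycles)
    have "card Z \<le> card (conf g)" unfolding Z_def using finC by (rule card_image_le)
    then have Z: "finite Z" "card Z \<le> D" using g finC by (auto simp: Z_def G1_def)
    define I where "I = {..<N} - Z"
    define H where "H = {g i | i. i \<in> I \<and> g i \<in> U}"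
    have gX: "g i \<in> {..<r} \<rightarrow>\<^sub>E X" if "i < N" for i
      using g(1) that by (auto simp: G_def seqs_def)
    have clean: "fst (fst (hd L)) \<notin> {i \<in> I. g i \<in> U}" if "L \<in> cycles N r" "satisfies g L" for L
      using that by (auto simp: I_def Z_def conf_def)
    have I': "{i \<in> I. g i \<in> U} \<subseteq> {..<N}" by (auto simp: I_def)
    note clique = clique_in_hyperedge[OF I' clean]
    show "\<exists>H. H \<subseteq> U \<inter> ({..<r} \<rightarrow>\<^sub>E X) \<and> sparse_hitting r (2 * \<epsilon> * card X) X H"
      unfolding sparse_hitting_def
    proof (intro exI[of _ H] conjI allI impI ballI)
      show "H \<subseteq> U \<inter> ({..<r} \<rightarrow>\<^sub>E X)" using gX by (auto simp: H_def I_def)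
      show "inj_on u {..<r}" if "u \<in> H" for u
        using that clique(1) by (auto simp: H_def)
    next
      fix K a b
      assume K: "a \<in> K \<and> b \<in> K \<and> a \<noteq> b \<and>
        (\<forall>x\<in>K. \<forall>y\<in>K. x \<noteq> y \<longrightarrow> (\<exists>u\<in>H. x \<in> u ` {..<r} \<and> y \<in> u ` {..<r}))"
      then have ab: "a \<in> K" "b \<in> K" "a \<noteq> b" by simp_all
      have "\<exists>i\<in>{i \<in> I. g i \<in> U}. K \<subseteq> g i ` {..<r}"
      proof (rule clique(2)[OF _ _ ab])
        fix x y assume "x \<in> K" "y \<in> K" "x \<noteq> y"
        then obtain u where "u \<in> H" "x \<in> u ` {..<r}" "y \<in> u ` {..<r}" using K by blast
        then show "\<exists>i\<in>{i \<in> I. g i \<in> U}. x \<in> g i ` {..<r} \<and> y \<in> g i ` {..<r}"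
          unfolding H_def by blast
      qed
      then show "\<exists>u\<in>H. K \<subseteq> u ` {..<r}" unfolding H_def by blast
    next
      fix S assume S: "S \<subseteq> X \<and> 2 * \<epsilon> * card X \<le> card S"
      define V where "V = (\<Union>i\<in>Z. g i ` {..<r})"
      have finV: "finite V" using Z by (simp add: V_def)
      have "card V \<le> (\<Sum>i\<in>Z. card (g i ` {..<r}))"
        unfolding V_def using Z by (intro card_UN_le) auto
      also have "\<dots> \<le> (\<Sum>i\<in>Z. r)"
        by (intro sum_mono) (metis card_image_le card_lessThan finite_lessThan)
      finally have "real (card V) \<le> card Z * real r"
        by (metis of_nat_le_iff of_nat_mult sum_constant of_nat_id)
      also have "\<dots> \<le> D * r" using Z by (intro mult_right_mono) auto
      finally have V: "real (card V) \<le> \<epsilon> * card X" using Dr by linarith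
      have "card S \<le> card (S - V) + card V"
        using diff_card_le_card_Diff[OF finV, of S] by linarith
      then have "S - V \<in> \<S>" using S V by (auto simp: \<S>_def)
      then have "g \<notin> miss (S - V)" using g(3) by (auto simp: G2_def)
      then obtain i where i: "i < N" "g i \<in> U" "g i \<in> {..<r} \<rightarrow>\<^sub>E (S - V)"
        using g(1) by (auto simp: miss_def)
      \<comment> \<open>A tuple inside \<open>S - V\<close> has an entry outside \<open>V\<close>,
        hence is not among the deleted ones.\<close>
      have "g i 0 \<in> S - V" using i(3) r by auto
      then have "i \<notin> Z" using r by (auto simp: V_def)
      then have "g i \<in> H" using i by (auto simp: H_def I_def)
      moreover have "g i ` {..<r} \<subseteq> S" using i(3) by auto
      ultimately show "\<exists>u\<in>H. u ` {..<r} \<subseteq> S" by blast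
    qed
  qed
qed

section \<open>The two-part graph\<close>

definition is_clique :: "'a sgraph \<Rightarrow> 'a set \<Rightarrow> bool" where
  "is_clique G K \<longleftrightarrow> finite K \<and> K \<subseteq> verts G \<and> (\<forall>u\<in>K. \<forall>v\<in>K. u \<noteq> v \<longrightarrow> {u, v} \<in> edges G)"

definition clique_free :: "'a sgraph \<Rightarrow> nat \<Rightarrow> 'a set \<Rightarrow> bool" where
  "clique_free G t S \<longleftrightarrow> (\<forall>K. K \<subseteq> S \<and> is_clique G K \<longrightarrow> card K \<noteq> t)"

lemma contains_copy_complete_graph:
  "contains_copy G (complete_graph t) \<longleftrightarrow> (\<exists>K. is_clique G K \<and> card K = t)"
proof
  assume "contains_copy G (complete_graph t)"
  then obtain f where f: "inj_on f {..<t}" "f ` {..<t} \<subseteq> verts G"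
    and e: "\<And>e. e \<subseteq> {..<t} \<Longrightarrow> card e = 2 \<Longrightarrow> f ` e \<in> edges G"
    by (auto simp: contains_copy_def complete_graph_def)
  have "{f i, f j} \<in> edges G" if "i < t" "j < t" "f i \<noteq> f j" for i j
    using e[of "{i, j}"] that by (auto simp: card_2_iff)
  then have "is_clique G (f ` {..<t})" using f(2) by (auto simp: is_clique_def)
  moreover have "card (f ` {..<t}) = t" using f(1) by (simp add: card_image)
  ultimately show "\<exists>K. is_clique G K \<and> card K = t" by blast
next
  assume "\<exists>K. is_clique G K \<and> card K = t"
  then obtain K where K: "is_clique G K" "card K = t" by blast
  then obtain f where f: "bij_betw f {..<t} K"
    using ex_bij_betw_nat_finite[of K] by (auto simp: is_clique_def atLeast0LessThan)
  have "f ` e \<in> edges G" if "e \<subseteq> {..<t}" "card e = 2" for e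
  proof -
    obtain i j where ij: "e = {i, j}" "i \<noteq> j" using \<open>card e = 2\<close> by (meson card_2_iff)
    then have "i < t" "j < t" using that(1) by auto
    then have "f i \<in> K" "f j \<in> K" "f i \<noteq> f j"
      using f ij(2) by (auto simp: bij_betw_def inj_on_def)
    then show ?thesis using K(1) by (simp add: is_clique_def ij(1))
  qed
  then show "contains_copy G (complete_graph t)"
    using f K(1) unfolding contains_copy_def complete_graph_def
    by (intro exI[of _ f]) (auto simp: bij_betw_def is_clique_def)
qed

lemma free_of_complete_graph: "free_of (complete_graph t) G \<longleftrightarrow> clique_free G t (verts G)"
proof -
  have "K \<subseteq> verts G" if "is_clique G K" for K
    using that by (simp add: is_clique_def)
  then show ?thesis
    unfolding free_of_def contains_copy_complete_graph clique_free_def by metis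
qed

lemma free_of_induced:
  assumes "S \<subseteq> verts G"
  shows "free_of (complete_graph t) (induced G S) \<longleftrightarrow> clique_free G t S"
proof -
  have "is_clique (induced G S) K \<longleftrightarrow> K \<subseteq> S \<and> is_clique G K" for K
    using assms by (auto simp: is_clique_def induced_def)
  then show ?thesis
    unfolding free_of_def contains_copy_complete_graph clique_free_def by blast
qed

lemma alpha_le_iff:
  assumes G: "simple_graph G" and r: "0 < r"
  shows "real (alpha r G) \<le> x \<longleftrightarrow> (\<forall>S. S \<subseteq> verts G \<and> clique_free G r S \<longrightarrow> real (card S) \<le> x)"
proof -
  define A where "A = {card S | S. S \<subseteq> verts G \<and> clique_free G r S}"
  have fin: "finite (verts G)" using G by (simp add: simple_graph_def)
  have eq: "alpha r G = Max A"
    unfolding alpha_def A_def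
    by (intro arg_cong[of _ _ Max] Collect_cong ex_cong1 conj_cong refl free_of_induced)
  have "A \<subseteq> {..card (verts G)}" using fin by (auto simp: A_def card_mono)
  then have finA: "finite A" by (rule finite_subset) simp
  \<comment> \<open>The maximum is meaningful because the empty set qualifies; for this
    \<open>r\<close> must be positive.\<close>
  have "clique_free G r {}" using r by (auto simp: clique_free_def)
  then have ne: "A \<noteq> {}" by (auto simp: A_def)
  show ?thesis
  proof
    assume x: "real (alpha r G) \<le> x"
    show "\<forall>S. S \<subseteq> verts G \<and> clique_free G r S \<longrightarrow> real (card S) \<le> x"
    proof (intro allI impI)
      fix S assume "S \<subseteq> verts G \<and> clique_free G r S"
      then have "card S \<le> Max A" using finA by (intro Max_ge) (auto simp: A_def)
      then show "real (card S) \<le> x" using x eq by linarith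
    qed
  next
    assume "\<forall>S. S \<subseteq> verts G \<and> clique_free G r S \<longrightarrow> real (card S) \<le> x"
    then show "real (alpha r G) \<le> x"
      using Max_in[OF finA ne] unfolding eq by (auto simp: A_def)
  qed
qed

definition feasible :: "nat \<Rightarrow> nat \<Rightarrow> real \<Rightarrow> 'a sgraph \<Rightarrow> bool" where
  "feasible r t x G \<longleftrightarrow> simple_graph G \<and> clique_free G t (verts G) \<and>
     (\<forall>S. S \<subseteq> verts G \<and> clique_free G r S \<longrightarrow> real (card S) \<le> x)"

section \<open>Two copies of a vertex set joined by a cross relation\<close>

definition hyperedge_adj :: "nat \<Rightarrow> (nat \<Rightarrow> 'a) set \<Rightarrow> 'a \<Rightarrow> 'a \<Rightarrow> bool" where
  "hyperedge_adj r H x y \<longleftrightarrow> x \<noteq> y \<and> (\<exists>u\<in>H. x \<in> u ` {..<r} \<and> y \<in> u ` {..<r})"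

definition two_copies :: "'a set \<Rightarrow> ('a \<Rightarrow> 'a \<Rightarrow> bool) \<Rightarrow> ('a \<Rightarrow> 'a \<Rightarrow> bool) \<Rightarrow> (bool \<times> 'a) sgraph" where
  "two_copies X R C = (UNIV \<times> X,
     {{(c, x), (c, y)} | c x y. x \<in> X \<and> y \<in> X \<and> R x y} \<union>
     {{(False, x), (True, y)} | x y. x \<in> X \<and> y \<in> X \<and> C x y})"

lemma two_copies_edge_same:
  assumes "\<And>x y. R x y \<Longrightarrow> R y x"
  shows "{(c, x), (c, y)} \<in> edges (two_copies X R C) \<longleftrightarrow> x \<in> X \<and> y \<in> X \<and> R x y"
proof
  assume "{(c, x), (c, y)} \<in> edges (two_copies X R C)"
  then obtain c' x' y' where "{(c, x), (c, y)} = {(c', x'), (c', y')}" "x' \<in> X" "y' \<in> X" "R x' y'"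
    by (auto simp: two_copies_def doubleton_eq_iff)
  then show "x \<in> X \<and> y \<in> X \<and> R x y" using assms[of x' y'] by (auto simp: doubleton_eq_iff)
qed (auto simp: two_copies_def)

lemma two_copies_edge_cross:
  "{(False, x), (True, y)} \<in> edges (two_copies X R C) \<longleftrightarrow> x \<in> X \<and> y \<in> X \<and> C x y"
proof -
  have "{(False, x), (True, y)} \<noteq> {(c, x'), (c, y')}" for c x' y'
    by (cases c) (simp_all add: doubleton_eq_iff)
  then show ?thesis
    by (simp add: two_copies_def) (simp add: doubleton_eq_iff)
qed

lemma simple_two_copies:
  assumes "finite X" "\<And>x. \<not> R x x"
  shows "simple_graph (two_copies X R C)"
proof -
  have "x \<noteq> y" if "R x y" for x y using that assms(2) by auto
  then show ?thesis
    using assms by (auto simp: simple_graph_def two_copies_def card_insert_if)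
qed

lemma card_edges_two_copies:
  assumes "finite X"
  shows "card {(x, y) \<in> X \<times> X. C x y} \<le> card (edges (two_copies X R C))"
proof (rule card_inj_on_le)
  show "inj_on (\<lambda>(x, y). {(False, x), (True, y)}) {(x, y) \<in> X \<times> X. C x y}"
    by (auto simp: inj_on_def doubleton_eq_iff)
  show "(\<lambda>(x, y). {(False, x), (True, y)}) ` {(x, y) \<in> X \<times> X. C x y} \<subseteq> edges (two_copies X R C)"
    by (auto simp: two_copies_def)
  have "edges (two_copies X R C) \<subseteq> Pow (UNIV \<times> X)" by (auto simp: two_copies_def)
  then show "finite (edges (two_copies X R C))"
    by (rule finite_subset) (use assms in simp)
qed

lemma card_bool_split:
  assumes "finite S"
  shows "card S = card {x. (False, x) \<in> S} + card {x. (True, x) \<in> S}"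
proof -
  have S: "S = Pair False ` {x. (False, x) \<in> S} \<union> Pair True ` {x. (True, x) \<in> S}"
    by (auto simp: image_iff) (metis (full_types))
  have "finite {x. (c, x) \<in> S}" for c
    by (rule finite_subset[OF _ finite_imageI[OF assms, of snd]]) force
  then have "card (Pair False ` {x. (False, x) \<in> S} \<union> Pair True ` {x. (True, x) \<in> S})
      = card (Pair False ` {x. (False, x) \<in> S}) + card (Pair True ` {x. (True, x) \<in> S})"
    by (intro card_Un_disjoint) auto
  also have "\<dots> = card {x. (False, x) \<in> S} + card {x. (True, x) \<in> S}"
    by (simp add: card_image inj_on_def)
  finally show ?thesis using S by simp
qed

text \<open>Everything is read off the traces on the two copies. A clique has traces
  \<open>K\<close> and \<open>L\<close> that are completely related by \<open>C\<close>; and in a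
  \<open>K_r\<close>-free set each trace has fewer than \<open>x\<close> elements, since the
  \<open>r\<close> distinct points of a hyperedge form a clique.\<close>

lemma feasible_two_copies:
  fixes X :: "'a set" and H :: "(nat \<Rightarrow> 'a) set" and x :: real
  assumes X: "finite X" and H: "H \<subseteq> {..<r} \<rightarrow>\<^sub>E X" "\<And>u. u \<in> H \<Longrightarrow> inj_on u {..<r}"
    and clique: "\<And>K L. K \<subseteq> X \<Longrightarrow> L \<subseteq> X \<Longrightarrow>
      (\<And>x y. x \<in> K \<Longrightarrow> y \<in> K \<Longrightarrow> x \<noteq> y \<Longrightarrow> hyperedge_adj r H x y) \<Longrightarrow>
      (\<And>x y. x \<in> L \<Longrightarrow> y \<in> L \<Longrightarrow> x \<noteq> y \<Longrightarrow> hyperedge_adj r H x y) \<Longrightarrow>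
      (\<And>x y. x \<in> K \<Longrightarrow> y \<in> L \<Longrightarrow> C x y) \<Longrightarrow> card K + card L < t"
    and dense: "\<And>S. S \<subseteq> X \<Longrightarrow> x \<le> card S \<Longrightarrow> \<exists>u\<in>H. u ` {..<r} \<subseteq> S"
  shows "feasible r t (2 * x) (two_copies X (hyperedge_adj r H) C)"
proof -
  let ?R = "hyperedge_adj r H" and ?G = "two_copies X (hyperedge_adj r H) C"
  have sym: "?R x y \<Longrightarrow> ?R y x" for x y by (auto simp: hyperedge_adj_def)
  have same: "{(c, x), (c, y)} \<in> edges ?G \<longleftrightarrow> x \<in> X \<and> y \<in> X \<and> ?R x y" for c x y
    by (rule two_copies_edge_same) (rule sym)
  have V: "verts ?G = UNIV \<times> X" by (simp add: two_copies_def)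
  have "clique_free ?G t (verts ?G)"
    unfolding clique_free_def
  proof (intro allI impI)
    fix K assume "K \<subseteq> verts ?G \<and> is_clique ?G K"
    then have K: "finite K" "K \<subseteq> UNIV \<times> X"
      and e: "\<And>u v. u \<in> K \<Longrightarrow> v \<in> K \<Longrightarrow> u \<noteq> v \<Longrightarrow> {u, v} \<in> edges ?G"
      by (auto simp: is_clique_def V)
    have adj: "?R x y" if "(c, x) \<in> K" "(c, y) \<in> K" "x \<noteq> y" for c x y
      using e[OF that(1,2)] that(3) same[of c x y] by simp
    have "C x y" if "(False, x) \<in> K" "(True, y) \<in> K" for x y
      using e[OF that] by (simp add: two_copies_edge_cross)
    then have "card {x. (False, x) \<in> K} + card {x. (True, x) \<in> K} < t"
      using K(2) by (intro clique) (auto intro: adj)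
    then show "card K \<noteq> t" using card_bool_split[OF K(1)] by simp
  qed
  moreover have "real (card S) \<le> 2 * x" if S: "S \<subseteq> verts ?G" "clique_free ?G r S" for S
  proof -
    have "finite S" using S(1) X unfolding V by (rule finite_subset[OF _ finite_cartesian_product[OF finite]])
    have "card {x. (c, x) \<in> S} < x" for c
    proof (rule ccontr)
      assume "\<not> ?thesis"
      then obtain u where u: "u \<in> H" "u ` {..<r} \<subseteq> {x. (c, x) \<in> S}"
        using dense[of "{x. (c, x) \<in> S}"] S(1) V by auto
      let ?K = "Pair c ` u ` {..<r}"
      have uX: "u ` {..<r} \<subseteq> X" using u(1) H(1) by auto
      have "{(c, x), (c, y)} \<in> edges ?G" if "x \<in> u ` {..<r}" "y \<in> u ` {..<r}" "x \<noteq> y" for x y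
        using that u(1) uX unfolding same hyperedge_adj_def by blast
      then have "is_clique ?G ?K" using uX by (auto simp: is_clique_def V)
      moreover have "?K \<subseteq> S" using u(2) by auto
      moreover have "card ?K = r" using H(2)[OF u(1)] by (simp add: card_image inj_on_def)
      ultimately show False using S(2) by (auto simp: clique_free_def)
    qed
    then have "card {x. (False, x) \<in> S} < x" "card {x. (True, x) \<in> S} < x" by blast+
    then show ?thesis using card_bool_split[OF \<open>finite S\<close>] by simp
  qed
  moreover have "simple_graph ?G"
    using X by (intro simple_two_copies) (auto simp: hyperedge_adj_def)
  ultimately show ?thesis by (simp add: feasible_def)
qed

text \<open>A list of \<open>l\<close> related pairs unzips into two lists related in every
  coordinate; the factor \<open>M ^ 2\<close> is the free choice of the two blow-up labels.\<close>

lemma card_cross_pairs: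
  fixes \<Omega> :: "'a set" and l M :: nat
  assumes \<Omega>: "finite \<Omega>"
  defines "V \<equiv> {xs. set xs \<subseteq> \<Omega> \<and> length xs = l}"
  shows "M ^ 2 * card {(x, y) \<in> \<Omega> \<times> \<Omega>. Q x y} ^ l
    \<le> card {(x, y) \<in> (V \<times> {..<M}) \<times> (V \<times> {..<M}). \<forall>i<l. Q (fst x ! i) (fst y ! i)}"
proof -
  define Z where "Z = {(x, y) \<in> \<Omega> \<times> \<Omega>. Q x y}"
  have finZ: "finite Z" using \<Omega> by (auto simp: Z_def intro: finite_subset[of _ "\<Omega> \<times> \<Omega>"])
  define Zs where "Zs = {zs. set zs \<subseteq> Z \<and> length zs = l}"
  let ?D = "Zs \<times> {..<M} \<times> {..<M}"
  let ?f = "\<lambda>(zs, m, m'). ((map fst zs, m :: nat), (map snd zs, m' :: nat))"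
  have "card ?D = M ^ 2 * card Z ^ l"
    using card_lists_length_eq[OF finZ, of l] by (simp add: Zs_def card_cartesian_product power2_eq_square)
  moreover have "card ?D \<le> card {(x, y) \<in> (V \<times> {..<M}) \<times> (V \<times> {..<M}). \<forall>i<l. Q (fst x ! i) (fst y ! i)}"
  proof (rule card_inj_on_le[of ?f])
    show "inj_on ?f ?D"
      by (auto simp: inj_on_def) (metis zip_map_fst_snd)
    show "?f ` ?D \<subseteq> {(x, y) \<in> (V \<times> {..<M}) \<times> (V \<times> {..<M}). \<forall>i<l. Q (fst x ! i) (fst y ! i)}"
    proof (rule image_subsetI)
      fix z assume "z \<in> ?D"
      then obtain zs m m' where z: "z = (zs, m, m')" "set zs \<subseteq> Z" "length zs = l" "m < M" "m' < M"
        by (auto simp: Zs_def)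
      have "zs ! i \<in> Z" if "i < l" for i using z that by (metis nth_mem subsetD)
      then have "Q (fst (zs ! i)) (snd (zs ! i))" if "i < l" for i
        using that by (fastforce simp: Z_def)
      moreover have "set (map fst zs) \<subseteq> \<Omega>" "set (map snd zs) \<subseteq> \<Omega>" using z(2) by (auto simp: Z_def)
      ultimately show "?f z \<in> {(x, y) \<in> (V \<times> {..<M}) \<times> (V \<times> {..<M}). \<forall>i<l. Q (fst x ! i) (fst y ! i)}"
        using z by (simp add: V_def)
    qed
    have "finite V" unfolding V_def by (rule finite_lists_length_eq[OF \<Omega>])
    then have "finite ((V \<times> {..<M}) \<times> (V \<times> {..<M}))" by simp
    then show "finite {(x, y) \<in> (V \<times> {..<M}) \<times> (V \<times> {..<M}). \<forall>i<l. Q (fst x ! i) (fst y ! i)}"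
      by (rule finite_subset[rotated]) blast
  qed
  ultimately show ?thesis by (simp add: Z_def)
qed

text \<open>The position of an entry in the tuple is its leaf in the tree. The second components are
  labels of the blow-up, on which no condition is placed.\<close>

definition admissible :: "nat \<Rightarrow> nat \<Rightarrow> ('a \<Rightarrow> 'a \<Rightarrow> bool) \<Rightarrow> (nat \<Rightarrow> 'a list \<times> nat) set" where
  "admissible l r N = {u. \<forall>a<r. \<forall>b<r. \<forall>i<l. branch i a b \<longrightarrow> N (fst (u a) ! i) (fst (u b) ! i)}"

text \<open>One tree already yields a positive proportion of tuples: it is built among the points of
  \<open>V\<close> whose fibres in \<open>S\<close> have at least \<open>\<epsilon> / 2 * M\<close>
  labels, and every choice of labels gives an admissible tuple. The proportion obtained does not
  depend on \<open>M\<close>, which is the purpose of the blow-up: \<open>X\<close> can be enlarged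
  while \<open>\<Omega>\<close> stays fixed.\<close>

lemma admissible_dense:
  fixes \<Omega> :: "'a set" and \<epsilon> :: real and r l M :: nat
  assumes \<Omega>: "finite \<Omega>" "\<Omega> \<noteq> {}" and \<epsilon>: "0 < \<epsilon>" and M: "0 < M"
    and dens: "\<And>A B. A \<subseteq> \<Omega> \<Longrightarrow> B \<subseteq> \<Omega> \<Longrightarrow> \<epsilon> / 2 / 2 ^ l * card \<Omega> \<le> card A \<Longrightarrow>
      \<epsilon> / 2 / 2 ^ l * card \<Omega> \<le> card B \<Longrightarrow> \<exists>a\<in>A. \<exists>b\<in>B. N a b"
    and sym: "\<And>x y. N x y \<Longrightarrow> N y x"
  defines "V \<equiv> {xs. set xs \<subseteq> \<Omega> \<and> length xs = l}"
  assumes S: "S \<subseteq> V \<times> {..<M}" "\<epsilon> * card (V \<times> {..<M}) \<le> card S"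
  shows "(\<epsilon> / 2 / card V) ^ r * card (V \<times> {..<M}) ^ r \<le> card (admissible l r N \<inter> ({..<r} \<rightarrow>\<^sub>E S))"
proof -
  have finV: "finite V" unfolding V_def by (rule finite_lists_length_eq[OF \<Omega>(1)])
  have cV: "card V = card \<Omega> ^ l" unfolding V_def by (rule card_lists_length_eq[OF \<Omega>(1)])
  have "0 < card \<Omega>" using \<Omega> by (simp add: card_gt_0_iff)
  then have V0: "0 < card V" by (simp add: cV)
  define F where "F v = {m. (v, m) \<in> S}" for v
  have F: "F v \<subseteq> {..<M}" for v using S(1) by (auto simp: F_def)
  then have finF: "finite (F v)" for v by (rule finite_subset) simp
  have cF: "card (F v) \<le> M" for v using card_mono[OF _ F[of v]] by simp
  define W where "W = {v \<in> V. \<epsilon> / 2 * M \<le> card (F v)}"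
  have "S = (SIGMA v:V. F v)" using S(1) by (auto simp: F_def)
  then have "card S = card (SIGMA v:V. F v)" by (rule arg_cong)
  also have "\<dots> = (\<Sum>v\<in>V. card (F v))"
    using finV finF by (intro card_SigmaI) auto
  finally have "card S = (\<Sum>v\<in>V. card (F v))" .
  then have "real (card S) = (\<Sum>v\<in>V. real (card (F v)))" by simp
  also have "\<dots> = (\<Sum>v\<in>W. real (card (F v))) + (\<Sum>v\<in>V - W. real (card (F v)))"
    using finV by (subst sum.subset_diff[of W V]) (auto simp: W_def)
  also have "\<dots> \<le> (\<Sum>v\<in>W. real M) + (\<Sum>v\<in>V - W. \<epsilon> / 2 * M)"
    using cF by (intro add_mono sum_mono) (auto simp: W_def)
  also have "\<dots> \<le> (\<Sum>v\<in>W. real M) + (\<Sum>v\<in>V. \<epsilon> / 2 * M)"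
    using finV \<epsilon> by (intro add_left_mono sum_mono2) auto
  also have "\<dots> = (card W + \<epsilon> / 2 * card V) * M" by (simp add: algebra_simps)
  finally have "(\<epsilon> * card V) * M \<le> (card W + \<epsilon> / 2 * card V) * M"
    using S(2) by (simp add: card_cartesian_product mult.assoc)
  then have "\<epsilon> * card V \<le> card W + \<epsilon> / 2 * card V"
    using M by (simp only: mult_le_cancel_right)
  then have cW: "\<epsilon> / 2 / 2 ^ l * 2 ^ l * card \<Omega> ^ l \<le> card W"
    by (simp add: cV)
  have "\<exists>v. range v \<subseteq> W \<and> (\<forall>i<l. \<forall>a b. branch i a b \<longrightarrow> N (v a ! i) (v b ! i))"
  proof (rule dense_tree[OF \<Omega> _ dens sym])
    show "0 < \<epsilon> / 2 / 2 ^ l" using \<epsilon> by simp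
    show "W \<subseteq> {xs. set xs \<subseteq> \<Omega> \<and> length xs = l}" by (auto simp: W_def V_def)
    show "\<epsilon> / 2 / 2 ^ l * 2 ^ l * card \<Omega> ^ l \<le> card W" by (rule cW)
  qed
  then obtain v where v: "range v \<subseteq> W" "\<And>i a b. i < l \<Longrightarrow> branch i a b \<Longrightarrow> N (v a ! i) (v b ! i)"
    by blast
  define B where "B = (\<Pi>\<^sub>E p\<in>{..<r}. Pair (v p) ` F (v p))"
  have B: "B \<subseteq> admissible l r N \<inter> ({..<r} \<rightarrow>\<^sub>E S)"
  proof
    fix u assume u: "u \<in> B"
    have up: "u p \<in> Pair (v p) ` F (v p)" if "p < r" for p
      using u that by (auto simp: B_def PiE_iff)
    then have "fst (u p) = v p" if "p < r" for p using that by fastforce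
    then have "u \<in> admissible l r N" using v(2) by (simp add: admissible_def)
    moreover have "u p \<in> S" if "p < r" for p using up[OF that] by (auto simp: F_def)
    then have "u \<in> {..<r} \<rightarrow>\<^sub>E S" using u by (auto simp: B_def PiE_iff)
    ultimately show "u \<in> admissible l r N \<inter> ({..<r} \<rightarrow>\<^sub>E S)" by blast
  qed
  have finS: "finite S" using S(1) finV by (meson finite_SigmaI finite_lessThan finite_subset)
  have "(\<epsilon> / 2 / card V) ^ r * card (V \<times> {..<M}) ^ r = (\<epsilon> / 2 * M) ^ r"
    using V0 by (simp add: card_cartesian_product power_mult_distrib[symmetric])
  also have "\<dots> = (\<Prod>p<r. \<epsilon> / 2 * M)" by simp
  also have "\<dots> \<le> (\<Prod>p<r. real (card (F (v p))))"
    using v(1) \<epsilon> by (intro prod_mono) (auto simp: W_def)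
  also have "\<dots> = card B"
    by (simp add: B_def card_PiE card_image inj_on_def)
  also have "real (card B) \<le> card (admissible l r N \<inter> ({..<r} \<rightarrow>\<^sub>E S))"
    using B finS by (intro of_nat_mono card_mono) (auto intro!: finite_PiE)
  finally show ?thesis .
qed

text \<open>A clique with two vertices lies in a single hyperedge, and its positions there form the
  template. A smaller one may lie in no hyperedge; any template of the same size serves, because no
  index branches from itself.\<close>

lemma template_of_clique:
  fixes H :: "(nat \<Rightarrow> 'a list \<times> nat) set"
  assumes r: "0 < r" and H: "H \<subseteq> admissible l r N" "\<And>u. u \<in> H \<Longrightarrow> inj_on u {..<r}"
    and cover: "\<And>a b. a \<in> K \<Longrightarrow> b \<in> K \<Longrightarrow> a \<noteq> b \<Longrightarrow> \<exists>u\<in>H. K \<subseteq> u ` {..<r}"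
  shows "\<exists>A. A \<subseteq> {..<r} \<and> card A = card K \<and>
    (\<forall>a\<in>A. \<forall>a'\<in>A. \<forall>i<l. branch i a a' \<longrightarrow> (\<exists>x\<in>K. \<exists>x'\<in>K. N (fst x ! i) (fst x' ! i)))"
proof (cases "\<exists>a\<in>K. \<exists>b\<in>K. a \<noteq> b")
  case True
  then obtain u where u: "u \<in> H" "K \<subseteq> u ` {..<r}" using cover by blast
  define A where "A = {p. p < r \<and> u p \<in> K}"
  have "u ` A = K" using u(2) by (auto simp: A_def)
  moreover have "inj_on u A" using H(2)[OF u(1)] by (rule inj_on_subset) (auto simp: A_def)
  ultimately have "card A = card K" by (metis card_image)
  moreover have "N (fst (u a) ! i) (fst (u a') ! i)" if "a \<in> A" "a' \<in> A" "i < l" "branch i a a'" for a a' i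
    using H(1) u(1) that by (auto simp: admissible_def A_def)
  moreover have "u a \<in> K" if "a \<in> A" for a using that by (simp add: A_def)
  moreover have "A \<subseteq> {..<r}" by (auto simp: A_def)
  ultimately show ?thesis by blast
next
  case False
  have no: "\<not> branch i a a" for i a by (simp add: branch_def)
  show ?thesis
  proof (cases "K = {}")
    case True
    then show ?thesis by (intro exI[of _ "{}"]) auto
  next
    case ne: False
    then obtain a where "K = {a}" using False by blast
    then show ?thesis using r no by (intro exI[of _ "{0}"]) auto
  qed
qed

text \<open>Bernoulli's inequality for \<open>(1 - 2 * \<delta>) ^ l\<close>; the bound
  \<open>\<delta> \<le> 1 / 2\<close> keeps the base nonnegative.\<close>

lemma power_half_minus_ge:
  fixes \<eta> :: real
  assumes "0 < \<eta>" "0 < l"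
  obtains \<delta> where "0 < \<delta>" "\<delta> \<le> 1 / 2" "1 / 2 ^ l - 2 * \<eta> \<le> (1 / 2 - \<delta>) ^ l"
proof -
  define \<delta> where "\<delta> = min (1 / 2) (\<eta> / l)"
  have \<delta>: "0 < \<delta>" using assms by (simp add: \<delta>_def)
  have \<delta>2: "\<delta> \<le> 1 / 2" "\<delta> \<le> \<eta> / l"
    unfolding \<delta>_def by (rule min.cobounded1, rule min.cobounded2)
  then have "\<delta> * l \<le> \<eta>" using assms by (simp add: pos_le_divide_eq)
  have "1 / 2 ^ l - 2 * \<eta> \<le> (1 - 2 * (\<delta> * l)) / 2 ^ l"
  proof -
    have "2 * (\<delta> * l) / 2 ^ l \<le> 2 * (\<delta> * l) / 1"
      using \<delta> by (intro divide_left_mono) auto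
    then show ?thesis using \<open>\<delta> * l \<le> \<eta>\<close> by (simp add: diff_divide_distrib)
  qed
  also have "\<dots> \<le> (1 + - (2 * \<delta>)) ^ l / 2 ^ l"
    using Bernoulli_inequality[of "- (2 * \<delta>)" l] \<delta>2 by (intro divide_right_mono) (auto simp: algebra_simps)
  also have "\<dots> = (1 / 2 - \<delta>) ^ l"
    by (simp add: power_divide[symmetric] diff_divide_distrib)
  finally show ?thesis using \<delta> \<delta>2 that by blast
qed

text \<open>The parameters are chosen in a forced order: \<open>\<delta>\<close> and
  \<open>\<epsilon>\<close> determine \<open>\<Omega>\<close>, hence \<open>V\<close> and the
  proportion \<open>\<beta>\<close>; only then are the least size \<open>n0\<close> and the blow-up
  factor \<open>M\<close> available.\<close>

lemma dense_feasible_graph: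
  fixes r s l :: nat and e \<eta> :: real
  assumes s: "2 \<le> s" and l: "0 < l" "2 ^ (l - 1) < r" "r \<le> (s - 1) * 2 ^ l"
    and e: "0 < e" and \<eta>: "0 < \<eta>"
  shows "\<exists>G :: (bool \<times> ((nat \<times> nat) set list \<times> nat)) sgraph. verts G \<noteq> {} \<and>
    feasible r (r + s) (e * card (verts G)) G \<and>
    (1 / 2 ^ (l + 2) - \<eta>) * (card (verts G))\<^sup>2 \<le> card (edges G)"
proof -
  have r: "0 < r" using l(2) by (metis gr0I less_nat_zero_code)
  obtain \<delta> where \<delta>: "0 < \<delta>" "\<delta> \<le> 1 / 2" "1 / 2 ^ l - 2 * \<eta> \<le> (1 / 2 - \<delta>) ^ l"
    using power_half_minus_ge[OF \<eta> l(1)] by blast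
  \<comment> \<open>The hypergraph hits sets of size \<open>2 * \<epsilon> * card X\<close>, and two
    copies double the bound on clique-free sets; \<open>4 * \<epsilon> * card X\<close> equals
    \<open>e\<close> times the \<open>2 * card X\<close> vertices.\<close>
  define \<epsilon> where "\<epsilon> = e / 2"
  have \<epsilon>: "0 < \<epsilon>" using e by (simp add: \<epsilon>_def)
  then have \<epsilon>': "0 < \<epsilon> / 2 / 2 ^ l" by simp
  show ?thesis
  proof (rule bollobas_erdos_relations[OF \<epsilon>' \<delta>(1)])
    fix \<Omega> :: "(nat \<times> nat) set set" and N Q
    assume \<Omega>: "finite \<Omega>" "\<Omega> \<noteq> {}"
      and dens: "\<And>A B. A \<subseteq> \<Omega> \<Longrightarrow> B \<subseteq> \<Omega> \<Longrightarrow> \<epsilon> / 2 / 2 ^ l * card \<Omega> \<le> card A \<Longrightarrow>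
        \<epsilon> / 2 / 2 ^ l * card \<Omega> \<le> card B \<Longrightarrow> \<exists>a\<in>A. \<exists>b\<in>B. N a b"
      and sym: "\<And>x y. N x y \<Longrightarrow> N y x"
      and Q: "(1 / 2 - \<delta>) * (card \<Omega>)\<^sup>2 \<le> card {(x, y) \<in> \<Omega> \<times> \<Omega>. Q x y}"
      and NQ: "\<And>x x' y y'. N x x' \<Longrightarrow> N y y' \<Longrightarrow> Q x y \<Longrightarrow> Q x y' \<Longrightarrow> Q x' y \<Longrightarrow> Q x' y' \<Longrightarrow> False"
    define V where "V = {xs. set xs \<subseteq> \<Omega> \<and> length xs = l}"
    have finV: "finite V" unfolding V_def by (rule finite_lists_length_eq[OF \<Omega>(1)])
    have cV: "card V = card \<Omega> ^ l" unfolding V_def by (rule card_lists_length_eq[OF \<Omega>(1)])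
    have "0 < card \<Omega>" using \<Omega> by (simp add: card_gt_0_iff)
    then have V0: "0 < card V" by (simp add: cV)
    define \<beta> where "\<beta> = (\<epsilon> / 2 / card V) ^ r"
    have \<beta>: "0 < \<beta>" using \<epsilon> V0 by (simp add: \<beta>_def)
    show ?thesis
    proof (rule sparse_hypergraph[OF r \<epsilon> \<beta>])
      fix n0 :: nat
      assume n0: "\<And>(X :: ((nat \<times> nat) set list \<times> nat) set) U. finite X \<Longrightarrow> n0 \<le> card X \<Longrightarrow>
        (\<And>S. S \<subseteq> X \<Longrightarrow> \<epsilon> * card X \<le> card S \<Longrightarrow> \<beta> * card X ^ r \<le> card (U \<inter> ({..<r} \<rightarrow>\<^sub>E S))) \<Longrightarrow>
        \<exists>H. H \<subseteq> U \<inter> ({..<r} \<rightarrow>\<^sub>E X) \<and> sparse_hitting r (2 * \<epsilon> * card X) X H"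
      define M where "M = max 1 n0"
      have M: "0 < M" by (simp add: M_def)
      define X where "X = V \<times> {..<M}"
      have finX: "finite X" using finV by (simp add: X_def)
      have cX: "card X = card V * M" by (simp add: X_def card_cartesian_product)
      have "n0 \<le> 1 * M" by (simp add: M_def)
      also have "\<dots> \<le> card X" unfolding cX using V0 by (intro mult_le_mono1) simp
      finally have "n0 \<le> card X" .
      have "\<exists>H. H \<subseteq> admissible l r N \<inter> ({..<r} \<rightarrow>\<^sub>E X) \<and> sparse_hitting r (2 * \<epsilon> * card X) X H"
      proof (rule n0[OF finX \<open>n0 \<le> card X\<close>])
        fix S assume "S \<subseteq> X" "\<epsilon> * card X \<le> card S"
        then show "\<beta> * card X ^ r \<le> card (admissible l r N \<inter> ({..<r} \<rightarrow>\<^sub>E S))"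
          unfolding \<beta>_def X_def V_def by (intro admissible_dense[OF \<Omega> \<epsilon> M dens sym])
      qed
      then obtain H where H: "H \<subseteq> admissible l r N \<inter> ({..<r} \<rightarrow>\<^sub>E X)"
        and sparse: "sparse_hitting r (2 * \<epsilon> * card X) X H" by blast
      have H_inj: "inj_on u {..<r}" if "u \<in> H" for u
        using sparse that unfolding sparse_hitting_def by blast
      have H_clique: "\<exists>u\<in>H. K \<subseteq> u ` {..<r}" if "a \<in> K" "b \<in> K" "a \<noteq> b"
        "\<And>x y. x \<in> K \<Longrightarrow> y \<in> K \<Longrightarrow> x \<noteq> y \<Longrightarrow> hyperedge_adj r H x y" for K a b
      proof -
        have "\<forall>x\<in>K. \<forall>y\<in>K. x \<noteq> y \<longrightarrow> (\<exists>u\<in>H. x \<in> u ` {..<r} \<and> y \<in> u ` {..<r})"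
          using that(4) unfolding hyperedge_adj_def by blast
        with sparse that(1-3) show ?thesis unfolding sparse_hitting_def by blast
      qed
      have H_dense: "\<exists>u\<in>H. u ` {..<r} \<subseteq> S" if "S \<subseteq> X" "2 * \<epsilon> * card X \<le> card S" for S
        using sparse that unfolding sparse_hitting_def by blast
      define C where "C x y \<longleftrightarrow> (\<forall>i<l. Q (fst x ! i) (fst y ! i))" for x y :: "(nat \<times> nat) set list \<times> nat"
      define G where "G = two_copies X (hyperedge_adj r H) C"
      have "feasible r (r + s) (2 * (2 * \<epsilon> * card X)) G"
        unfolding G_def
      proof (rule feasible_two_copies[OF finX _ H_inj])
        show "H \<subseteq> {..<r} \<rightarrow>\<^sub>E X" using H by blast
        show "\<exists>u\<in>H. u ` {..<r} \<subseteq> S" if "S \<subseteq> X" "2 * \<epsilon> * card X \<le> card S" for S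
          using H_dense that by blast
      next
        fix K L assume K: "\<And>x y. x \<in> K \<Longrightarrow> y \<in> K \<Longrightarrow> x \<noteq> y \<Longrightarrow> hyperedge_adj r H x y"
          and L: "\<And>x y. x \<in> L \<Longrightarrow> y \<in> L \<Longrightarrow> x \<noteq> y \<Longrightarrow> hyperedge_adj r H x y"
          and KL: "\<And>x y. x \<in> K \<Longrightarrow> y \<in> L \<Longrightarrow> C x y"
        have template: "\<exists>A. A \<subseteq> {..<r} \<and> card A = card K' \<and>
          (\<forall>a\<in>A. \<forall>a'\<in>A. \<forall>i<l. branch i a a' \<longrightarrow> (\<exists>x\<in>K'. \<exists>x'\<in>K'. N (fst x ! i) (fst x' ! i)))"
          if "\<And>x y. x \<in> K' \<Longrightarrow> y \<in> K' \<Longrightarrow> x \<noteq> y \<Longrightarrow> hyperedge_adj r H x y" for K'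
        proof (rule template_of_clique[OF r])
          show "H \<subseteq> admissible l r N" using H by blast
          show "inj_on u {..<r}" if "u \<in> H" for u using that by (rule H_inj)
          show "\<exists>u\<in>H. K' \<subseteq> u ` {..<r}" if "a \<in> K'" "b \<in> K'" "a \<noteq> b" for a b
            using that \<open>\<And>x y. x \<in> K' \<Longrightarrow> y \<in> K' \<Longrightarrow> x \<noteq> y \<Longrightarrow> hyperedge_adj r H x y\<close>
            by (rule H_clique)
        qed
        from template[OF K] obtain A where A: "A \<subseteq> {..<r} \<and> card A = card K \<and>
          (\<forall>a\<in>A. \<forall>a'\<in>A. \<forall>i<l. branch i a a' \<longrightarrow> (\<exists>x\<in>K. \<exists>x'\<in>K. N (fst x ! i) (fst x' ! i)))" ..
        from template[OF L] obtain B where B: "B \<subseteq> {..<r} \<and> card B = card L \<and>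
          (\<forall>b\<in>B. \<forall>b'\<in>B. \<forall>i<l. branch i b b' \<longrightarrow> (\<exists>y\<in>L. \<exists>y'\<in>L. N (fst y ! i) (fst y' ! i)))" ..
        have "card A + card B \<le> r + (r - 1) div 2 ^ l + 1"
        proof (rule card_add_le_if_no_common_branch[OF conjunct1[OF A] conjunct1[OF B] l(1,2)])
          fix i a a' b b' assume i: "i < l" and ab: "a \<in> A" "a' \<in> A" "b \<in> B" "b' \<in> B"
            "branch i a a'" "branch i b b'"
          obtain x x' where x: "x \<in> K" "x' \<in> K" "N (fst x ! i) (fst x' ! i)"
            using A ab i by blast
          obtain y y' where y: "y \<in> L" "y' \<in> L" "N (fst y ! i) (fst y' ! i)"
            using B ab i by blast
          have "Q (fst z ! i) (fst w ! i)" if "z \<in> K" "w \<in> L" for z w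
            using KL[OF that] i by (simp add: C_def)
          then show False using NQ[OF x(3) y(3)] x y by blast
        qed
        \<comment> \<open>The defining inequality \<open>r \<le> (s - 1) * 2 ^ l\<close> brings the
          bound on the two templates below \<open>r + s\<close>.\<close>
        moreover have "(r - 1) div 2 ^ l < s - 1"
          using l(3) r by (intro div_less_iff_less_mult[THEN iffD2]) auto
        ultimately show "card K + card L < r + s" using A B by linarith
      qed
      moreover have cG: "card (verts G) = 2 * card X"
        by (simp add: G_def two_copies_def card_cartesian_product)
      ultimately have "feasible r (r + s) (e * card (verts G)) G"
        by (simp add: \<epsilon>_def mult_ac)
      moreover have "verts G \<noteq> {}"
        using cG cX V0 M by (metis card.empty mult_is_0 not_gr_zero zero_neq_numeral)
      moreover have "(1 / 2 ^ (l + 2) - \<eta>) * (card (verts G))\<^sup>2 \<le> card (edges G)"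
      proof -
        have "(1 / 2 ^ (l + 2) - \<eta>) * (card (verts G))\<^sup>2 = (1 / 2 ^ l - 4 * \<eta>) * (card X)\<^sup>2"
          unfolding cG by (simp add: power_mult_distrib algebra_simps)
        also have "\<dots> \<le> (1 / 2 - \<delta>) ^ l * (card X)\<^sup>2"
          using \<delta>(3) \<eta> by (intro mult_right_mono) auto
        also have "\<dots> = real (M ^ 2) * ((1 / 2 - \<delta>) * (card \<Omega>)\<^sup>2) ^ l"
          by (simp add: cX cV power_mult_distrib mult_ac flip: power_mult)
        also have "\<dots> \<le> real (M ^ 2) * real (card {(x, y) \<in> \<Omega> \<times> \<Omega>. Q x y}) ^ l"
          using Q \<delta>(2) by (intro mult_left_mono power_mono) auto
        also have "\<dots> = real (M ^ 2 * card {(x, y) \<in> \<Omega> \<times> \<Omega>. Q x y} ^ l)" by simp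
        also have "\<dots> \<le> card {(x, y) \<in> X \<times> X. C x y}"
          unfolding of_nat_le_iff X_def V_def C_def by (rule card_cross_pairs[OF \<Omega>(1)])
        also have "real (card {(x, y) \<in> X \<times> X. C x y}) \<le> card (edges G)"
          unfolding of_nat_le_iff G_def by (rule card_edges_two_copies[OF finX])
        finally show ?thesis .
      qed
      ultimately show ?thesis by blast
    qed
  qed
qed

section \<open>Blow-ups and disjoint unions\<close>

text \<open>The pullback of \<open>G\<close> along \<open>\<pi>\<close>: with a bijection it merely
  relabels \<open>G\<close> by natural numbers, with nearly equal fibres it is a balanced
  blow-up.\<close>

definition blow_up :: "(nat \<Rightarrow> 'a) \<Rightarrow> nat \<Rightarrow> 'a sgraph \<Rightarrow> nat sgraph" where
  "blow_up \<pi> n G = ({..<n}, {{u, v} | u v. u < n \<and> v < n \<and> {\<pi> u, \<pi> v} \<in> edges G})"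

lemma simple_graph_neq:
  assumes "simple_graph G" "{a, b} \<in> edges G"
  shows "a \<noteq> b"
proof -
  have "card {a, b} = 2" using assms unfolding simple_graph_def by blast
  then show ?thesis by auto
qed

lemma blow_up_edge_iff:
  "{u, v} \<in> edges (blow_up \<pi> n G) \<longleftrightarrow> u < n \<and> v < n \<and> {\<pi> u, \<pi> v} \<in> edges G"
proof
  assume "{u, v} \<in> edges (blow_up \<pi> n G)"
  then obtain u' v' where h: "{u, v} = {u', v'}" "u' < n" "v' < n" "{\<pi> u', \<pi> v'} \<in> edges G"
    by (auto simp: blow_up_def)
  then have "u = u' \<and> v = v' \<or> u = v' \<and> v = u'" by (simp add: doubleton_eq_iff)
  then show "u < n \<and> v < n \<and> {\<pi> u, \<pi> v} \<in> edges G"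
    using h by (auto simp: insert_commute)
qed (auto simp: blow_up_def)

lemma simple_blow_up:
  assumes "simple_graph G"
  shows "simple_graph (blow_up \<pi> n G)"
proof -
  have "u \<noteq> v" if "{\<pi> u, \<pi> v} \<in> edges G" for u v
    using simple_graph_neq[OF assms that] by auto
  then show ?thesis by (auto simp: simple_graph_def blow_up_def card_insert_if)
qed

text \<open>Fibres of \<open>\<pi>\<close> span no edges since \<open>G\<close> has no loops, so
  \<open>\<pi>\<close> is injective on cliques.\<close>

lemma clique_blow_up:
  assumes G: "simple_graph G" and \<pi>: "\<pi> ` {..<n} \<subseteq> verts G" and K: "is_clique (blow_up \<pi> n G) K"
  shows "is_clique G (\<pi> ` K)" "card (\<pi> ` K) = card K"
proof -
  have e: "{\<pi> u, \<pi> v} \<in> edges G" if "u \<in> K" "v \<in> K" "u \<noteq> v" for u v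
    using K that blow_up_edge_iff unfolding is_clique_def by blast
  have "K \<subseteq> {..<n}" using K by (simp add: is_clique_def blow_up_def)
  then have "\<pi> ` K \<subseteq> verts G" using \<pi> by blast
  then show "is_clique G (\<pi> ` K)" using K e by (auto simp: is_clique_def)
  have "inj_on \<pi> K"
    using simple_graph_neq[OF G e] by (meson inj_onI)
  then show "card (\<pi> ` K) = card K" by (rule card_image)
qed

text \<open>A right inverse of \<open>\<pi>\<close> lifts a clique in the image back into
  \<open>S\<close>. Hence a clique-free set of the blow-up lies in the preimage of a clique-free set
  of \<open>G\<close>, and its size is controlled by the fibres.\<close>

lemma clique_free_blow_up:
  assumes S: "S \<subseteq> {..<n}" and free: "clique_free (blow_up \<pi> n G) r S"
  shows "clique_free G r (\<pi> ` S)"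
  unfolding clique_free_def
proof (intro allI impI)
  fix K assume K: "K \<subseteq> \<pi> ` S \<and> is_clique G K"
  define \<rho> where "\<rho> = inv_into S \<pi>"
  have \<rho>: "\<rho> a \<in> S" "\<pi> (\<rho> a) = a" if "a \<in> K" for a
    using K that by (auto simp: \<rho>_def inv_into_into f_inv_into_f)
  have "{\<rho> a, \<rho> b} \<in> edges (blow_up \<pi> n G)" if "a \<in> K" "b \<in> K" "\<rho> a \<noteq> \<rho> b" for a b
  proof -
    have "{a, b} \<in> edges G" using K that by (auto simp: is_clique_def)
    then show ?thesis using that \<rho> S by (auto simp: blow_up_edge_iff)
  qed
  moreover have "finite K" using K by (simp add: is_clique_def)
  moreover have "\<rho> ` K \<subseteq> {..<n}" using \<rho>(1) S by blast
  then have "\<rho> ` K \<subseteq> verts (blow_up \<pi> n G)" by (simp add: blow_up_def)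
  ultimately have "is_clique (blow_up \<pi> n G) (\<rho> ` K)"
    unfolding is_clique_def by blast
  moreover have "\<rho> ` K \<subseteq> S" using \<rho>(1) by blast
  ultimately have "card (\<rho> ` K) \<noteq> r" using free by (simp add: clique_free_def)
  moreover have "inj_on \<rho> K" using \<rho>(2) by (rule inj_on_inverseI)
  ultimately show "card K \<noteq> r" by (simp add: card_image)
qed

lemma card_edges_blow_up:
  assumes G: "simple_graph G" and E: "E \<subseteq> edges G"
    and fib: "\<And>e a. e \<in> E \<Longrightarrow> a \<in> e \<Longrightarrow> q \<le> card {u. u < n \<and> \<pi> u = a}"
  shows "q\<^sup>2 * card E \<le> card (edges (blow_up \<pi> n G))"
proof -
  define F where "F e = {d \<in> edges (blow_up \<pi> n G). \<pi> ` d = e}" for e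
  have "edges (blow_up \<pi> n G) \<subseteq> Pow {..<n}" by (auto simp: blow_up_def)
  then have finB: "finite (edges (blow_up \<pi> n G))" by (rule finite_subset) simp
  have "edges G \<subseteq> Pow (verts G)" "finite (verts G)" using G by (auto simp: simple_graph_def)
  then have "finite (edges G)" by (meson finite_Pow_iff finite_subset)
  with E have finE: "finite E" by (rule finite_subset)
  have F: "q\<^sup>2 \<le> card (F e)" if e: "e \<in> E" for e
  proof -
    have "card e = 2" using e E G by (auto simp: simple_graph_def)
    then obtain a b where ab: "e = {a, b}" "a \<noteq> b" by (meson card_2_iff)
    let ?P = "{u. u < n \<and> \<pi> u = a} \<times> {u. u < n \<and> \<pi> u = b}"
    have "q * q \<le> card ?P"
      using fib[OF e, of a] fib[OF e, of b] ab(1) by (simp add: card_cartesian_product mult_le_mono)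
    also have "card ?P \<le> card (F e)"
    proof (rule card_inj_on_le[of "\<lambda>(u, v). {u, v}"])
      show "inj_on (\<lambda>(u, v). {u, v}) ?P"
        using ab(2) by (auto simp: inj_on_def doubleton_eq_iff)
      show "(\<lambda>(u, v). {u, v}) ` ?P \<subseteq> F e"
        using e E ab by (auto simp: F_def blow_up_edge_iff)
      show "finite (F e)" using finB by (simp add: F_def)
    qed
    finally show ?thesis by (simp add: power2_eq_square)
  qed
  have "q\<^sup>2 * card E = (\<Sum>e\<in>E. q\<^sup>2)" by simp
  also have "\<dots> \<le> (\<Sum>e\<in>E. card (F e))" by (intro sum_mono F)
  also have "\<dots> = card (\<Union>e\<in>E. F e)"
    using finE finB by (intro card_UN_disjoint[symmetric]) (auto simp: F_def)
  also have "\<dots> \<le> card (edges (blow_up \<pi> n G))"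
    using finB by (intro card_mono) (auto simp: F_def)
  finally show ?thesis .
qed

section \<open>Disjoint unions\<close>

definition disjoint_graph :: "'a sgraph \<Rightarrow> 'b sgraph \<Rightarrow> ('a + 'b) sgraph" where
  "disjoint_graph G H = (verts G <+> verts H, (`) Inl ` edges G \<union> (`) Inr ` edges H)"

lemma simple_disjoint_graph:
  assumes "simple_graph G" "simple_graph H"
  shows "simple_graph (disjoint_graph G H)"
proof -
  have "finite (verts G <+> verts H)" using assms by (simp add: simple_graph_def)
  moreover have "Inl ` e \<subseteq> verts G <+> verts H \<and> card (Inl ` e :: ('a + 'b) set) = 2" if "e \<in> edges G" for e
    using assms(1) that unfolding simple_graph_def Plus_def by (auto simp: card_image)
  moreover have "Inr ` e \<subseteq> verts G <+> verts H \<and> card (Inr ` e :: ('a + 'b) set) = 2" if "e \<in> edges H" for e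
    using assms(2) that unfolding simple_graph_def Plus_def by (auto simp: card_image)
  ultimately show ?thesis unfolding simple_graph_def disjoint_graph_def by force
qed

lemma disjoint_graph_edge:
  "{Inl a, Inl b} \<in> edges (disjoint_graph G H) \<longleftrightarrow> {a, b} \<in> edges G" (is ?l)
  "{Inr c, Inr d} \<in> edges (disjoint_graph G H) \<longleftrightarrow> {c, d} \<in> edges H" (is ?r)
  "{Inl a, Inr c} \<notin> edges (disjoint_graph G H)" (is ?m)
proof -
  have E: "edges (disjoint_graph G H) = (`) Inl ` edges G \<union> (`) Inr ` edges H"
    by (simp add: disjoint_graph_def)
  have l: "Inl ` {a, b} \<in> (`) Inl ` edges G \<longleftrightarrow> {a, b} \<in> edges G"
    by (rule inj_image_mem_iff) (simp add: inj_image_eq_iff inj_on_def)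
  have l': "Inl ` {a, b} \<noteq> Inr ` e" for e :: "'b set" by auto
  have "Inl ` {a, b} \<in> edges (disjoint_graph G H) \<longleftrightarrow> {a, b} \<in> edges G"
    unfolding E Un_iff l using l' by blast
  then show ?l by simp
  have r: "Inr ` {c, d} \<in> (`) Inr ` edges H \<longleftrightarrow> {c, d} \<in> edges H"
    by (rule inj_image_mem_iff) (simp add: inj_image_eq_iff inj_on_def)
  have r': "Inr ` {c, d} \<noteq> Inl ` e" for e :: "'a set" by auto
  have "Inr ` {c, d} \<in> edges (disjoint_graph G H) \<longleftrightarrow> {c, d} \<in> edges H"
    unfolding E Un_iff r using r' by blast
  then show ?r by simp
  show ?m
  proof
    assume "{Inl a, Inr c} \<in> edges (disjoint_graph G H)"
    then have "(\<exists>e. {Inl a, Inr c} = Inl ` e) \<or> (\<exists>e. {Inl a, Inr c} = Inr ` e)"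
      unfolding E by blast
    moreover have "Inr c \<notin> Inl ` e" for e :: "'a set" by auto
    moreover have "Inl a \<notin> Inr ` e" for e :: "'b set" by auto
    ultimately show False by (metis insertCI)
  qed
qed

lemma clique_disjoint_graph:
  assumes "is_clique (disjoint_graph G H) K"
  shows "(\<exists>L. K = Inl ` L \<and> is_clique G L) \<or> (\<exists>L. K = Inr ` L \<and> is_clique H L)"
proof -
  let ?L = "Inl -` K" and ?R = "Inr -` K"
  have K: "finite K" "K \<subseteq> verts G <+> verts H"
    and e: "\<And>u v. u \<in> K \<Longrightarrow> v \<in> K \<Longrightarrow> u \<noteq> v \<Longrightarrow> {u, v} \<in> edges (disjoint_graph G H)"
    using assms by (auto simp: is_clique_def disjoint_graph_def)
  have "is_clique G ?L"
    unfolding is_clique_def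
  proof (intro conjI ballI impI)
    show "finite ?L" using K(1) by (rule finite_vimageI) simp
    show "?L \<subseteq> verts G" using K(2) by auto
    show "{a, b} \<in> edges G" if "a \<in> ?L" "b \<in> ?L" "a \<noteq> b" for a b
      using e[of "Inl a" "Inl b"] that by (simp add: disjoint_graph_edge)
  qed
  moreover have "is_clique H ?R"
    unfolding is_clique_def
  proof (intro conjI ballI impI)
    show "finite ?R" using K(1) by (rule finite_vimageI) simp
    show "?R \<subseteq> verts H" using K(2) by auto
    show "{a, b} \<in> edges H" if "a \<in> ?R" "b \<in> ?R" "a \<noteq> b" for a b
      using e[of "Inr a" "Inr b"] that by (simp add: disjoint_graph_edge)
  qed
  moreover have "?L = {} \<or> ?R = {}"
    using e disjoint_graph_edge(3) by fastforce
  moreover have "K = Inl ` ?L \<union> Inr ` ?R"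
  proof (intro equalityI subsetI)
    fix k assume "k \<in> K"
    then show "k \<in> Inl ` ?L \<union> Inr ` ?R" by (cases k) auto
  qed auto
  ultimately show ?thesis by (metis image_empty sup_bot.left_neutral sup_bot.right_neutral)
qed

lemma clique_disjoint_graph_iff:
  "is_clique (disjoint_graph G H) (Inl ` L) \<longleftrightarrow> is_clique G L"
  "is_clique (disjoint_graph G H) (Inr ` R) \<longleftrightarrow> is_clique H R"
proof -
  have V: "verts (disjoint_graph G H) = verts G <+> verts H" by (simp add: disjoint_graph_def)
  have "finite (Inl ` L) = finite L" "finite (Inr ` R) = finite R"
    by (simp_all add: finite_image_iff)
  then show "is_clique (disjoint_graph G H) (Inl ` L) \<longleftrightarrow> is_clique G L"
    "is_clique (disjoint_graph G H) (Inr ` R) \<longleftrightarrow> is_clique H R"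
    unfolding is_clique_def V by (auto simp: disjoint_graph_edge)
qed

lemma clique_free_disjoint_graph:
  "clique_free (disjoint_graph G H) t S \<longleftrightarrow> clique_free G t (Inl -` S) \<and> clique_free H t (Inr -` S)"
proof (intro iffI conjI)
  assume free: "clique_free (disjoint_graph G H) t S"
  show "clique_free G t (Inl -` S)"
    unfolding clique_free_def
  proof (intro allI impI)
    fix L assume "L \<subseteq> Inl -` S \<and> is_clique G L"
    then have "Inl ` L \<subseteq> S" "is_clique (disjoint_graph G H) (Inl ` L)"
      by (auto simp: clique_disjoint_graph_iff)
    then have "card (Inl ` L :: ('a + 'b) set) \<noteq> t" using free by (simp add: clique_free_def)
    then show "card L \<noteq> t" by (simp add: card_image)
  qed
  show "clique_free H t (Inr -` S)"
    unfolding clique_free_def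
  proof (intro allI impI)
    fix L assume "L \<subseteq> Inr -` S \<and> is_clique H L"
    then have "Inr ` L \<subseteq> S" "is_clique (disjoint_graph G H) (Inr ` L)"
      by (auto simp: clique_disjoint_graph_iff)
    then have "card (Inr ` L :: ('a + 'b) set) \<noteq> t" using free by (simp add: clique_free_def)
    then show "card L \<noteq> t" by (simp add: card_image)
  qed
next
  assume free: "clique_free G t (Inl -` S) \<and> clique_free H t (Inr -` S)"
  show "clique_free (disjoint_graph G H) t S"
    unfolding clique_free_def
  proof (intro allI impI)
    fix K assume K: "K \<subseteq> S \<and> is_clique (disjoint_graph G H) K"
    from clique_disjoint_graph[OF conjunct2[OF this]] show "card K \<noteq> t"
    proof (elim disjE exE conjE)
      fix L assume L: "K = Inl ` L" "is_clique G L"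
      then have "L \<subseteq> Inl -` S" using K by auto
      then have "card L \<noteq> t" using free L(2) unfolding clique_free_def by blast
      then show ?thesis by (simp add: L(1) card_image)
    next
      fix L assume L: "K = Inr ` L" "is_clique H L"
      then have "L \<subseteq> Inr -` S" using K by auto
      then have "card L \<noteq> t" using free L(2) unfolding clique_free_def by blast
      then show ?thesis by (simp add: L(1) card_image)
    qed
  qed
qed

section \<open>Residue classes as balanced fibres\<close>

lemma card_residue_class_less:
  fixes n j m :: nat
  assumes "j < n"
  shows "m div n \<le> card {u. u < m \<and> u mod n = j}" "card {u. u < m \<and> u mod n = j} \<le> m div n + 1"
proof -
  have n: "0 < n" using assms by simp
  have "j + k * n < m" if "k < m div n" for k
  proof -
    have "(k + 1) * n \<le> m div n * n" using that by (intro mult_le_mono1) simp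
    also have "\<dots> \<le> m" by simp
    finally show ?thesis using assms by (simp add: algebra_simps)
  qed
  then have "(\<lambda>k. j + k * n) ` {..<m div n} \<subseteq> {u. u < m \<and> u mod n = j}"
    using assms by auto
  moreover have "inj_on (\<lambda>k. j + k * n) {..<m div n}" using n by (auto simp: inj_on_def)
  ultimately have "card {..<m div n} \<le> card {u. u < m \<and> u mod n = j}"
    by (intro card_inj_on_le) auto
  then show "m div n \<le> card {u. u < m \<and> u mod n = j}" by simp
  have "inj_on (\<lambda>u. u div n) {u. u < m \<and> u mod n = j}"
  proof (rule inj_onI)
    fix x y assume "x \<in> {u. u < m \<and> u mod n = j}" "y \<in> {u. u < m \<and> u mod n = j}" "x div n = y div n"
    then show "x = y" using div_mult_mod_eq[of x n] div_mult_mod_eq[of y n] by simp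
  qed
  moreover have "(\<lambda>u. u div n) ` {u. u < m \<and> u mod n = j} \<subseteq> {..m div n}"
    by (auto intro: div_le_mono)
  ultimately have "card {u. u < m \<and> u mod n = j} \<le> card {..m div n}"
    by (intro card_inj_on_le) auto
  then show "card {u. u < m \<and> u mod n = j} \<le> m div n + 1" by simp
qed

lemma card_le_fibres:
  assumes "finite S" "finite T" "\<pi> ` S \<subseteq> T" "\<And>a. a \<in> T \<Longrightarrow> card {u \<in> S. \<pi> u = a} \<le> q"
  shows "card S \<le> q * card T"
proof -
  have "card S = (\<Sum>a\<in>\<pi> ` S. card {u \<in> S. \<pi> u = a})"
    using sum.image_gen[OF assms(1), of "\<lambda>_. 1 :: nat" \<pi>] by simp
  also have "\<dots> \<le> (\<Sum>a\<in>\<pi> ` S. q)" using assms(3,4) by (intro sum_mono) auto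
  also have "\<dots> = card (\<pi> ` S) * q" by simp
  also have "\<dots> \<le> card T * q" using assms by (intro mult_le_mono1 card_mono)
  finally show ?thesis by (simp add: mult.commute)
qed

section \<open>Existence of the limits\<close>

lemma card_edges_le:
  assumes "simple_graph G"
  shows "card (edges G) \<le> (card (verts G))\<^sup>2"
proof -
  have V: "finite (verts G)" using assms by (simp add: simple_graph_def)
  have "edges G \<subseteq> (\<lambda>(a, b). {a, b}) ` (verts G \<times> verts G)"
  proof
    fix e assume "e \<in> edges G"
    then have "card e = 2" "e \<subseteq> verts G" using assms by (auto simp: simple_graph_def)
    then obtain a b where "e = {a, b}" "a \<in> verts G" "b \<in> verts G" by (auto simp: card_2_iff)
    then show "e \<in> (\<lambda>(a, b). {a, b}) ` (verts G \<times> verts G)" by auto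
  qed
  then have "card (edges G) \<le> card (verts G \<times> verts G)"
    using V by (intro surj_card_le) auto
  then show ?thesis by (simp add: card_cartesian_product power2_eq_square)
qed

section \<open>The extremal number as a maximum\<close>

definition RT_set :: "nat \<Rightarrow> nat \<Rightarrow> nat \<Rightarrow> real \<Rightarrow> nat set" where
  "RT_set r n t x = {card (edges G) | G :: nat sgraph. feasible r t x G \<and> card (verts G) = n}"

lemma RT_eq_Sup:
  assumes "0 < r"
  shows "RT r n (complete_graph t) x = Sup (RT_set r n t x)"
proof -
  have "simple_graph G \<and> card (verts G) = n \<and> free_of (complete_graph t) G \<and> real (alpha r G) \<le> x
    \<longleftrightarrow> feasible r t x G \<and> card (verts G) = n" for G :: "nat sgraph"
    using alpha_le_iff[OF _ assms, of G x] by (auto simp: feasible_def free_of_complete_graph)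
  then show ?thesis by (simp only: RT_def RT_set_def)
qed

lemma RT_set_bounded: "RT_set r n t x \<subseteq> {..n\<^sup>2}"
proof
  fix k assume "k \<in> RT_set r n t x"
  then obtain G :: "nat sgraph" where "k = card (edges G)" "simple_graph G" "card (verts G) = n"
    unfolding RT_set_def feasible_def by blast
  then show "k \<in> {..n\<^sup>2}" using card_edges_le[of G] by simp
qed

lemma RT_ge:
  fixes G :: "nat sgraph"
  assumes "0 < r" "feasible r t x G" "card (verts G) = n"
  shows "card (edges G) \<le> RT r n (complete_graph t) x"
  unfolding RT_eq_Sup[OF assms(1)]
proof (rule cSup_upper)
  show "card (edges G) \<in> RT_set r n t x" using assms(2,3) unfolding RT_set_def by blast
  show "bdd_above (RT_set r n t x)" using RT_set_bounded by (rule bdd_above_mono[rotated]) simp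
qed

text \<open>A positive value excludes the empty set, whose supremum is 0 by convention; a finite
  nonempty set attains its supremum.\<close>

lemma RT_attained:
  assumes "0 < r" "0 < RT r n (complete_graph t) x"
  obtains G :: "nat sgraph" where "feasible r t x G" "card (verts G) = n"
    "card (edges G) = RT r n (complete_graph t) x"
proof -
  have fin: "finite (RT_set r n t x)" using RT_set_bounded by (rule finite_subset) simp
  have "RT_set r n t x \<noteq> {}"
  proof
    assume "RT_set r n t x = {}"
    then have "RT r n (complete_graph t) x = 0" by (simp add: RT_eq_Sup[OF assms(1)])
    then show False using assms(2) by simp
  qed
  then have "RT r n (complete_graph t) x \<in> RT_set r n t x"
    unfolding RT_eq_Sup[OF assms(1)] using fin by (simp add: cSup_eq_Max)
  then show ?thesis using that by (auto simp: RT_set_def)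
qed

lemma RT_le:
  assumes "0 < r"
  shows "RT r n (complete_graph t) x \<le> n\<^sup>2"
proof (cases "RT r n (complete_graph t) x = 0")
  case False
  then obtain G :: "nat sgraph" where "feasible r t x G" "card (verts G) = n"
    "card (edges G) = RT r n (complete_graph t) x"
    using RT_attained[OF assms] by blast
  then show ?thesis using card_edges_le[of G] by (simp add: feasible_def)
qed simp

lemma RT_mono:
  assumes "0 < r" "x \<le> y"
  shows "RT r n (complete_graph t) x \<le> RT r n (complete_graph t) y"
proof (cases "RT r n (complete_graph t) x = 0")
  case False
  then obtain G :: "nat sgraph" where G: "feasible r t x G" "card (verts G) = n"
    "card (edges G) = RT r n (complete_graph t) x"
    using RT_attained[OF assms(1)] by blast
  have "feasible r t y G" using G(1) assms(2) unfolding feasible_def by (meson order_trans)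
  then show ?thesis using RT_ge[OF assms(1) _ G(2)] G(3) by metis
qed simp

lemma feasible_relabel:
  fixes G :: "'a sgraph"
  assumes G: "feasible r t x G" and n: "card (verts G) = n"
  shows "\<exists>G' :: nat sgraph. feasible r t x G' \<and> card (verts G') = n \<and> card (edges G) \<le> card (edges G')"
proof -
  have simple: "simple_graph G" using G by (simp add: feasible_def)
  then have "finite (verts G)" by (simp add: simple_graph_def)
  then obtain \<pi> where \<pi>: "bij_betw \<pi> {..<n} (verts G)"
    using ex_bij_betw_nat_finite[of "verts G"] n by (auto simp: atLeast0LessThan)
  then have img: "\<pi> ` {..<n} = verts G" and inj: "inj_on \<pi> {..<n}" by (auto simp: bij_betw_def)
  let ?B = "blow_up \<pi> n G"
  have V: "verts ?B = {..<n}" by (simp add: blow_up_def)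
  have "clique_free ?B t (verts ?B)"
    unfolding clique_free_def
  proof (intro allI impI)
    fix K assume "K \<subseteq> verts ?B \<and> is_clique ?B K"
    then have "is_clique G (\<pi> ` K)" "card (\<pi> ` K) = card K"
      using clique_blow_up[OF simple] img by (metis order_refl)+
    then show "card K \<noteq> t"
      using G by (metis feasible_def clique_free_def is_clique_def)
  qed
  moreover have "real (card S) \<le> x" if S: "S \<subseteq> verts ?B" "clique_free ?B r S" for S
  proof -
    have "clique_free G r (\<pi> ` S)" using S V by (intro clique_free_blow_up) auto
    moreover have "\<pi> ` S \<subseteq> verts G" using S(1) V img by blast
    ultimately have "real (card (\<pi> ` S)) \<le> x" using G by (simp add: feasible_def)
    moreover have "card (\<pi> ` S) = card S"
      using S(1) V inj by (metis card_image inj_on_subset)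
    ultimately show ?thesis by simp
  qed
  ultimately have "feasible r t x ?B"
    using simple by (simp add: feasible_def simple_blow_up)
  moreover have "1\<^sup>2 * card (edges G) \<le> card (edges ?B)"
  proof (rule card_edges_blow_up[OF simple order_refl])
    fix e a assume "e \<in> edges G" "a \<in> e"
    then have "a \<in> verts G" using simple by (auto simp: simple_graph_def)
    then obtain u where "u < n" "\<pi> u = a" unfolding img[symmetric] by auto
    then have "{u. u < n \<and> \<pi> u = a} \<noteq> {}" by auto
    then have "0 < card {u. u < n \<and> \<pi> u = a}" by (simp add: card_gt_0_iff)
    then show "1 \<le> card {u. u < n \<and> \<pi> u = a}" by linarith
  qed
  ultimately show ?thesis using V by (intro exI[of _ ?B]) simp
qed

text \<open>The copies of \<open>H\<close> fill only a bounded number of vertices. Their smaller clique-free sets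
  compensate for the rounding in the blow-up of \<open>G\<close>.\<close>

lemma feasible_extension:
  fixes G :: "'a sgraph" and H :: "'b sgraph" and \<epsilon> :: real
  assumes G: "feasible r t (\<epsilon> * n) G" "card (verts G) = n" "0 < n"
    and H: "feasible r t (\<epsilon> / 2 * h) H" "card (verts H) = h" "0 < h"
    and \<epsilon>: "0 < \<epsilon>" and N: "m \<le> N" and m: "m = 2 * (n + h)"
  shows "\<exists>G' :: nat sgraph. feasible r t (\<epsilon> * N) G' \<and> card (verts G') = N \<and>
    ((N - m) div n)\<^sup>2 * card (edges G) \<le> card (edges G')"
proof -
  have simple: "simple_graph G" "simple_graph H" using G(1) H(1) by (simp_all add: feasible_def)
  then have fin: "finite (verts G)" "finite (verts H)" by (simp_all add: simple_graph_def)
  obtain f where "bij_betw f {..<n} (verts G)"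
    using ex_bij_betw_nat_finite[OF fin(1)] G(2) by (auto simp: atLeast0LessThan)
  then have f: "f ` {..<n} = verts G" "inj_on f {..<n}" by (auto simp: bij_betw_def)
  obtain g where "bij_betw g {..<h} (verts H)"
    using ex_bij_betw_nat_finite[OF fin(2)] H(2) by (auto simp: atLeast0LessThan)
  then have g: "g ` {..<h} = verts H" "inj_on g {..<h}" by (auto simp: bij_betw_def)
  \<comment> \<open>The first \<open>m\<close> vertices are spread over \<open>H\<close> and all
    others over \<open>G\<close>, in each case by residue classes so that fibres differ in size by
    at most one.\<close>
  define \<pi> where "\<pi> u = (if u < m then Inr (g (u mod h)) else Inl (f ((u - m) mod n)))" for u
  let ?D = "disjoint_graph G H"
  let ?B = "blow_up \<pi> N ?D"
  have V: "verts ?B = {..<N}" by (simp add: blow_up_def)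
  have D: "simple_graph ?D" using simple by (rule simple_disjoint_graph)
  have VD: "verts ?D = verts G <+> verts H" by (simp add: disjoint_graph_def)
  have fm: "f (u mod n) \<in> verts G" for u using f(1) G(3) by auto
  have gm: "g (u mod h) \<in> verts H" for u using g(1) H(3) by auto
  have img: "\<pi> ` {..<N} \<subseteq> verts ?D" unfolding VD \<pi>_def using fm gm by auto
  have "clique_free G t (verts G)" "clique_free H t (verts H)"
    using G(1) H(1) by (simp_all add: feasible_def)
  moreover have "Inl -` (verts G <+> verts H) = verts G" "Inr -` (verts G <+> verts H) = verts H"
    by auto
  ultimately have Dt: "clique_free ?D t (verts ?D)" by (simp add: clique_free_disjoint_graph VD)
  have "clique_free ?B t (verts ?B)"
    unfolding clique_free_def
  proof (intro allI impI)
    fix K assume "K \<subseteq> verts ?B \<and> is_clique ?B K"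
    then have K: "is_clique ?D (\<pi> ` K)" "card (\<pi> ` K) = card K"
      using clique_blow_up[OF D img] by simp_all
    then have "\<pi> ` K \<subseteq> verts ?D" by (simp add: is_clique_def)
    then show "card K \<noteq> t" using K Dt unfolding clique_free_def by metis
  qed
  moreover have "real (card S) \<le> \<epsilon> * N" if S: "S \<subseteq> verts ?B" "clique_free ?B r S" for S
  proof -
    have SN: "S \<subseteq> {..<N}" using S(1) V by simp
    have finS: "finite S" using SN by (rule finite_subset) simp
    define T1 where "T1 = {a. Inl a \<in> \<pi> ` S}"
    define T2 where "T2 = {b. Inr b \<in> \<pi> ` S}"
    have "clique_free ?D r (\<pi> ` S)" using SN S(2) by (rule clique_free_blow_up)
    then have "clique_free G r T1" "clique_free H r T2"
      by (simp_all add: clique_free_disjoint_graph T1_def T2_def vimage_def)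
    moreover have "\<pi> ` S \<subseteq> verts G <+> verts H" using img SN VD by blast
    then have sub: "T1 \<subseteq> verts G" "T2 \<subseteq> verts H" by (auto simp: T1_def T2_def)
    ultimately have T: "card T1 \<le> \<epsilon> * n" "card T2 \<le> \<epsilon> / 2 * h"
      using G(1) H(1) by (simp_all add: feasible_def)
    have finT: "finite T1" "finite T2" using sub fin by (auto dest: finite_subset)
    define S1 where "S1 = {u \<in> S. m \<le> u}"
    define S2 where "S2 = {u \<in> S. u < m}"
    have "card S1 \<le> ((N - m) div n + 1) * card T1"
    proof (rule card_le_fibres[where \<pi> = "\<lambda>u. f ((u - m) mod n)"])
      show "(\<lambda>u. f ((u - m) mod n)) ` S1 \<subseteq> T1"
      proof (rule image_subsetI)
        fix u assume u: "u \<in> S1"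
        then have "\<pi> u = Inl (f ((u - m) mod n))" by (simp add: \<pi>_def S1_def)
        moreover have "u \<in> S" using u by (simp add: S1_def)
        ultimately show "f ((u - m) mod n) \<in> T1" unfolding T1_def by (metis imageI mem_Collect_eq)
      qed
      fix a assume "a \<in> T1"
      then obtain j where j: "j < n" "a = f j" using sub(1) f(1) by auto
      have "card {u \<in> S1. f ((u - m) mod n) = a} \<le> card {v. v < N - m \<and> v mod n = j}"
      proof (rule card_inj_on_le[of "\<lambda>u. u - m"])
        show "inj_on (\<lambda>u. u - m) {u \<in> S1. f ((u - m) mod n) = a}"
        proof (rule inj_onI)
          fix x y assume "x \<in> {u \<in> S1. f ((u - m) mod n) = a}" "y \<in> {u \<in> S1. f ((u - m) mod n) = a}"
            "x - m = y - m"
          moreover from this have "m \<le> x" "m \<le> y" by (simp_all add: S1_def)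
          ultimately show "x = y" by linarith
        qed
        show "(\<lambda>u. u - m) ` {u \<in> S1. f ((u - m) mod n) = a} \<subseteq> {v. v < N - m \<and> v mod n = j}"
        proof (rule image_subsetI)
          fix u assume u: "u \<in> {u \<in> S1. f ((u - m) mod n) = a}"
          then have "u \<in> S" "m \<le> u" "f ((u - m) mod n) = f j" using j by (simp_all add: S1_def)
          moreover from this have "u < N" using SN by blast
          moreover have "(u - m) mod n = j"
            using inj_onD[OF f(2) \<open>f ((u - m) mod n) = f j\<close>] j G(3) by simp
          ultimately show "u - m \<in> {v. v < N - m \<and> v mod n = j}" by simp
        qed
      qed simp
      also have "\<dots> \<le> (N - m) div n + 1" using j(1) by (rule card_residue_class_less)
      finally show "card {u \<in> S1. f ((u - m) mod n) = a} \<le> (N - m) div n + 1" .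
    qed (use finS finT in \<open>auto simp: S1_def\<close>)
    then have "real (card S1) \<le> real ((N - m) div n + 1) * card T1"
      unfolding of_nat_mult[symmetric] of_nat_le_iff .
    also have "\<dots> \<le> (real (N - m) / n + 1) * (\<epsilon> * n)"
      using T(1) \<epsilon> of_nat_div_le_of_nat[of "N - m" n] by (intro mult_mono) auto
    also have "\<dots> = \<epsilon> * real (N - m) + \<epsilon> * n" using G(3) by (simp add: field_simps)
    finally have S1: "real (card S1) \<le> \<epsilon> * real (N - m) + \<epsilon> * n" .
    have "card S2 \<le> (m div h + 1) * card T2"
    proof (rule card_le_fibres[where \<pi> = "\<lambda>u. g (u mod h)"])
      show "(\<lambda>u. g (u mod h)) ` S2 \<subseteq> T2"
      proof (rule image_subsetI)
        fix u assume u: "u \<in> S2"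
        then have "\<pi> u = Inr (g (u mod h))" by (simp add: \<pi>_def S2_def)
        moreover have "u \<in> S" using u by (simp add: S2_def)
        ultimately show "g (u mod h) \<in> T2" unfolding T2_def by (metis imageI mem_Collect_eq)
      qed
      fix a assume "a \<in> T2"
      then obtain j where j: "j < h" "a = g j" using sub(2) g(1) by auto
      have "card {u \<in> S2. g (u mod h) = a} \<le> card {v. v < m \<and> v mod h = j}"
      proof (rule card_mono)
        show "{u \<in> S2. g (u mod h) = a} \<subseteq> {v. v < m \<and> v mod h = j}"
        proof
          fix u assume u: "u \<in> {u \<in> S2. g (u mod h) = a}"
          then have "u < m" "g (u mod h) = g j" using j by (auto simp: S2_def)
          moreover have "u mod h = j"
            using inj_onD[OF g(2) \<open>g (u mod h) = g j\<close>] j H(3) by simp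
          ultimately show "u \<in> {v. v < m \<and> v mod h = j}" by simp
        qed
      qed simp
      also have "\<dots> \<le> m div h + 1" using j(1) by (rule card_residue_class_less)
      finally show "card {u \<in> S2. g (u mod h) = a} \<le> m div h + 1" .
    qed (use finS finT in \<open>auto simp: S2_def\<close>)
    then have "real (card S2) \<le> real (m div h + 1) * card T2"
      unfolding of_nat_mult[symmetric] of_nat_le_iff .
    also have "\<dots> \<le> (real m / h + 1) * (\<epsilon> / 2 * h)"
      using T(2) \<epsilon> of_nat_div_le_of_nat[of m h] by (intro mult_mono) auto
    also have "\<dots> = \<epsilon> / 2 * m + \<epsilon> / 2 * h" using H(3) by (simp add: field_simps)
    finally have S2: "real (card S2) \<le> \<epsilon> / 2 * m + \<epsilon> / 2 * h" .
    have "S = S1 \<union> S2" by (auto simp: S1_def S2_def)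
    then have "card S \<le> card S1 + card S2" by (metis card_Un_le)
    then have "real (card S) \<le> \<epsilon> * real (N - m) + \<epsilon> * n + (\<epsilon> / 2 * m + \<epsilon> / 2 * h)"
      using S1 S2 by linarith
    \<comment> \<open>Rounding costs \<open>\<epsilon> * n + \<epsilon> / 2 * h\<close>, whereas
      using \<open>\<epsilon> / 2\<close> on \<open>m\<close> vertices saves
      \<open>\<epsilon> / 2 * m = \<epsilon> * (n + h)\<close>. This is the origin of
      \<open>m = 2 * (n + h)\<close>.\<close>
    also have "\<dots> = \<epsilon> * N - \<epsilon> / 2 * h"
      using N by (simp add: of_nat_diff m algebra_simps)
    also have "\<dots> \<le> \<epsilon> * N" using \<epsilon> by simp
    finally show ?thesis .
  qed
  ultimately have "feasible r t (\<epsilon> * N) ?B"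
    using D by (simp add: feasible_def simple_blow_up)
  \<comment> \<open>Only edges from the part of \<open>G\<close> are counted; their number is
    quadratic in \<open>N\<close>.\<close>
  moreover define E where "E = ((`) Inl ` edges G :: ('a + 'b) set set)"
  have "((N - m) div n)\<^sup>2 * card E \<le> card (edges ?B)"
  proof (rule card_edges_blow_up[OF D])
    show "E \<subseteq> edges ?D" by (simp add: disjoint_graph_def E_def)
    fix e a assume "e \<in> E" "a \<in> e"
    then have "e \<in> (`) Inl ` edges G" "a \<in> e" by (simp_all add: E_def)
    then obtain b where b: "a = Inl b" "b \<in> verts G" using simple(1) by (auto simp: simple_graph_def)
    then obtain j where j: "j < n" "b = f j" using f(1) by auto
    have "(N - m) div n \<le> card {v. v < N - m \<and> v mod n = j}"
      using j(1) by (rule card_residue_class_less)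
    also have "\<dots> \<le> card {u. u < N \<and> \<pi> u = a}"
    proof (rule card_inj_on_le[of "\<lambda>v. v + m"])
      show "(\<lambda>v. v + m) ` {v. v < N - m \<and> v mod n = j} \<subseteq> {u. u < N \<and> \<pi> u = a}"
        by (auto simp: \<pi>_def b(1) j(2))
    qed auto
    finally show "(N - m) div n \<le> card {u. u < N \<and> \<pi> u = a}" .
  qed
  moreover have "card E = card (edges G)"
    unfolding E_def by (rule card_image) (simp add: inj_on_def inj_image_eq_iff)
  ultimately show ?thesis using V by (intro exI[of _ ?B]) simp
qed

section \<open>Edge densities and their limits\<close>

definition density :: "nat \<Rightarrow> nat \<Rightarrow> real \<Rightarrow> nat \<Rightarrow> real" where
  "density r t \<epsilon> n = real (RT r n (complete_graph t) (\<epsilon> * real n)) / (real n)\<^sup>2"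

lemma density_le_1: "0 < r \<Longrightarrow> density r t \<epsilon> n \<le> 1"
proof -
  assume r: "0 < r"
  have "real (RT r n (complete_graph t) (\<epsilon> * real n)) \<le> (real n)\<^sup>2"
    using RT_le[OF r] by (metis of_nat_le_iff of_nat_power)
  then show ?thesis by (cases "n = 0") (simp_all add: density_def divide_le_eq_1)
qed

text \<open>An optimal graph on \<open>n\<close> vertices is blown up to \<open>N\<close> vertices.
  The extra part has bounded size, so for large \<open>N\<close> the loss of density tends to
  0.\<close>

lemma density_almost_increasing:
  fixes H :: "'b sgraph"
  assumes r: "0 < r" and \<epsilon>: "0 < \<epsilon>" and n: "0 < n" and \<eta>: "0 < \<eta>"
    and H: "feasible r t (\<epsilon> / 2 * card (verts H)) H" "verts H \<noteq> {}"
  shows "eventually (\<lambda>N. density r t \<epsilon> n - \<eta> \<le> density r t \<epsilon> N) sequentially"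
proof (cases "RT r n (complete_graph t) (\<epsilon> * real n) = 0")
  \<comment> \<open>The value 0 can mean that no graph qualifies, so there may be nothing to blow
    up.\<close>
  case True
  then have "density r t \<epsilon> n = 0" by (simp add: density_def)
  moreover have "0 \<le> density r t \<epsilon> N" for N by (simp add: density_def)
  ultimately have "density r t \<epsilon> n - \<eta> \<le> density r t \<epsilon> N" for N
    using \<eta> by (smt (verit))
  then show ?thesis by simp
next
  case False
  then obtain G :: "nat sgraph" where G: "feasible r t (\<epsilon> * real n) G" "card (verts G) = n"
    "card (edges G) = RT r n (complete_graph t) (\<epsilon> * real n)"
    using RT_attained[OF r] by blast
  define h where "h = card (verts H)"
  have "finite (verts H)" using H(1) by (simp add: feasible_def simple_graph_def)
  then have h: "0 < h" using H(2) by (simp add: h_def card_gt_0_iff)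
  define m where "m = 2 * (n + h)"
  define c where "c = density r t \<epsilon> n"
  have c: "c = card (edges G) / (real n)\<^sup>2" by (simp add: c_def density_def G(3))
  have "((\<lambda>N. (1 - real (m + n) / real N)\<^sup>2 * c) \<longlongrightarrow> (1 - 0)\<^sup>2 * c) sequentially"
    by (intro tendsto_intros lim_const_over_n)
  then have "eventually (\<lambda>N. c - \<eta> < (1 - real (m + n) / real N)\<^sup>2 * c) sequentially"
    using \<eta> by (intro order_tendstoD) auto
  moreover have "eventually (\<lambda>N. m + n < N) sequentially" by (rule eventually_gt_at_top)
  ultimately show ?thesis
  proof eventually_elim
    case (elim N)
    then have N: "m \<le> N" "0 < N" by auto
    obtain G' :: "nat sgraph" where G': "feasible r t (\<epsilon> * N) G'" "card (verts G') = N"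
      "((N - m) div n)\<^sup>2 * card (edges G) \<le> card (edges G')"
      using feasible_extension[OF G(1,2) n H(1)[folded h_def] h_def[symmetric] h \<epsilon> N(1) m_def] by blast
    \<comment> \<open>The integer quotient loses less than one, that is, fewer than \<open>n\<close>
      vertices beyond the \<open>m\<close> reserved ones.\<close>
    have "(real N - real (m + n)) / n = real (N - m) / n - 1"
      using N(1) n by (simp add: of_nat_diff field_simps)
    also have "\<dots> \<le> real ((N - m) div n)"
    proof -
      have "N - m \<le> ((N - m) div n + 1) * n"
        using dividend_less_div_times[OF n, of "N - m"] by simp
      then have "real (N - m) \<le> (real ((N - m) div n) + 1) * n"
        by (simp only: of_nat_le_iff[symmetric, where 'a = real] of_nat_mult of_nat_add of_nat_1)
      then show ?thesis using n by (simp add: pos_divide_le_eq algebra_simps)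
    qed
    finally have "((real N - real (m + n)) / n)\<^sup>2 \<le> (real ((N - m) div n))\<^sup>2"
      using elim(2) by (intro power_mono divide_nonneg_nonneg) auto
    then have "((real N - real (m + n)) / n)\<^sup>2 * card (edges G) \<le> (real ((N - m) div n))\<^sup>2 * card (edges G)"
      by (rule mult_right_mono) simp
    also have "\<dots> = real (((N - m) div n)\<^sup>2 * card (edges G))" by simp
    also have "\<dots> \<le> RT r N (complete_graph t) (\<epsilon> * real N)"
      unfolding of_nat_le_iff using G'(3) RT_ge[OF r G'(1,2)] by linarith
    finally have "((real N - real (m + n)) / n)\<^sup>2 * card (edges G) / (real N)\<^sup>2 \<le> density r t \<epsilon> N"
      unfolding density_def by (intro divide_right_mono) auto
    moreover have "(1 - real (m + n) / real N)\<^sup>2 * c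
        = ((real N - real (m + n)) / n)\<^sup>2 * card (edges G) / (real N)\<^sup>2"
    proof -
      have "1 - real (m + n) / real N = (real N - real (m + n)) / real N"
        using N(2) by (simp add: diff_divide_distrib)
      then show ?thesis by (simp add: c power_divide mult_ac)
    qed
    ultimately show ?case using elim(1) by (simp add: c_def)
  qed
qed

text \<open>Every value is asymptotically a lower bound up to an arbitrarily small error, so the
  lower limit reaches the supremum. The index 0 is left out because a graph without vertices cannot
  be blown up.\<close>

lemma tendsto_SUP_if_almost_increasing:
  fixes f :: "nat \<Rightarrow> real"
  assumes bdd: "\<And>n. f n \<le> b"
    and incr: "\<And>n \<eta>. 0 < n \<Longrightarrow> 0 < \<eta> \<Longrightarrow> eventually (\<lambda>N. f n - \<eta> \<le> f N) sequentially"
  shows "f \<longlonglongrightarrow> (SUP n\<in>{0<..}. f n)"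
proof (rule order_tendstoI)
  have bdd': "bdd_above (f ` {0<..})" using bdd by (rule bdd_aboveI2)
  fix a assume "a < (SUP n\<in>{0<..}. f n)"
  then obtain n where n: "0 < n" "a < f n" using less_cSUP_iff[OF _ bdd'] by force
  have "eventually (\<lambda>N. f n - (f n - a) / 2 \<le> f N) sequentially"
    using n by (intro incr) auto
  then show "eventually (\<lambda>N. a < f N) sequentially"
  proof eventually_elim
    case (elim N)
    have "a < f n - (f n - a) / 2" using n(2) by (simp add: field_simps)
    then show ?case using elim by linarith
  qed
next
  fix a assume a: "(SUP n\<in>{0<..}. f n) < a"
  have bdd': "bdd_above (f ` {0<..})" using bdd by (rule bdd_aboveI2)
  have "eventually (\<lambda>N. 0 < N) sequentially" by (rule eventually_gt_at_top)
  then show "eventually (\<lambda>N. f N < a) sequentially"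
  proof eventually_elim
    case (elim N)
    then have "f N \<le> (SUP n\<in>{0<..}. f n)" by (intro cSUP_upper bdd') auto
    then show ?case using a by linarith
  qed
qed

text \<open>The hypothesis serves twice: with \<open>\<epsilon> / 2\<close> it supplies the extra
  vertices needed for the inner limit to exist, and with \<open>\<epsilon>\<close> it bounds that
  limit, a supremum over all orders, from below.\<close>

lemma theta_lower_bound:
  fixes c :: real and r t :: nat
  assumes r: "0 < r"
    and dense: "\<And>(e :: real) (\<eta> :: real). 0 < e \<Longrightarrow> 0 < \<eta> \<Longrightarrow> \<exists>G :: 'a sgraph. verts G \<noteq> {} \<and>
      feasible r t (e * card (verts G)) G \<and> (c - \<eta>) * (card (verts G))\<^sup>2 \<le> card (edges G)"
  shows "c \<le> theta r (complete_graph t)"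
proof -
  define g where "g \<epsilon> = lim (density r t \<epsilon>)" for \<epsilon>
  define L where "L \<epsilon> = (SUP n\<in>{0<..}. density r t \<epsilon> n)" for \<epsilon>
  have lim: "density r t \<epsilon> \<longlonglongrightarrow> L \<epsilon>" if \<epsilon>: "0 < \<epsilon>" for \<epsilon>
    unfolding L_def
  proof (rule tendsto_SUP_if_almost_increasing)
    show "density r t \<epsilon> n \<le> 1" for n using r by (rule density_le_1)
    fix n :: nat and \<eta> :: real assume n: "0 < n" and \<eta>: "0 < \<eta>"
    obtain H :: "'a sgraph" where "verts H \<noteq> {}" "feasible r t (\<epsilon> / 2 * card (verts H)) H"
      using dense[of "\<epsilon> / 2", OF half_gt_zero[OF \<epsilon>] zero_less_one] by blast
    then show "eventually (\<lambda>N. density r t \<epsilon> n - \<eta> \<le> density r t \<epsilon> N) sequentially"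
      by (intro density_almost_increasing[OF r \<epsilon> n \<eta>])
  qed
  have g: "g \<epsilon> = L \<epsilon>" if "0 < \<epsilon>" for \<epsilon>
    unfolding g_def using lim[OF that] by (rule limI)
  have c: "c \<le> L \<epsilon>" if \<epsilon>: "0 < \<epsilon>" for \<epsilon>
  proof (rule field_le_epsilon)
    fix \<eta> :: real assume \<eta>: "0 < \<eta>"
    obtain G :: "'a sgraph" where G: "verts G \<noteq> {}" "feasible r t (\<epsilon> * card (verts G)) G"
      "(c - \<eta>) * (card (verts G))\<^sup>2 \<le> card (edges G)"
      using dense[OF \<epsilon> \<eta>] by blast
    define n where "n = card (verts G)"
    have "finite (verts G)" using G(2) by (simp add: feasible_def simple_graph_def)
    then have n: "0 < n" using G(1) by (simp add: n_def card_gt_0_iff)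
    obtain G' :: "nat sgraph" where G': "feasible r t (\<epsilon> * n) G'" "card (verts G') = n"
      "card (edges G) \<le> card (edges G')"
      using feasible_relabel[OF G(2) refl] unfolding n_def by blast
    have "(c - \<eta>) * (real n)\<^sup>2 \<le> real (card (edges G))" using G(3) by (simp add: n_def)
    also have "\<dots> \<le> RT r n (complete_graph t) (\<epsilon> * n)"
      unfolding of_nat_le_iff using G'(3) RT_ge[OF r G'(1,2)] by linarith
    finally have "c - \<eta> \<le> density r t \<epsilon> n"
      using n by (simp add: density_def pos_le_divide_eq)
    also have "\<dots> \<le> L \<epsilon>"
      unfolding L_def using n density_le_1[OF r] by (intro cSUP_upper bdd_aboveI2) auto
    finally show "c \<le> L \<epsilon> + \<eta>" by simp
  qed
  have mono: "L a \<le> L b" if "0 < a" "a \<le> b" for a b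
  proof (rule LIMSEQ_le)
    show "density r t a \<longlonglongrightarrow> L a" "density r t b \<longlonglongrightarrow> L b" using that by (auto intro: lim)
    have "density r t a n \<le> density r t b n" for n
      unfolding density_def using that(2)
      by (intro divide_right_mono of_nat_mono RT_mono r mult_right_mono) auto
    then show "\<exists>N. \<forall>n\<ge>N. density r t a n \<le> density r t b n" by blast
  qed
  \<comment> \<open>The inner limits increase with \<open>\<epsilon>\<close> and are bounded below
    by \<open>c\<close>, so they converge to their infimum from the right.\<close>
  have "(L \<longlongrightarrow> Inf (L ` ({0<..} \<inter> UNIV))) (at 0 within ({0<..} \<inter> UNIV))"
    by (rule Lim_right_bound[where K = c]) (auto intro: mono c)
  then have L: "(L \<longlongrightarrow> Inf (L ` {0<..})) (at_right 0)" by simp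
  have "eventually (\<lambda>\<epsilon>. L \<epsilon> = g \<epsilon>) (at_right 0)"
    by (rule eventually_mono[OF eventually_at_right_less]) (simp add: g)
  then have "(g \<longlongrightarrow> Inf (L ` {0<..})) (at_right 0)"
    using L by (rule Lim_transform_eventually[rotated])
  then have "Lim (at_right 0) g = Inf (L ` {0<..})"
    by (intro tendsto_Lim) auto
  moreover have "theta r (complete_graph t) = Lim (at_right 0) g"
    unfolding theta_def g_def density_def ..
  moreover have "c \<le> Inf (L ` {0<..})"
    using c by (intro cINF_greatest) auto
  ultimately show ?thesis by simp
qed

theorem theorem2:
  fixes r s l :: nat
  assumes "2 \<le> s" and "s \<le> r"
    and "l = (LEAST k::nat. 0 < k \<and> \<lceil>real r * 2 powi (- int k)\<rceil> < int s)"
  shows "theta r (complete_graph (r + s)) \<ge> 2 powi (- int l - 2)"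
proof -
  let ?P = "\<lambda>k::nat. 0 < k \<and> \<lceil>real r * 2 powi (- int k)\<rceil> < int s"
  have iff: "\<lceil>real r * 2 powi (- int k)\<rceil> < int s \<longleftrightarrow> r \<le> (s - 1) * 2 ^ k" for k
  proof -
    have "\<lceil>real r * 2 powi (- int k)\<rceil> < int s \<longleftrightarrow> \<lceil>real r / 2 ^ k\<rceil> \<le> int (s - 1)"
      using assms(1) by (auto simp: power_int_minus divide_inverse)
    also have "\<dots> \<longleftrightarrow> real r / 2 ^ k \<le> real (s - 1)"
      by (simp add: ceiling_le_iff)
    also have "\<dots> \<longleftrightarrow> real r \<le> real ((s - 1) * 2 ^ k)"
      by (simp add: pos_divide_le_eq)
    finally show ?thesis by (simp only: of_nat_le_iff)
  qed
  \<comment> \<open>The exponent \<open>r\<close> is a witness, without which the least number would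
    be unspecified.\<close>
  have "r \<le> 1 * 2 ^ r" by simp
  also have "\<dots> \<le> (s - 1) * 2 ^ r" using assms(1) by (intro mult_le_mono1) simp
  finally have "?P r" using assms(1,2) by (simp add: iff)
  then have "?P l" unfolding assms(3) by (rule LeastI)
  then have l: "0 < l" "r \<le> (s - 1) * 2 ^ l" by (simp_all add: iff)
  have lr: "2 ^ (l - 1) < r"
  \<comment> \<open>Minimality compares with \<open>l - 1\<close> only if that is positive; for
    \<open>l = 1\<close> the claim is \<open>1 < r\<close>, which follows from
    \<open>2 \<le> s\<close> and \<open>s \<le> r\<close>.\<close>
  proof (cases "l = 1")
    case True
    then show ?thesis using assms(1,2) by simp
  next
    case False
    then have "l - 1 < l" "0 < l - 1" using l(1) by auto
    have "l - 1 < (LEAST k. ?P k)" unfolding assms(3)[symmetric] by fact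
    then have "\<not> ?P (l - 1)" by (rule not_less_Least)
    then have "(s - 1) * 2 ^ (l - 1) < r" using \<open>0 < l - 1\<close> unfolding iff by (simp add: not_le)
    moreover have "1 * 2 ^ (l - 1) \<le> (s - 1) * 2 ^ (l - 1)"
      using assms(1) by (intro mult_le_mono1) simp
    ultimately show ?thesis by linarith
  qed
  have "0 < r" using assms(1,2) by simp
  then have "1 / 2 ^ (l + 2) \<le> theta r (complete_graph (r + s))"
    by (rule theta_lower_bound) (rule dense_feasible_graph[OF assms(1) l(1) lr l(2)])
  moreover have "2 powi (- int l - 2) = (1 / 2 ^ (l + 2) :: real)"
  proof -
    have "- int l - 2 = - int (l + 2)" by simp
    then show ?thesis by (simp only: power_int_minus power_int_of_nat inverse_eq_divide)
  qed
  ultimately show ?thesis by simp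
qed

end
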